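(* Let $\Omega\subset\mathbb{R}^2$ be a bounded domain and let $u$ be a (nonzero, real-valued) Dirichlet eigenfunction, $-\Delta u=\lambda u$ in $\Omega$, $u|_{\partial\Omega}=0$, that extends real-analytically to an open neighbourhood of $\overline\Omega$. Then the number of Neumann domains of $u$ is greater than or equal to the sum of the number of isolated local maxima of $u$ and the number of curves of local maxima of $u$.
   Context: Put $\Gamma^D=\partial\Omega$. Local maxima/minima are understood in the non-strict sense; for points of $\partial\Omega$ they are understood for the analytic extension of $u$. Put $\mathcal{C}=\{x\in\overline\Omega:\operatorname{grad}u(x)=0\}$; let $\mathcal{M}_+$, $\mathcal{M}_-$ be the sets of points of $\mathcal{C}$ that are local maxima, resp. local minima, of $u$, and let $\mathcal{S}=\mathcal{C}\setminus(\mathcal{M}_+\cup\mathcal{M}_-)$ be the set of saddle points (possibly degenerate). For $x\in\overline\Omega$ let $\gamma_x(t)$ be the integral curve of the vector field $-\operatorname{grad}u$ with $\gamma_x(0)=x$, followed forward and backward as long as it stays in $\overline\Omega$. It is known that in each time direction, for $x\in\Omega$, the curve either reaches $\Gamma^D$ in finite time or tends to a point of $\mathcal{C}$ as $t\to\pm\infty$; in the latter case the limit is denoted $\gamma_x(\pm\infty)$. For $x_0\in\mathcal{C}$ put $W^s(x_0)=\{x\in\overline\Omega:\gamma_x(+\infty)=x_0\}$, $W^u(x_0)=\{x\in\overline\Omega:\gamma_x(-\infty)=x_0\}$, and for $r\in\mathcal{S}$ put $L(r)=W^s(r)\cup W^u(r)$. The Neumann line set is $$\mathcal{N}(u)=\overline{\bigcup_{r\in\mathcal{S}}\partial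 L(r)\setminus\Gamma^D}\,\cup\,\mathcal{C},$$ with boundary and closure taken in $\mathbb{R}^2$. The Neumann domains of $u$ are the connected components of $\Omega\setminus\mathcal{N}(u)$. It is known that $\mathcal{M}_+$ is a disjoint union of isolated points (isolated local maxima) and simple closed curves, each of them isolated in $\mathcal{C}$; a curve of local maxima is one of these simple closed curves, i.e. a connected component of $\mathcal{M}_+$ which is a simple closed curve. *)

theory Defs
  imports "HOL-Analysis.Analysis" "HOL-Library.Equipollence"
begin

text \<open>Joint real-analyticity in two variables: near each point the function is the sum of a
  (necessarily absolutely) convergent double power series.\<close>

definition real_analytic_on :: "(real^2 \<Rightarrow> real) \<Rightarrow> (real^2) set \<Rightarrow> bool" where
  "real_analytic_on u U \<longleftrightarrow>
     (\<forall>a\<in>U. \<exists>c :: nat \<Rightarrow> nat \<Rightarrow> real. \<exists>e>0. \<forall>x\<in>ball a e.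
        ((\<lambda>(i, j). c i j * (x$1 - a$1) ^ i * (x$2 - a$2) ^ j) has_sum u x) UNIV)"

definition partial_deriv :: "'n \<Rightarrow> (real^'n::finite \<Rightarrow> real) \<Rightarrow> real^'n \<Rightarrow> real" where
  "partial_deriv i u x = deriv (\<lambda>t. u (x + t *\<^sub>R axis i 1)) 0"

definition grad :: "(real^'n::finite \<Rightarrow> real) \<Rightarrow> real^'n \<Rightarrow> real^'n" where
  "grad u x = (\<chi> i. partial_deriv i u x)"

definition laplacian :: "(real^'n::finite \<Rightarrow> real) \<Rightarrow> real^'n \<Rightarrow> real" where
  "laplacian u x = (\<Sum>i\<in>UNIV. partial_deriv i (partial_deriv i u) x)"

text \<open>In all that follows, \<open>u\<close> is the analytic extension of the eigenfunction to a neighbourhood of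
  \<open>closure \<Omega>\<close>. Near a point of \<open>closure \<Omega>\<close> this extension is determined by its values on \<open>\<Omega>\<close>.\<close>

definition critical_points :: "(real^2) set \<Rightarrow> (real^2 \<Rightarrow> real) \<Rightarrow> (real^2) set" where
  "critical_points \<Omega> u = {x \<in> closure \<Omega>. grad u x = 0}"

definition local_maxima :: "(real^2) set \<Rightarrow> (real^2 \<Rightarrow> real) \<Rightarrow> (real^2) set" where
  "local_maxima \<Omega> u = {x \<in> critical_points \<Omega> u. \<forall>\<^sub>F y in nhds x. u y \<le> u x}"

definition local_minima :: "(real^2) set \<Rightarrow> (real^2 \<Rightarrow> real) \<Rightarrow> (real^2) set" where
  "local_minima \<Omega> u = {x \<in> critical_points \<Omega> u. \<forall>\<^sub>F y in nhds x. u x \<le> u y}"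

definition saddle_points :: "(real^2) set \<Rightarrow> (real^2 \<Rightarrow> real) \<Rightarrow> (real^2) set" where
  "saddle_points \<Omega> u = critical_points \<Omega> u - (local_maxima \<Omega> u \<union> local_minima \<Omega> u)"

definition isolated_maxima :: "(real^2) set \<Rightarrow> (real^2 \<Rightarrow> real) \<Rightarrow> (real^2) set" where
  "isolated_maxima \<Omega> u = {x. x isolated_in local_maxima \<Omega> u}"

definition simple_closed_curve :: "(real^2) set \<Rightarrow> bool" where
  "simple_closed_curve K \<longleftrightarrow>
     (\<exists>g. simple_path g \<and> pathfinish g = pathstart g \<and> path_image g = K)"

definition curves_of_maxima :: "(real^2) set \<Rightarrow> (real^2 \<Rightarrow> real) \<Rightarrow> (real^2) set set" where
  "curves_of_maxima \<Omega> u = {K \<in> components (local_maxima \<Omega> u). simple_closed_curve K}"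

definition integral_curve_on ::
  "(real^2) set \<Rightarrow> (real^2 \<Rightarrow> real) \<Rightarrow> (real \<Rightarrow> real^2) \<Rightarrow> real set \<Rightarrow> bool" where
  "integral_curve_on \<Omega> u \<gamma> T \<longleftrightarrow>
     (\<forall>t\<in>T. \<gamma> t \<in> closure \<Omega> \<and> (\<gamma> has_vector_derivative - grad u (\<gamma> t)) (at t within T))"

text \<open>Integral curves of an analytic vector field are determined by their initial value, so the
  existentially quantified \<open>\<gamma>\<close> below is \<open>\<gamma>\<^sub>x\<close>, followed for as long as it stays in \<open>closure \<Omega>\<close>;
  the limit at \<open>\<plusminus>\<infinity>\<close> only makes sense if it stays there for all positive (negative) time.\<close>

definition stable_set :: "(real^2) set \<Rightarrow> (real^2 \<Rightarrow> real) \<Rightarrow> real^2 \<Rightarrow> (real^2) set" where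
  "stable_set \<Omega> u p =
     {x \<in> closure \<Omega>. \<exists>\<gamma>. integral_curve_on \<Omega> u \<gamma> {0..} \<and> \<gamma> 0 = x \<and> (\<gamma> \<longlongrightarrow> p) at_top}"

definition unstable_set :: "(real^2) set \<Rightarrow> (real^2 \<Rightarrow> real) \<Rightarrow> real^2 \<Rightarrow> (real^2) set" where
  "unstable_set \<Omega> u p =
     {x \<in> closure \<Omega>. \<exists>\<gamma>. integral_curve_on \<Omega> u \<gamma> {..0} \<and> \<gamma> 0 = x \<and> (\<gamma> \<longlongrightarrow> p) at_bot}"

definition neumann_line_set :: "(real^2) set \<Rightarrow> (real^2 \<Rightarrow> real) \<Rightarrow> (real^2) set" where
  "neumann_line_set \<Omega> u =
     closure ((\<Union>r\<in>saddle_points \<Omega> u. frontier (stable_set \<Omega> u r \<union> unstable_set \<Omega> u r))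
              - frontier \<Omega>)
     \<union> critical_points \<Omega> u"

definition neumann_domains :: "(real^2) set \<Rightarrow> (real^2 \<Rightarrow> real) \<Rightarrow> (real^2) set set" where
  "neumann_domains \<Omega> u = components (\<Omega> - neumann_line_set \<Omega> u)"

end

theory Submission
  imports Defs "HOL-Complex_Analysis.Complex_Analysis"
begin

text \<open>Every isolated local maximum and every curve of local maxima \<open>K\<close> attracts an open set under the
  ascending gradient flow, its basin, and different \<open>K\<close> have disjoint basins. A Neumann domain meeting
  the basin of \<open>K\<close> lies in it: at a point \<open>x\<close> of its boundary outside \<open>\<N>(u)\<close> the orbit cannot end at a
  local maximum or minimum, so it ends at a saddle point \<open>r\<close>; then \<open>x\<close> is interior to \<open>L(r)\<close>, hence
  close to \<open>x\<close> there are points of the basin in \<open>L(r)\<close> where \<open>u\<close> is smaller than \<open>u(r)\<close>, which is absurd.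
  The basin is not covered by \<open>\<N>(u)\<close>: either an open set of its points flows down out of
  \<open>closure \<Omega>\<close> or to local minima, or by Baire's theorem the stable set of one of the finitely many
  saddle points has interior points in the basin.

  The orbits converge because the critical set is simple. At critical points with \<open>u = 0\<close> the leading
  part of \<open>\<partial>\<^sub>1u - \<i> \<partial>\<^sub>2u\<close> is \<open>B z\<^sup>k\<close>, so they are isolated. At critical points with \<open>u \<noteq> 0\<close> the
  Hessian is nonzero, because its trace is, so the critical set lies on an analytic curve: it is
  locally a point or an arc of extrema. Local maxima have \<open>u > 0\<close> by the maximum principle and thus
  lie in \<open>\<Omega>\<close>.\<close>

text \<open>The delicate case is a curve of maxima: convergence of an orbit to a single point of it
  would call for a Lojasiewicz-type inequality. Attraction to extrema therefore only means that the
  distance to a compact, relatively open piece of the critical set tends to 0. Genuine convergence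
  is used at saddle points alone, where \<open>stable_set\<close> and \<open>unstable_set\<close>
  ask for it, and there it follows from isolation. A second obstacle is that continuity in the
  initial point wants a flow defined for all times, whereas the sets in the statement only see
  orbits inside \<open>closure \<Omega>\<close>. A cutoff field provides the former, and staying in
  \<open>closure \<Omega>\<close> is then checked separately. Only forward time is solved. Replacing
  \<open>u\<close> by \<open>- u\<close> yields everything about minima and descending orbits, which
  is why the facts live in locales that are instantiated twice. The inequality is proved as an
  injection, which makes sense whether or not the counts are finite.\<close>

no_notation fps_nth (infixl \<open>$\<close> 75)

section \<open>Double power series\<close>

text \<open>Absolute convergence at the corner \<open>(r, r)\<close>, hence on the whole closed
  bidisc of radius \<open>r\<close>. The field is generic so that one theory serves the real series
  and its complexification.\<close>

definition pconv :: "(nat \<Rightarrow> nat \<Rightarrow> 'a::{real_normed_field,banach}) \<Rightarrow> real \<Rightarrow> bool" where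
  "pconv c r \<longleftrightarrow> (\<lambda>(i, j). norm (c i j) * r ^ i * r ^ j) summable_on UNIV"

definition pser :: "(nat \<Rightarrow> nat \<Rightarrow> 'a::{real_normed_field,banach}) \<Rightarrow> 'a \<Rightarrow> 'a \<Rightarrow> 'a" where
  "pser c x y = (\<Sum>\<^sub>\<infinity>(i, j)\<in>UNIV. c i j * x ^ i * y ^ j)"

definition dx :: "(nat \<Rightarrow> nat \<Rightarrow> 'a::{real_normed_field,banach}) \<Rightarrow> nat \<Rightarrow> nat \<Rightarrow> 'a" where
  "dx c i j = of_nat (Suc i) * c (Suc i) j"

definition dy :: "(nat \<Rightarrow> nat \<Rightarrow> 'a::{real_normed_field,banach}) \<Rightarrow> nat \<Rightarrow> nat \<Rightarrow> 'a" where
  "dy c i j = of_nat (Suc j) * c i (Suc j)"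

text \<open>Exchanging the variables reduces facts about \<open>dy\<close> to facts about
  \<open>dx\<close>, and later the case \<open>c 0 2 < 0\<close> to
  \<open>c 2 0 < 0\<close>.\<close>

definition flip :: "(nat \<Rightarrow> nat \<Rightarrow> 'a) \<Rightarrow> nat \<Rightarrow> nat \<Rightarrow> 'a" where
  "flip c i j = c j i"

lemma pconv_abs_summable:
  assumes "pconv c r" "norm x \<le> r" "norm y \<le> r"
  shows "(\<lambda>p. norm (case p of (i, j) \<Rightarrow> c i j * x ^ i * y ^ j)) summable_on UNIV"
proof -
  have r: "r \<ge> 0" using assms(2) norm_ge_zero[of x] by linarith
  have "(\<lambda>p. norm (case p of (i, j) \<Rightarrow> c i j * x ^ i * y ^ j)) summable_on UNIV"
  proof (rule summable_on_comparison_test[OF assms(1)[unfolded pconv_def]])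
    fix p :: "nat \<times> nat"
    obtain i j where p: "p = (i, j)" by (cases p)
    have "norm (c i j) * norm x ^ i * norm y ^ j \<le> norm (c i j) * r ^ i * r ^ j"
      by (intro mult_mono power_mono order_refl mult_nonneg_nonneg zero_le_power norm_ge_zero assms r)
    then show "norm (case p of (i, j) \<Rightarrow> c i j * x ^ i * y ^ j) \<le> (case p of (i, j) \<Rightarrow> norm (c i j) * r ^ i * r ^ j)"
      by (simp add: p norm_mult norm_power)
  qed auto
  then show ?thesis .
qed

lemma pser_has_sum:
  assumes "pconv c r" "norm x \<le> r" "norm y \<le> r"
  shows "((\<lambda>(i, j). c i j * x ^ i * y ^ j) has_sum pser c x y) UNIV"
  unfolding pser_def
  by (rule has_sum_infsum) (rule abs_summable_summable[OF pconv_abs_summable[OF assms]])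

lemma pconv_mono:
  assumes "pconv c r" "0 \<le> s" "s \<le> r"
  shows "pconv c s"
  unfolding pconv_def
proof (rule summable_on_comparison_test[OF assms(1)[unfolded pconv_def]])
  fix p :: "nat \<times> nat"
  show "(case p of (i, j) \<Rightarrow> norm (c i j) * s ^ i * s ^ j) \<le> (case p of (i, j) \<Rightarrow> norm (c i j) * r ^ i * r ^ j)"
    using assms by (cases p) (auto intro!: mult_mono power_mono)
qed (use assms in auto)

lemma pconv_flip [simp]: "pconv (flip c) r \<longleftrightarrow> pconv c r"
  unfolding pconv_def
  by (rule summable_on_reindex_bij_witness[where i = prod.swap and j = prod.swap])
    (auto simp: mult_ac flip_def)

lemma pser_flip: "pser (flip c) x y = pser c y x"
  unfolding pser_def
  by (rule infsum_reindex_bij_witness[where i = prod.swap and j = prod.swap])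
    (auto simp: mult_ac flip_def)

lemma dx_flip: "dx (flip c) = flip (dy c)" and dy_flip: "dy (flip c) = flip (dx c)"
  by (simp_all add: fun_eq_iff dx_def dy_def flip_def)

text \<open>The factor \<open>Suc i\<close> produced by differentiation is absorbed by the geometric
  decay of \<open>(s / r) ^ i\<close>, at the price of a smaller radius.\<close>

lemma pconv_dx:
  fixes c :: "nat \<Rightarrow> nat \<Rightarrow> 'a::{real_normed_field,banach}"
  assumes "pconv c r" "0 \<le> s" "s < r"
  shows "pconv (dx c) s"
proof -
  have "(\<lambda>n. of_nat n * (s / r) ^ n) \<longlonglongrightarrow> 0"
    using assms by (intro powser_times_n_limit_0) auto
  then have "Bseq (\<lambda>n. of_nat n * (s / r) ^ n)"
    by (rule convergent_imp_Bseq[OF convergentI])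
  moreover have "(\<lambda>n. (s / r) ^ n) \<longlonglongrightarrow> 0"
    using assms by (intro LIMSEQ_power_zero) auto
  then have "Bseq (\<lambda>n. (s / r) ^ n)"
    by (rule convergent_imp_Bseq[OF convergentI])
  ultimately obtain K L where K: "\<And>n. \<bar>of_nat n * (s / r) ^ n\<bar> \<le> K" and L: "\<And>n. \<bar>(s / r) ^ n\<bar> \<le> L"
    by (auto simp: Bseq_def)
  \<comment> \<open>\<open>K + L\<close> bounds \<open>(i + 1) * (s / r) ^ i\<close>; dividing by
    \<open>r\<close> compensates for the exponent \<open>Suc i\<close> that goes with the
    coefficient \<open>c (Suc i) j\<close>.\<close>
  define M where "M = (K + L) / r"
  have bd: "of_nat (Suc i) * s ^ i \<le> M * r ^ Suc i" for i
  proof -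
    have "of_nat (Suc i) * (s / r) ^ i \<le> K + L"
      using K[of i] L[of i] by (simp add: ring_distribs)
    then have "of_nat (Suc i) * (s / r) ^ i * r ^ i \<le> (K + L) * r ^ i"
      using assms by (intro mult_right_mono) auto
    then show ?thesis using assms by (simp add: M_def power_divide)
  qed
  have "(\<lambda>(i, j). norm (c i j) * r ^ i * r ^ j) summable_on range (\<lambda>(i, j). (Suc i, j))"
    using assms(1) unfolding pconv_def by (rule summable_on_subset_banach) auto
  then have 1: "((\<lambda>(i, j). norm (c i j) * r ^ i * r ^ j) \<circ> (\<lambda>(i, j). (Suc i, j))) summable_on UNIV"
    by (subst (asm) summable_on_reindex) (auto simp: inj_on_def)
  have 2: "(\<lambda>p. M * ((\<lambda>(i, j). norm (c i j) * r ^ i * r ^ j) \<circ> (\<lambda>(i, j). (Suc i, j))) p) summable_on UNIV"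
    by (rule summable_on_cmult_right[OF 1])
  show ?thesis unfolding pconv_def
  proof (rule summable_on_comparison_test[OF 2])
    fix p :: "nat \<times> nat"
    obtain i j where p: "p = (i, j)" by (cases p)
    have "(of_nat (Suc i) * s ^ i) * norm (c (Suc i) j) * s ^ j \<le> (M * r ^ Suc i) * norm (c (Suc i) j) * r ^ j"
    proof (rule mult_mono[OF mult_right_mono[OF bd] power_mono])
      show "0 \<le> M * r ^ Suc i * norm (c (Suc i) j)"
        by (rule mult_nonneg_nonneg[OF order_trans[OF _ bd[of i]]]) (use assms(2,3) in auto)
    qed (use assms(2,3) in auto)
    then show "(case p of (i, j) \<Rightarrow> norm (dx c i j) * s ^ i * s ^ j)
        \<le> M * ((\<lambda>(i, j). norm (c i j) * r ^ i * r ^ j) \<circ> (\<lambda>(i, j). (Suc i, j))) p"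
      by (simp add: p dx_def norm_mult mult_ac del: of_nat_Suc power_Suc)
  qed (use assms in auto)
qed

lemma pconv_dy:
  fixes c :: "nat \<Rightarrow> nat \<Rightarrow> 'a::{real_normed_field,banach}"
  assumes "pconv c r" "0 \<le> s" "s < r"
  shows "pconv (dy c) s"
  using pconv_dx[of "flip c" r s] assms by (simp add: dx_flip)

text \<open>Summing over \<open>j\<close> first leaves a power series in \<open>x\<close> alone, so
  that one-variable term-by-term differentiation becomes available.\<close>

lemma pser_sums:
  assumes "pconv c r" "norm x \<le> r" "norm y \<le> r"
  shows "(\<lambda>i. (\<Sum>\<^sub>\<infinity>j. c i j * y ^ j) * x ^ i) sums pser c x y"
    and "x \<noteq> 0 \<Longrightarrow> (\<lambda>j. c i j * y ^ j) summable_on UNIV"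
proof -
  have s: "(\<lambda>(i, j). c i j * x ^ i * y ^ j) summable_on Sigma UNIV (\<lambda>_. UNIV)"
    using abs_summable_summable[OF pconv_abs_summable[OF assms]] by simp
  have row: "(\<Sum>\<^sub>\<infinity>j. c i j * x ^ i * y ^ j) = (\<Sum>\<^sub>\<infinity>j. c i j * y ^ j) * x ^ i" for i
  proof -
    have "(\<Sum>\<^sub>\<infinity>j. c i j * x ^ i * y ^ j) = (\<Sum>\<^sub>\<infinity>j. (c i j * y ^ j) * x ^ i)"
      by (simp add: mult_ac)
    then show ?thesis by (simp add: infsum_cmult_left')
  qed
  have "((\<lambda>i. \<Sum>\<^sub>\<infinity>j. c i j * x ^ i * y ^ j) has_sum pser c x y) UNIV"
    using has_sum_infsum[OF summable_on_Sigma_banach[OF s]] infsum_Sigma'_banach[OF s]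
    by (simp add: pser_def)
  then show "(\<lambda>i. (\<Sum>\<^sub>\<infinity>j. c i j * y ^ j) * x ^ i) sums pser c x y"
    using has_sum_imp_sums by (simp add: row)
  assume "x \<noteq> 0"
  have "(\<lambda>p. case p of (i, j) \<Rightarrow> c i j * x ^ i * y ^ j) summable_on range (Pair i)"
    using s by (rule summable_on_subset_banach) auto
  then have "((\<lambda>p. case p of (i, j) \<Rightarrow> c i j * x ^ i * y ^ j) \<circ> Pair i) summable_on UNIV"
    by (subst (asm) summable_on_reindex) (auto simp: inj_on_def)
  then have "(\<lambda>j. x ^ i * (c i j * y ^ j)) summable_on UNIV"
    by (simp add: o_def mult_ac)
  then show "(\<lambda>j. c i j * y ^ j) summable_on UNIV"
    using \<open>x \<noteq> 0\<close> by (subst (asm) summable_on_cmult_right') auto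
qed

lemma pser_0 [simp]: "pser c 0 0 = c 0 0"
proof -
  have "((\<lambda>(i, j). c i j * 0 ^ i * 0 ^ j) has_sum c 0 0) UNIV"
    by (rule has_sum_finite_neutralI[of "{(0, 0)}"]) (auto simp: power_0_left intro: ccontr)
  then show ?thesis unfolding pser_def by (rule infsumI)
qed

lemma DERIV_pser_x:
  fixes c :: "nat \<Rightarrow> nat \<Rightarrow> 'a::{real_normed_field,banach}"
  assumes "pconv c r" "norm x < r" "norm y < r"
  shows "((\<lambda>x. pser c x y) has_field_derivative pser (dx c) x y) (at x)"
proof -
  define a where "a i = (\<Sum>\<^sub>\<infinity>j. c i j * y ^ j)" for i
  have sums: "(\<lambda>i. a i * z ^ i) sums pser c z y" if "norm z < r" for z
    using pser_sums(1)[OF assms(1), of z y] that assms by (simp add: a_def)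
  have "diffs a i = (\<Sum>\<^sub>\<infinity>j. dx c i j * y ^ j)" for i
    by (simp add: diffs_def a_def dx_def mult.assoc infsum_cmult_right' del: of_nat_Suc)
  \<comment> \<open>An intermediate radius, because \<open>dx c\<close> is only known to converge
    strictly inside \<open>r\<close>.\<close>
  moreover obtain s where s: "norm x < s" "norm y < s" "s < r"
    using assms dense[of "max (norm x) (norm y)" r] by auto
  moreover have "0 \<le> s" using s(1) norm_ge_zero[of x] by linarith
  ultimately have 1: "(\<lambda>i. diffs a i * x ^ i) sums pser (dx c) x y"
    using pser_sums(1)[OF pconv_dx[OF assms(1)], of s x y] by simp
  have "((\<lambda>z. \<Sum>n. a n * z ^ n) has_field_derivative (\<Sum>n. diffs a n * x ^ n)) (at x)"
    by (rule termdiffs_strong'[of r]) (use sums assms in \<open>auto simp: sums_iff\<close>)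
  then have "((\<lambda>z. \<Sum>n. a n * z ^ n) has_field_derivative pser (dx c) x y) (at x)"
    using 1 by (simp add: sums_iff)
  then show ?thesis
  proof (rule has_field_derivative_transform_within_open[of _ _ _ "ball 0 r"])
    show "(\<Sum>n. a n * z ^ n) = pser c z y" if "z \<in> ball 0 r" for z
      using sums[of z] that by (simp add: sums_iff)
  qed (use assms in auto)
qed

lemma DERIV_pser_y:
  fixes c :: "nat \<Rightarrow> nat \<Rightarrow> 'a::{real_normed_field,banach}"
  assumes "pconv c r" "norm x < r" "norm y < r"
  shows "((\<lambda>y. pser c x y) has_field_derivative pser (dy c) x y) (at y)"
  using DERIV_pser_x[of "flip c" r y x] assms by (simp add: pser_flip dx_flip)

text \<open>The index pairs are enumerated by \<open>prod_decode\<close> to get a sequence of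
  polynomials, to which the Weierstrass M-test applies. Continuity and holomorphy of the sum both
  rest on this.\<close>

lemma pser_uniform_limit:
  fixes c :: "nat \<Rightarrow> nat \<Rightarrow> 'a::{real_normed_field,banach}"
  assumes "pconv c r" "r \<ge> 0"
  shows "uniform_limit {p. norm (fst p) \<le> r \<and> norm (snd p) \<le> r}
    (\<lambda>n p. \<Sum>k<n. case prod_decode k of (i, j) \<Rightarrow> c i j * fst p ^ i * snd p ^ j)
    (\<lambda>p. pser c (fst p) (snd p)) sequentially"
proof -
  define M where "M k = (case prod_decode k of (i, j) \<Rightarrow> norm (c i j) * r ^ i * r ^ j)" for k
  let ?A = "{p::'a\<times>'a. norm (fst p) \<le> r \<and> norm (snd p) \<le> r}"
  let ?f = "\<lambda>k (p::'a\<times>'a). case prod_decode k of (i, j) \<Rightarrow> c i j * fst p ^ i * snd p ^ j"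
  have "M summable_on UNIV"
    unfolding M_def using assms(1) unfolding pconv_def
    by (subst summable_on_reindex_bij_betw[OF bij_prod_decode])
  then have M: "summable M"
    by (meson has_sum_imp_sums has_sum_infsum sums_summable)
  have "uniform_limit ?A (\<lambda>n p. \<Sum>k<n. ?f k p) (\<lambda>p. suminf (\<lambda>k. ?f k p)) sequentially"
  proof (rule Weierstrass_m_test[OF _ M])
    fix k and p :: "'a \<times> 'a" assume p: "p \<in> ?A"
    obtain i j where k: "prod_decode k = (i, j)" by (cases "prod_decode k")
    show "norm (?f k p) \<le> M k"
      using p assms(2) unfolding M_def k
      by (auto simp: norm_mult norm_power intro!: mult_mono power_mono)
  qed
  moreover have "suminf (\<lambda>k. ?f k p) = pser c (fst p) (snd p)" if "p \<in> ?A" for p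
  proof -
    have "((\<lambda>k. ?f k p) has_sum pser c (fst p) (snd p)) UNIV"
      using has_sum_reindex_bij_betw[OF bij_prod_decode, of "\<lambda>(i, j). c i j * fst p ^ i * snd p ^ j"]
        pser_has_sum[OF assms(1), of "fst p" "snd p"] that by auto
    then show ?thesis by (rule sums_unique[OF has_sum_imp_sums, symmetric])
  qed
  ultimately show ?thesis
    by (subst uniform_limit_cong'[of _ _ "\<lambda>n p. \<Sum>k<n. ?f k p" _ "\<lambda>p. suminf (\<lambda>k. ?f k p)"]) auto
qed

lemma continuous_on_pser:
  fixes c :: "nat \<Rightarrow> nat \<Rightarrow> 'a::{real_normed_field,banach}"
  assumes "pconv c r" "r \<ge> 0"
  shows "continuous_on {p. norm (fst p) \<le> r \<and> norm (snd p) \<le> r} (\<lambda>p. pser c (fst p) (snd p))"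
  by (rule uniform_limit_theorem[OF _ pser_uniform_limit[OF assms]])
    (auto intro!: always_eventually continuous_intros continuous_on_sum simp: case_prod_unfold)

text \<open>Holomorphy is only claimed along a curve \<open>(f w, g w)\<close>, where the partial
  sums are polynomials in \<open>f\<close> and \<open>g\<close>; this avoids a notion of holomorphy
  in two variables.\<close>

lemma holomorphic_pser:
  assumes "pconv c r" "r \<ge> 0" "open S" "f holomorphic_on S" "g holomorphic_on S"
    and "\<And>w. w \<in> S \<Longrightarrow> norm (f w) \<le> r" "\<And>w. w \<in> S \<Longrightarrow> norm (g w) \<le> r"
  shows "(\<lambda>w. pser c (f w) (g w)) holomorphic_on S"
proof (rule holomorphic_uniform_sequence[OF \<open>open S\<close>])
  show "(\<lambda>w. \<Sum>k<n. case prod_decode k of (i, j) \<Rightarrow> c i j * f w ^ i * g w ^ j) holomorphic_on S" for n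
    using assms by (auto simp: case_prod_unfold intro!: holomorphic_intros)
  fix x assume "x \<in> S"
  then obtain d where d: "0 < d" "cball x d \<subseteq> S"
    using \<open>open S\<close> open_contains_cball by blast
  have "uniform_limit (cball x d)
    (\<lambda>n w. \<Sum>k<n. case prod_decode k of (i, j) \<Rightarrow> c i j * fst (f w, g w) ^ i * snd (f w, g w) ^ j)
    (\<lambda>w. pser c (fst (f w, g w)) (snd (f w, g w))) sequentially"
    by (rule uniform_limit_compose'[OF pser_uniform_limit[OF assms(1,2)]])
      (use d assms in auto)
  then show "\<exists>d>0. cball x d \<subseteq> S \<and>
     uniform_limit (cball x d)
      (\<lambda>n w. \<Sum>k<n. case prod_decode k of (i, j) \<Rightarrow> c i j * f w ^ i * g w ^ j)
      (\<lambda>w. pser c (f w) (g w)) sequentially"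
    using d by auto
qed

section \<open>Complexification of real double series\<close>

lemma pconv_of_real [simp]:
  "pconv (\<lambda>i j. of_real (c i j) :: 'a::{real_normed_field,banach}) r \<longleftrightarrow> pconv c r"
  by (simp add: pconv_def)

lemma pser_of_real:
  assumes "pconv c r" "\<bar>x\<bar> \<le> r" "\<bar>y\<bar> \<le> r"
  shows "pser (\<lambda>i j. complex_of_real (c i j)) (of_real x) (of_real y) = of_real (pser c x y)"
proof -
  have "((\<lambda>p. complex_of_real (case p of (i, j) \<Rightarrow> c i j * x ^ i * y ^ j)) has_sum of_real (pser c x y)) UNIV"
    using pser_has_sum[OF assms(1)] assms(2,3) by (intro has_sum_of_real) auto
  then have "((\<lambda>(i, j). complex_of_real (c i j) * of_real x ^ i * of_real y ^ j)
      has_sum of_real (pser c x y)) UNIV"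
    by (rule has_sum_cong[THEN iffD1, rotated]) auto
  then show ?thesis unfolding pser_def by (rule infsumI)
qed

section \<open>Real-analytic functions of two variables\<close>

text \<open>The expansion is claimed on the Euclidean ball, while \<open>pconv c r\<close> makes the
  series converge on the larger square around it.\<close>

definition expands :: "(real^2 \<Rightarrow> real) \<Rightarrow> real^2 \<Rightarrow> (nat \<Rightarrow> nat \<Rightarrow> real) \<Rightarrow> real \<Rightarrow> bool" where
  "expands u a c r \<longleftrightarrow> r > 0 \<and> pconv c r \<and> (\<forall>x\<in>ball a r. u x = pser c (x$1 - a$1) (x$2 - a$2))"

lemma mem_ball_vec2:
  fixes x a :: "real^2"
  assumes "x \<in> ball a r"
  shows "\<bar>x$1 - a$1\<bar> < r" "\<bar>x$2 - a$2\<bar> < r"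
  using assms component_le_norm_cart[of "x - a" 1] component_le_norm_cart[of "x - a" 2]
  by (auto simp: dist_norm norm_minus_commute)

lemma vec2_eqI: "x$1 = y$1 \<Longrightarrow> x$2 = y$2 \<Longrightarrow> x = (y::'a^2)"
  by (simp add: vec_eq_iff forall_2)

lemma norm_vec2: "norm (x::real^2) = sqrt ((x$1)\<^sup>2 + (x$2)\<^sup>2)"
  by (simp add: norm_vec_def L2_set_def UNIV_2)

lemma dist_vec2_le: "dist (a::real^2) b \<le> \<bar>a$1 - b$1\<bar> + \<bar>a$2 - b$2\<bar>"
proof -
  have "sqrt ((a$1 - b$1)\<^sup>2 + (a$2 - b$2)\<^sup>2) \<le> sqrt ((a$1 - b$1)\<^sup>2) + sqrt ((a$2 - b$2)\<^sup>2)"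
    by (rule sqrt_add_le_add_sqrt) auto
  then show ?thesis by (simp add: dist_norm norm_vec2)
qed

lemma axis_nth_2 [simp]:
  "axis (1::2) (x::'a::zero) $ 1 = x" "axis (1::2) (x::'a::zero) $ 2 = 0"
  "axis (2::2) (x::'a::zero) $ 1 = 0" "axis (2::2) (x::'a::zero) $ 2 = x"
  by (simp_all add: axis_def)

lemma real_analytic_on_expands:
  assumes "real_analytic_on u U" "a \<in> U"
  obtains c r where "expands u a c r"
proof -
  obtain c e where e: "e > 0"
    and h: "\<And>x. x \<in> ball a e \<Longrightarrow> ((\<lambda>(i, j). c i j * (x$1 - a$1) ^ i * (x$2 - a$2) ^ j) has_sum u x) UNIV"
    using assms unfolding real_analytic_on_def by blast
  \<comment> \<open>With \<open>r = e / 3\<close> the corner \<open>a + (r, r)\<close> is at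
    distance at most \<open>2 * r < e\<close>, so the given sum converges there; for real terms this
    convergence is absolute, as \<open>pconv\<close> demands.\<close>
  define r where "r = e / 3"
  define x where "x = a + (\<chi> i. r)"
  have "dist x a \<le> 2 * r" using dist_vec2_le[of x a] e by (simp add: x_def r_def)
  then have "x \<in> ball a e" using e by (simp add: r_def dist_commute)
  then have "(\<lambda>(i, j). c i j * r ^ i * r ^ j) summable_on UNIV"
    using h[of x] by (auto simp: x_def summable_on_def)
  then have "(\<lambda>p. norm (case p of (i, j) \<Rightarrow> c i j * r ^ i * r ^ j)) summable_on UNIV"
    by (subst (asm) summable_on_iff_abs_summable_on_real)
  moreover have "norm (case p of (i, j) \<Rightarrow> c i j * r ^ i * r ^ j)
      = (case p of (i, j) \<Rightarrow> norm (c i j) * r ^ i * r ^ j)" for p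
    using e by (cases p) (simp add: abs_mult r_def)
  ultimately have "pconv c r" unfolding pconv_def by simp
  moreover have "u x = pser c (x$1 - a$1) (x$2 - a$2)" if "x \<in> ball a r" for x
    using h[of x] that e by (auto simp: r_def pser_def intro!: infsumI[symmetric])
  ultimately have "expands u a c r" using e by (simp add: expands_def r_def)
  then show ?thesis by (rule that)
qed

lemma expands_imp_real_analytic:
  assumes "\<And>a. a \<in> U \<Longrightarrow> \<exists>c r. expands u a c r"
  shows "real_analytic_on u U"
  unfolding real_analytic_on_def
proof
  fix a assume "a \<in> U"
  then obtain c r where c: "expands u a c r" using assms by blast
  show "\<exists>c e. 0 < e \<and> (\<forall>x\<in>ball a e. ((\<lambda>(i, j). c i j * (x$1 - a$1) ^ i * (x$2 - a$2) ^ j) has_sum u x) UNIV)"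
  proof (intro exI[of _ c] exI[of _ r] conjI ballI)
    show "r > 0" using c by (simp add: expands_def)
    fix x assume x: "x \<in> ball a r"
    show "((\<lambda>(i, j). c i j * (x$1 - a$1) ^ i * (x$2 - a$2) ^ j) has_sum u x) UNIV"
      using pser_has_sum[of c r "x$1 - a$1" "x$2 - a$2"] mem_ball_vec2[OF x] c x
      by (simp add: expands_def)
  qed
qed

lemma expands_mono: "expands u a c r \<Longrightarrow> 0 < s \<Longrightarrow> s \<le> r \<Longrightarrow> expands u a c s"
  using pconv_mono[of c r s] by (auto simp: expands_def)

lemma expands_DERIV:
  fixes x a :: "real^2"
  assumes "expands u a c r" "x \<in> ball a r"
  shows "((\<lambda>t. u (x + t *\<^sub>R axis 1 1)) has_field_derivative pser (dx c) (x$1 - a$1) (x$2 - a$2)) (at 0)"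
    and "((\<lambda>t. u (x + t *\<^sub>R axis 2 1)) has_field_derivative pser (dy c) (x$1 - a$1) (x$2 - a$2)) (at 0)"
proof -
  have c: "pconv c r" "\<And>x. x \<in> ball a r \<Longrightarrow> u x = pser c (x$1 - a$1) (x$2 - a$2)"
    using assms by (auto simp: expands_def)
  have op: "open {t::real. x + t *\<^sub>R axis i 1 \<in> ball a r}" for i :: 2
  proof -
    have "open ((\<lambda>t::real. x + t *\<^sub>R axis i 1) -` ball a r)"
      by (rule open_vimage) (auto intro!: continuous_intros)
    then show ?thesis by (simp add: vimage_def)
  qed
  have "((\<lambda>t. pser c ((x$1 - a$1) + t) (x$2 - a$2)) has_field_derivative pser (dx c) (x$1 - a$1) (x$2 - a$2))
      (at 0)"
    using DERIV_pser_x[OF c(1), of "x$1 - a$1" "x$2 - a$2"] mem_ball_vec2[OF assms(2)]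
      DERIV_shift[of "\<lambda>t. pser c t (x$2 - a$2)" _ 0 "x$1 - a$1"] by (simp add: add.commute)
  then show "((\<lambda>t. u (x + t *\<^sub>R axis 1 1)) has_field_derivative pser (dx c) (x$1 - a$1) (x$2 - a$2)) (at 0)"
    by (rule has_field_derivative_transform_within_open[OF _ op[of 1]])
      (use assms(2) c(2) in \<open>auto simp: algebra_simps\<close>)
  have "((\<lambda>t. pser c (x$1 - a$1) ((x$2 - a$2) + t)) has_field_derivative pser (dy c) (x$1 - a$1) (x$2 - a$2))
      (at 0)"
    using DERIV_pser_y[OF c(1), of "x$1 - a$1" "x$2 - a$2"] mem_ball_vec2[OF assms(2)]
      DERIV_shift[of "\<lambda>t. pser c (x$1 - a$1) t" _ 0 "x$2 - a$2"] by (simp add: add.commute)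
  then show "((\<lambda>t. u (x + t *\<^sub>R axis 2 1)) has_field_derivative pser (dy c) (x$1 - a$1) (x$2 - a$2)) (at 0)"
    by (rule has_field_derivative_transform_within_open[OF _ op[of 2]])
      (use assms(2) c(2) in \<open>auto simp: algebra_simps\<close>)
qed

lemma expands_partial:
  assumes "expands u a c r" "0 < s" "s < r"
  shows "expands (partial_deriv 1 u) a (dx c) s" "expands (partial_deriv 2 u) a (dy c) s"
  using expands_DERIV[OF assms(1)] pconv_dx[of c r s] pconv_dy[of c r s] assms
  by (auto simp: expands_def partial_deriv_def intro!: DERIV_imp_deriv)

lemma expands_at: "expands u a c r \<Longrightarrow> u a = c 0 0"
  by (simp add: expands_def)

lemma expands_continuous:
  assumes "expands u a c r"
  shows "continuous_on (ball a r) u"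
proof -
  have pc: "pconv c r" "0 \<le> r" using assms by (auto simp: expands_def)
  have "continuous_on (ball a r) (\<lambda>x. (x$1 - a$1, x$2 - a$2))"
    by (intro continuous_intros)
  moreover have "(x$1 - a$1, x$2 - a$2) \<in> {p. norm (fst p) \<le> r \<and> norm (snd p) \<le> r}" if "x \<in> ball a r" for x
    using mem_ball_vec2[OF that] by simp
  ultimately have "continuous_on (ball a r) (\<lambda>x. pser c (fst (x$1 - a$1, x$2 - a$2)) (snd (x$1 - a$1, x$2 - a$2)))"
    by (intro continuous_on_compose2[OF continuous_on_pser[OF pc]]) blast+
  moreover have "pser c (fst (x$1 - a$1, x$2 - a$2)) (snd (x$1 - a$1, x$2 - a$2)) = u x" if "x \<in> ball a r" for x
    using assms that by (simp add: expands_def)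
  ultimately show ?thesis by (rule continuous_on_eq)
qed

lemma expands_lincomb:
  assumes "expands u a c r" "expands v a d r"
  shows "expands (\<lambda>x. \<alpha> * u x + \<beta> * v x) a (\<lambda>i j. \<alpha> * c i j + \<beta> * d i j) r"
proof -
  have pc: "pconv c r" "pconv d r" "r > 0" using assms by (auto simp: expands_def)
  have h: "((\<lambda>(i, j). (\<alpha> * c i j + \<beta> * d i j) * x ^ i * y ^ j) has_sum (\<alpha> * pser c x y + \<beta> * pser d x y)) UNIV"
    if "\<bar>x\<bar> \<le> r" "\<bar>y\<bar> \<le> r" for x y
  proof -
    have "((\<lambda>p. \<alpha> * (case p of (i, j) \<Rightarrow> c i j * x ^ i * y ^ j) + \<beta> * (case p of (i, j) \<Rightarrow> d i j * x ^ i * y ^ j))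
        has_sum (\<alpha> * pser c x y + \<beta> * pser d x y)) UNIV"
      using that by (intro has_sum_add has_sum_cmult_right pser_has_sum[OF pc(1)] pser_has_sum[OF pc(2)]) auto
    then show ?thesis
      by (rule has_sum_cong[THEN iffD1, rotated]) (auto simp: algebra_simps)
  qed
  have "(\<lambda>(i, j). (\<alpha> * c i j + \<beta> * d i j) * r ^ i * r ^ j) summable_on UNIV"
    using h[of r r] pc by (auto simp: summable_on_def)
  then have "(\<lambda>p. norm (case p of (i, j) \<Rightarrow> (\<alpha> * c i j + \<beta> * d i j) * r ^ i * r ^ j)) summable_on UNIV"
    by (subst (asm) summable_on_iff_abs_summable_on_real)
  then have "(\<lambda>(i, j). norm (\<alpha> * c i j + \<beta> * d i j) * r ^ i * r ^ j) summable_on UNIV"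
    by (rule summable_on_cong[THEN iffD1, rotated]) (use pc in \<open>auto simp: abs_mult\<close>)
  moreover have "\<alpha> * pser c x y + \<beta> * pser d x y = pser (\<lambda>i j. \<alpha> * c i j + \<beta> * d i j) x y"
    if "\<bar>x\<bar> \<le> r" "\<bar>y\<bar> \<le> r" for x y
    using infsumI[OF h[OF that]] by (simp add: pser_def)
  ultimately show ?thesis
    using assms by (simp add: expands_def pconv_def mem_ball_vec2[THEN less_imp_le])
qed

lemma real_analytic_on_partial:
  assumes "real_analytic_on u U"
  shows "real_analytic_on (partial_deriv i u) U"
proof (rule expands_imp_real_analytic)
  fix a assume "a \<in> U"
  then obtain c r where c: "expands u a c r" using real_analytic_on_expands[OF assms] by blast
  then have "0 < r / 2" "r / 2 < r" by (auto simp: expands_def)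
  from expands_partial[OF c this] show "\<exists>c r. expands (partial_deriv i u) a c r"
    using exhaust_2[of i] by auto
qed

lemma real_analytic_on_lincomb:
  assumes "real_analytic_on u U" "real_analytic_on v U"
  shows "real_analytic_on (\<lambda>x. \<alpha> * u x + \<beta> * v x) U"
proof (rule expands_imp_real_analytic)
  fix a assume "a \<in> U"
  then obtain c r d s where c: "expands u a c r" and d: "expands v a d s"
    using real_analytic_on_expands assms by metis
  then have "0 < min r s" by (auto simp: expands_def)
  then show "\<exists>c r. expands (\<lambda>x. \<alpha> * u x + \<beta> * v x) a c r"
    using expands_lincomb[OF expands_mono[OF c, of "min r s"] expands_mono[OF d, of "min r s"]] by auto
qed

lemma real_analytic_on_continuous:
  assumes "real_analytic_on u U"
  shows "a \<in> U \<Longrightarrow> isCont u a"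
    and "continuous_on U u"
proof -
  have *: "isCont u a" if a: "a \<in> U" for a
  proof -
    obtain c r where c: "expands u a c r" using real_analytic_on_expands[OF assms a] by blast
    then show ?thesis
      using expands_continuous[OF c] by (auto simp: continuous_on_eq_continuous_at expands_def)
  qed
  then show "a \<in> U \<Longrightarrow> isCont u a" by blast
  show "continuous_on U u" using * continuous_at_imp_continuous_on by blast
qed

lemma real_analytic_on_DERIV:
  assumes "real_analytic_on u U" "a \<in> U"
  shows "((\<lambda>t. u (a + t *\<^sub>R axis i 1)) has_field_derivative partial_deriv i u a) (at 0)"
proof -
  obtain c r where c: "expands u a c r" using real_analytic_on_expands[OF assms] by blast
  then have "a \<in> ball a r" by (simp add: expands_def)
  from expands_DERIV[OF c this] show ?thesis
    using exhaust_2[of i] by (auto simp: partial_deriv_def DERIV_imp_deriv)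
qed

section \<open>Identity theorem for expansions\<close>

lemma partial_deriv_eq_0:
  assumes "open A" "x \<in> A" "\<And>y. y \<in> A \<Longrightarrow> w y = 0"
  shows "partial_deriv i w x = 0"
proof -
  have "open ((\<lambda>t::real. x + t *\<^sub>R axis i 1) -` A)"
    by (rule open_vimage) (auto intro!: continuous_intros assms)
  then have "((\<lambda>t. w (x + t *\<^sub>R axis i 1)) has_field_derivative 0) (at 0)"
    by (rule has_field_derivative_transform_within_open[OF DERIV_const[of 0]]) (use assms in auto)
  then show ?thesis by (simp add: partial_deriv_def DERIV_imp_deriv)
qed


text \<open>Up to factorials the coefficients at \<open>p\<close> are partial derivatives of
  \<open>w\<close>, which vanish on \<open>A\<close> and by continuity at its limit points. Since
  \<open>p\<close> may lie on the boundary of \<open>A\<close>, identities valid in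
  \<open>\<Omega>\<close> are carried to \<open>closure \<Omega>\<close>. The induction varies
  \<open>w\<close> in order to pass to its partial derivatives.\<close>

lemma expands_coeff_0:
  assumes "open A" "A \<subseteq> U" "real_analytic_on w U" "\<And>x. x \<in> A \<Longrightarrow> w x = 0"
    and "p \<in> closure A" "p \<in> U" "expands w p c r"
  shows "c i j = 0"
  using assms(3,4,7)
proof (induction "i + j" arbitrary: w c r i j)
  case 0
  obtain f where f: "\<And>n. f n \<in> A" "f \<longlonglongrightarrow> p"
    using assms(5) unfolding closure_sequential by blast
  have "(\<lambda>n. w (f n)) \<longlonglongrightarrow> w p"
    using isCont_tendsto_compose[OF real_analytic_on_continuous(1)[OF "0.prems"(1) assms(6)] f(2)] .
  then have "w p = 0"
    using f(1) "0.prems"(2) by (simp add: LIMSEQ_const_iff)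
  then show ?case using expands_at[OF "0.prems"(3)] "0.hyps" by simp
next
  case (Suc n)
  have r: "0 < r / 2" "r / 2 < r" using Suc.prems(3) by (auto simp: expands_def)
  have w: "real_analytic_on (partial_deriv k w) U" "\<And>x. x \<in> A \<Longrightarrow> partial_deriv k w x = 0" for k
    using real_analytic_on_partial[OF Suc.prems(1)] partial_deriv_eq_0[OF assms(1)] Suc.prems(2) by auto
  consider i' where "i = Suc i'" | j' where "j = Suc j'"
    using Suc.hyps(2) by (cases i; cases j) auto
  then show ?case
  proof cases
    case 1
    then have "dx c i' j = 0"
      using Suc.hyps(2) by (intro Suc.hyps(1)[OF _ w(1) w(2) expands_partial(1)[OF Suc.prems(3) r]]) auto
    then show ?thesis using 1 by (simp add: dx_def del: of_nat_Suc)
  next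
    case 2
    then have "dy c i j' = 0"
      using Suc.hyps(2) by (intro Suc.hyps(1)[OF _ w(1) w(2) expands_partial(2)[OF Suc.prems(3) r]]) auto
    then show ?thesis using 2 by (simp add: dy_def del: of_nat_Suc)
  qed
qed

lemma expands_eq_0:
  assumes "open A" "A \<subseteq> U" "real_analytic_on w U" "\<And>x. x \<in> A \<Longrightarrow> w x = 0"
    and "p \<in> closure A" "p \<in> U" "expands w p c r"
  shows "\<And>x. x \<in> ball p r \<Longrightarrow> w x = 0"
  using assms(7) expands_coeff_0[OF assms] by (simp add: expands_def pser_def case_prod_unfold)

text \<open>So far only partial derivatives are available. As the second one is continuous,
  \<open>has_derivative_partialsI\<close> upgrades them to a total derivative, which the chain rule
  along orbits requires.\<close>

lemma real_analytic_on_grad_has_derivative: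
  fixes u :: "real^2 \<Rightarrow> real"
  assumes "real_analytic_on u U" "open U" "x \<in> U"
  shows "(u has_derivative (\<lambda>h. grad u x \<bullet> h)) (at x)"
proof -
  define f where "f s t = u (vector [s, t] :: real^2)" for s t
  have v: "vector [s, t] + r *\<^sub>R axis 1 1 = (vector [r + s, t] :: real^2)"
    "vector [s, t] + r *\<^sub>R axis 2 1 = (vector [s, r + t] :: real^2)" for s t r :: real
    by (rule vec2_eqI; simp)+
  obtain e where e: "e > 0" "ball x e \<subseteq> U"
    using assms(2,3) open_contains_ball by blast
  define X where "X = ball (x$1) (e / 2)"
  define Y where "Y = ball (x$2) (e / 2)"
  have U: "(vector [s, t] :: real^2) \<in> U" if "s \<in> X" "t \<in> Y" for s t
    using dist_vec2_le[of x "vector [s, t]"] that e by (auto simp: X_def Y_def dist_real_def)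
  have xy: "x$1 \<in> X" "x$2 \<in> Y" and xv: "vector [x$1, x$2] = x" 
    using e by (auto simp: X_def Y_def intro: vec2_eqI)
  have d: "((\<lambda>s. f s t) has_field_derivative partial_deriv 1 u (vector [s, t])) (at s)"
    "((\<lambda>t. f s t) has_field_derivative partial_deriv 2 u (vector [s, t])) (at t)"
    if "s \<in> X" "t \<in> Y" for s t
    using real_analytic_on_DERIV[OF assms(1) U[OF that], of 1] real_analytic_on_DERIV[OF assms(1) U[OF that], of 2]
      DERIV_shift[of "\<lambda>s. f s t" _ 0 s] DERIV_shift[of "\<lambda>t. f s t" _ 0 t]
    by (simp_all add: f_def v)
  have c: "continuous_on (X \<times> Y) (\<lambda>p. partial_deriv 2 u (vector [fst p, snd p]))"
  proof (rule continuous_on_compose2[OF real_analytic_on_continuous(2)[OF real_analytic_on_partial[OF assms(1)]]])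
    have "continuous_on (X \<times> Y) (\<lambda>p. (fst p) *\<^sub>R axis 1 1 + (snd p) *\<^sub>R axis 2 1 :: real^2)"
      by (intro continuous_intros)
    moreover have "(fst p) *\<^sub>R axis 1 1 + (snd p) *\<^sub>R axis 2 1
        = (vector [fst p, snd p] :: real^2)" for p :: "real \<times> real"
      by (rule vec2_eqI) auto
    ultimately show "continuous_on (X \<times> Y) (\<lambda>p. vector [fst p, snd p] :: real^2)" by simp
  qed (use U in auto)
  have "((\<lambda>(s, t). f s t) has_derivative
     (\<lambda>(s, t). partial_deriv 1 u x * s + blinfun_apply (blinfun_mult_right (partial_deriv 2 u (vector [x$1,
         x$2]))) t)) (at (x$1, x$2) within X \<times> Y)"
  proof (rule has_derivative_partialsI)
    show "((\<lambda>s. f s (x$2)) has_derivative (*) (partial_deriv 1 u x)) (at (x$1) within X)"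
      using d(1)[OF xy] xv by (auto simp: has_field_derivative_def intro: has_derivative_at_withinI)
    show "((\<lambda>t. f s t) has_derivative blinfun_apply (blinfun_mult_right (partial_deriv 2 u (vector [s, t]))))
        (at t within Y)"
      if "s \<in> X" "t \<in> Y" for s t
      using d(2)[OF that] by (auto simp: has_field_derivative_def intro: has_derivative_at_withinI)
    have "continuous_on (X \<times> Y) (\<lambda>p. blinfun_mult_right (partial_deriv 2 u (vector [fst p, snd p])))"
      by (intro bounded_linear.continuous_on[OF bounded_linear_blinfun_mult_right] c)
    then show "continuous (at (x$1, x$2) within X \<times> Y)
        (\<lambda>(s, t). blinfun_mult_right (partial_deriv 2 u (vector [s, t])))"
      using xy by (auto simp: continuous_on_eq_continuous_within case_prod_unfold)
  qed (use xy in \<open>auto simp: Y_def\<close>)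
  then have 1: "((\<lambda>(s, t). f s t) has_derivative (\<lambda>(s, t). partial_deriv 1 u x * s
      + partial_deriv 2 u x * t)) (at (x$1, x$2))"
    unfolding xv using at_within_open[of "(x$1, x$2)" "X \<times> Y"] xy by (auto simp: X_def Y_def open_Times)
  have "((\<lambda>z. (z$1, z$2)) has_derivative (\<lambda>z. (z$1, z$2))) (at x)"
    by (intro has_derivative_Pair bounded_linear.has_derivative[OF bounded_linear_vec_nth] has_derivative_ident)
  from has_derivative_compose[OF this 1]
  have "((\<lambda>z. f (z$1) (z$2)) has_derivative (\<lambda>z. partial_deriv 1 u x * z$1 + partial_deriv 2 u x * z$2)) (at x)"
    by simp
  moreover have "f (z$1) (z$2) = u z" for z :: "real^2"
    unfolding f_def by (rule arg_cong[of _ _ u]) (rule vec2_eqI; simp)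
  ultimately show ?thesis by (simp add: grad_def inner_vec_def UNIV_2)
qed

section \<open>Zeros of gradients given by double power series\<close>

text \<open>The surviving terms off the degree-\<open>k\<close> diagonal have degree at least
  \<open>k + 1\<close>, so shrinking the bidisc from \<open>s\<close> to \<open>\<rho>\<close> gains
  a factor \<open>(\<rho> / s) ^ Suc k\<close>.\<close>

lemma leading_part_remainder:
  fixes G :: "nat \<Rightarrow> nat \<Rightarrow> complex"
  assumes pc: "pconv G s" "s > 0" and low: "\<And>i j. i + j < k \<Longrightarrow> G i j = 0"
    and xy: "norm x \<le> \<rho>" "norm y \<le> \<rho>" "\<rho> \<le> s"
  shows "norm (pser G x y - (\<Sum>j\<le>k. G (k - j) j * x ^ (k - j) * y ^ j))
    \<le> (\<Sum>\<^sub>\<infinity>(i, j)\<in>UNIV. norm (G i j) * s ^ i * s ^ j) * (\<rho> / s) ^ Suc k"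
proof -
  define f where "f = (\<lambda>(i, j). G i j * x ^ i * y ^ j)"
  define D where "D = (\<lambda>j. (k - j, j)) ` {..k}"
  define K where "K = (\<Sum>\<^sub>\<infinity>(i, j)\<in>UNIV. norm (G i j) * s ^ i * s ^ j)"
  have \<rho>: "0 \<le> \<rho>" using xy(1) norm_ge_zero[of x] by linarith
  have "sum f D = (\<Sum>j\<le>k. G (k - j) j * x ^ (k - j) * y ^ j)"
    unfolding D_def by (subst sum.reindex) (auto simp: inj_on_def f_def)
  moreover have "(f has_sum pser G x y) UNIV"
    using pser_has_sum[OF pc(1), of x y] xy by (simp add: f_def)
  moreover have "(f has_sum sum f D) D"
    by (rule has_sum_finite) (simp add: D_def)
  ultimately have 1: "(f has_sum (pser G x y - (\<Sum>j\<le>k. G (k - j) j * x ^ (k - j) * y ^ j))) (UNIV - D)"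
    using has_sum_Diff[where f = f and A = D and B = UNIV] by auto
  have "((\<lambda>(i, j). norm (G i j) * s ^ i * s ^ j) has_sum K) UNIV"
    unfolding K_def by (rule has_sum_infsum) (use pc in \<open>simp add: pconv_def\<close>)
  then have "((\<lambda>(i, j). norm (G i j) * s ^ i * s ^ j * (\<rho> / s) ^ Suc k) has_sum K * (\<rho> / s) ^ Suc k) UNIV"
    by (auto dest: has_sum_cmult_left[where c = "(\<rho> / s) ^ Suc k"] simp: case_prod_unfold)
  moreover have "finite D" by (simp add: D_def)
  \<comment> \<open>The diagonal \<open>D\<close> is removed from the majorant as well, so that both
    sums run over the same index set; the nonnegative amount removed is dropped at the end.\<close>
  ultimately have 2: "((\<lambda>(i, j). norm (G i j) * s ^ i * s ^ j * (\<rho> / s) ^ Suc k)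
      has_sum K * (\<rho> / s) ^ Suc k - (\<Sum>(i, j)\<in>D. norm (G i j) * s ^ i * s ^ j * (\<rho> / s) ^ Suc k)) (UNIV - D)"
    by (intro has_sum_Diff has_sum_finite) auto
  have "norm (pser G x y - (\<Sum>j\<le>k. G (k - j) j * x ^ (k - j) * y ^ j))
      \<le> K * (\<rho> / s) ^ Suc k - (\<Sum>(i, j)\<in>D. norm (G i j) * s ^ i * s ^ j * (\<rho> / s) ^ Suc k)"
  proof (rule norm_infsum_le[OF 1 2])
    fix p assume p: "p \<in> UNIV - D"
    obtain i j where ij: "p = (i, j)" by (cases p)
    show "norm (f p) \<le> (case p of (i, j) \<Rightarrow> norm (G i j) * s ^ i * s ^ j * (\<rho> / s) ^ Suc k)"
    proof (cases "i + j < k")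
      case True
      then show ?thesis using low \<rho> pc(2) p by (simp add: f_def ij)
    next
      case False
      have "i + j \<noteq> k" using p ij by (auto simp: D_def image_iff)
      then obtain m where m: "i + j = Suc k + m" using False by (metis add_Suc less_iff_Suc_add linorder_neqE_nat)
      have "norm x ^ i * norm y ^ j \<le> \<rho> ^ i * \<rho> ^ j"
        using xy \<rho> by (intro mult_mono power_mono) auto
      also have "\<dots> = \<rho> ^ Suc k * \<rho> ^ m" by (simp only: m power_add[symmetric])
      also have "\<dots> \<le> \<rho> ^ Suc k * s ^ m"
        using xy \<rho> by (intro mult_left_mono power_mono) auto
      also have "\<dots> = (s ^ i * s ^ j) * (\<rho> / s) ^ Suc k"
        using pc(2) by (simp only: m power_add[symmetric] power_divide) (simp add: power_add field_simps)
      finally have "norm (G i j) * (norm x ^ i * norm y ^ j) \<le> norm (G i j) * ((s ^ i * s ^ j) * (\<rho> / s) ^ Suc k)"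
        by (rule mult_left_mono) auto
      then show ?thesis using p ij by (simp add: f_def norm_mult norm_power mult.assoc)
    qed
  qed
  also have "\<dots> \<le> K * (\<rho> / s) ^ Suc k"
    using \<rho> pc(2) by (auto intro!: sum_nonneg)
  finally show ?thesis unfolding K_def .
qed

text \<open>For \<open>u = \<Sum> c i j x\<^sup>i y\<^sup>j\<close> solving \<open>\<Delta>u + \<mu> u = 0\<close> with \<open>u 0 = 0\<close>, the leading homogeneous part of
  \<open>\<partial>\<^sub>1u - \<i> \<partial>\<^sub>2u\<close> is annihilated by \<open>\<partial>\<^sub>1 + \<i> \<partial>\<^sub>2\<close>, hence a nonzero multiple of \<open>(x + \<i> y)\<^sup>k\<close>.\<close>

lemma nodal_gradient_isolated_zero:
  fixes c :: "nat \<Rightarrow> nat \<Rightarrow> real"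
  assumes pc: "pconv c r" "r > 0"
    and pde: "\<And>i j. dx (dx c) i j + dy (dy c) i j + \<mu> * c i j = 0"
    and c0: "c 0 0 = 0" and nz: "\<exists>i j. c i j \<noteq> 0"
  obtains e where "e > 0"
    "\<And>x y. \<lbrakk>\<bar>x\<bar> < e; \<bar>y\<bar> < e; pser (dx c) x y = 0; pser (dy c) x y = 0\<rbrakk> \<Longrightarrow> x = 0 \<and> y = 0"
proof -
  define s where "s = r / 2"
  have s: "0 < s" "s < r" using pc by (auto simp: s_def)
  \<comment> \<open>Coefficients of \<open>\<partial>1 u - \<i> \<partial>2 u\<close>, twice the
    Wirtinger derivative. At real points it vanishes exactly when both partial derivatives
    do.\<close>
  define G where "G i j = complex_of_real (dx c i j) - \<i> * of_real (dy c i j)" for i j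
  have pdx: "pconv (dx c) s" and pdy: "pconv (dy c) s"
    using pconv_dx[OF pc(1)] pconv_dy[OF pc(1)] s by auto
  have pG: "pconv G s"
    unfolding pconv_def
  proof (rule summable_on_comparison_test)
    show "(\<lambda>p. (case p of (i, j) \<Rightarrow> norm (dx c i j) * s ^ i * s ^ j)
        + (case p of (i, j) \<Rightarrow> norm (dy c i j) * s ^ i * s ^ j)) summable_on UNIV"
      by (intro summable_on_add pdx[unfolded pconv_def] pdy[unfolded pconv_def])
    fix p :: "nat \<times> nat"
    obtain i j where p: "p = (i, j)" by (cases p)
    have "norm (G i j) \<le> norm (dx c i j) + norm (dy c i j)"
      unfolding G_def by (rule order_trans[OF norm_triangle_ineq4]) (simp add: norm_mult)
    then have "norm (G i j) * (s ^ i * s ^ j) \<le> (norm (dx c i j) + norm (dy c i j)) * (s ^ i * s ^ j)"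
      using s by (intro mult_right_mono) auto
    then show "(case p of (i, j) \<Rightarrow> norm (G i j) * s ^ i * s ^ j)
      \<le> (case p of (i, j) \<Rightarrow> norm (dx c i j) * s ^ i * s ^ j)
          + (case p of (i, j) \<Rightarrow> norm (dy c i j) * s ^ i * s ^ j)"
      by (simp add: p algebra_simps)
  qed (use s in auto)
  have serG: "pser G (of_real x) (of_real y) = of_real (pser (dx c) x y) - \<i> * of_real (pser (dy c) x y)"
    if "\<bar>x\<bar> \<le> s" "\<bar>y\<bar> \<le> s" for x y
  proof -
    have "((\<lambda>p. complex_of_real (case p of (i, j) \<Rightarrow> dx c i j * x ^ i * y ^ j)
        + (- \<i>) * of_real (case p of (i, j) \<Rightarrow> dy c i j * x ^ i * y ^ j))
        has_sum (of_real (pser (dx c) x y) + (- \<i>) * of_real (pser (dy c) x y))) UNIV"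
      using that
      by (intro has_sum_add has_sum_of_real has_sum_cmult_right pser_has_sum[OF pdx] pser_has_sum[OF pdy]) auto
    then have "((\<lambda>(i, j). G i j * of_real x ^ i * of_real y ^ j)
        has_sum (of_real (pser (dx c) x y) + (- \<i>) * of_real (pser (dy c) x y))) UNIV"
      by (rule has_sum_cong[THEN iffD1, rotated]) (auto simp: G_def algebra_simps)
    from infsumI[OF this] show ?thesis by (simp add: pser_def)
  qed
  have G0: "G i j = 0 \<longleftrightarrow> dx c i j = 0 \<and> dy c i j = 0" for i j
    by (auto simp: G_def complex_eq_iff)
  \<comment> \<open>A coefficient of positive degree is recovered from a gradient coefficient one
    degree lower, and degree 0 is covered by \<open>c 0 0 = 0\<close>. So a nonzero \<open>c\<close>
    forces a nonzero \<open>G\<close>.\<close>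
  have cG: "c i j = 0" if "\<And>i' j'. i' + j' < i + j \<Longrightarrow> G i' j' = 0" for i j
  proof (cases i)
    case (Suc i')
    then have "dx c i' j = 0" using that[of i' j] G0 by simp
    then show ?thesis by (simp add: dx_def Suc del: of_nat_Suc)
  next
    case 0
    show ?thesis
    proof (cases j)
      case (Suc j')
      then have "dy c i j' = 0" using that[of i j'] G0 by simp
      then show ?thesis by (simp add: dy_def Suc del: of_nat_Suc)
    qed (use 0 c0 in simp)
  qed
  have "\<exists>k i j. i + j = k \<and> G i j \<noteq> 0"
    using nz cG by blast
  then obtain k where k: "\<exists>i j. i + j = k \<and> G i j \<noteq> 0" and low: "\<And>i j. i + j < k \<Longrightarrow> G i j = 0"
    using exists_least_iff[of "\<lambda>k. \<exists>i j. i + j = k \<and> G i j \<noteq> 0"] by blast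
  have ii: "a * Y + \<i> * (a * X) = \<i> * a * (X - \<i> * Y)" for a X Y :: complex
    by (simp add: complex_eq_iff algebra_simps)
  \<comment> \<open>In degree \<open>k - 1\<close> the term \<open>\<mu> * c i j\<close> vanishes by
    \<open>cG\<close>, so the equation reduces to Laplace's there; with the symmetry of mixed
    derivatives it becomes the Cauchy-Riemann recursion for \<open>G\<close>.\<close>
  have rec: "of_nat (Suc j) * G i (Suc j) = \<i> * of_nat (Suc i) * G (Suc i) j" if "Suc (i + j) = k" for i j
  proof -
    have "c i j = 0" by (rule cG) (use that in \<open>intro low, simp\<close>)
    then have "dx (dx c) i j + dy (dy c) i j = 0" using pde[of i j] by simp
    then have "complex_of_real (dx (dx c) i j) + of_real (dy (dy c) i j) = 0"
      by (metis of_real_add of_real_0)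
    then have "of_nat (Suc i) * of_real (dx c (Suc i) j) + of_nat (Suc j) * of_real (dy c i (Suc j))
        = (0::complex)"
      by (simp add: dx_def[of "dx c"] dy_def[of "dy c"])
    then have e: "of_nat (Suc j) * of_real (dy c i (Suc j))
        = - (of_nat (Suc i) * of_real (dx c (Suc i) j) :: complex)"
      by (simp add: eq_neg_iff_add_eq_0 add.commute)
    have m: "of_nat (Suc j) * complex_of_real (dx c i (Suc j)) = of_nat (Suc i) * of_real (dy c (Suc i) j)"
      by (simp add: dx_def dy_def)
    have "of_nat (Suc j) * G i (Suc j) = of_nat (Suc j) * of_real (dx c i (Suc j)) - \<i> * (of_nat (Suc j) *
        of_real (dy c i (Suc j)))"
      unfolding G_def by (simp only: right_diff_distrib mult.left_commute)
    also have "\<dots> = of_nat (Suc i) * of_real (dy c (Suc i) j) + \<i> * (of_nat (Suc i) * of_real (dx c (Suc i) j))"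
      by (simp only: e m minus_mult_right[symmetric] mult_minus_right diff_minus_eq_add)
    also have "\<dots> = \<i> * of_nat (Suc i) * (of_real (dx c (Suc i) j) - \<i> * of_real (dy c (Suc i) j))"
      by (rule ii)
    finally show ?thesis by (simp add: G_def)
  qed
  \<comment> \<open>The recursion has the binomial solution: the degree-\<open>k\<close> part is
    \<open>G k 0\<close> times the expansion of \<open>(x + \<i> * y) ^ k\<close>.\<close>
  have lead: "G (k - j) j = \<i> ^ j * of_nat (k choose j) * G k 0" if "j \<le> k" for j
    using that
  proof (induction j)
    case (Suc j)
    have kj: "Suc (k - Suc j) = k - j" using Suc.prems by simp
    have "of_nat (Suc j) * G (k - Suc j) (Suc j) = \<i> * of_nat (k - j) * (\<i> ^ j * of_nat (k choose j) * G k 0)"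
      using rec[of "k - Suc j" j] Suc by (simp add: kj del: of_nat_Suc)
    also have "\<dots> = \<i> ^ Suc j * of_nat ((k - j) * (k choose j)) * G k 0" by simp
    also have "(k - j) * (k choose j) = Suc j * (k choose Suc j)"
      using binomial_absorb_comp[of k j] binomial_absorption[of j k] by simp
    finally have "of_nat (Suc j) * G (k - Suc j) (Suc j)
        = of_nat (Suc j) * (\<i> ^ Suc j * of_nat (k choose Suc j) * G k 0)"
      by (simp only: of_nat_mult mult_ac)
    then show ?case by (simp del: of_nat_Suc)
  qed simp
  define B where "B = G k 0"
  have "B \<noteq> 0"
  proof
    assume "B = 0"
    obtain i j where ij: "i + j = k" "G i j \<noteq> 0" using k by blast
    then have "i = k - j" "j \<le> k" by auto
    then show False using lead[of j] ij(2) \<open>B = 0\<close> by (simp add: B_def)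
  qed
  have poly: "(\<Sum>j\<le>k. G (k - j) j * x ^ (k - j) * y ^ j) = B * (x + \<i> * y) ^ k" for x y
  proof -
    have "B * (x + \<i> * y) ^ k = B * (\<i> * y + x) ^ k" by (simp add: add.commute)
    also have "\<dots> = (\<Sum>j\<le>k. B * (of_nat (k choose j) * (\<i> * y) ^ j * x ^ (k - j)))"
      by (simp add: binomial_ring sum_distrib_left)
    also have "\<dots> = (\<Sum>j\<le>k. G (k - j) j * x ^ (k - j) * y ^ j)"
      by (rule sum.cong) (auto simp: lead B_def power_mult_distrib mult_ac)
    finally show ?thesis by simp
  qed
  define K where "K = (\<Sum>\<^sub>\<infinity>(i, j)\<in>UNIV. norm (G i j) * s ^ i * s ^ j)"
  have K: "K \<ge> 0" unfolding K_def using s by (intro infsum_nonneg) auto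
  \<comment> \<open>For \<open>0 < \<rho> < e\<close> the leading part, at least
    \<open>norm B * \<rho> ^ k\<close>, exceeds the remainder bound
    \<open>K * (\<rho> / s) ^ Suc k\<close>; \<open>K + 1\<close> avoids a zero denominator.\<close>
  define e where "e = min s (norm B * s ^ Suc k / (K + 1))"
  have e: "e > 0" using \<open>B \<noteq> 0\<close> s K by (simp add: e_def)
  show thesis
  proof (rule that[OF e])
    fix x y assume xy: "\<bar>x\<bar> < e" "\<bar>y\<bar> < e" "pser (dx c) x y = 0" "pser (dy c) x y = 0"
    define \<rho> where "\<rho> = max \<bar>x\<bar> \<bar>y\<bar>"
    have \<rho>: "\<bar>x\<bar> \<le> \<rho>" "\<bar>y\<bar> \<le> \<rho>" "\<rho> < e" "0 \<le> \<rho>" "\<rho> \<le> s"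
      using xy by (auto simp: \<rho>_def e_def)
    have "pser G (of_real x) (of_real y) = 0"
      using serG[of x y] xy \<rho> by simp
    then have 1: "norm (B * (of_real x + \<i> * of_real y) ^ k) \<le> K * (\<rho> / s) ^ Suc k"
      using leading_part_remainder[OF pG s(1) low, of k "of_real x" \<rho> "of_real y"] \<rho>
      by (simp add: poly K_def)
    have "\<rho> \<le> norm (complex_of_real x + \<i> * of_real y)"
      using abs_Re_le_cmod[of "complex_of_real x + \<i> * of_real y"] abs_Im_le_cmod[of "complex_of_real x
          + \<i> * of_real y"]
      by (simp add: \<rho>_def)
    then have "norm B * \<rho> ^ k \<le> norm (B * (of_real x + \<i> * of_real y) ^ k)"
      using \<rho> by (simp add: norm_mult norm_power mult_left_mono power_mono)
    with 1 have 2: "norm B * \<rho> ^ k \<le> K * (\<rho> / s) ^ Suc k" by linarith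
    have "\<rho> = 0"
    proof (rule ccontr)
      assume "\<rho> \<noteq> 0"
      then have p: "\<rho> > 0" using \<rho> by simp
      have "norm B * \<rho> ^ k * s ^ Suc k \<le> K * \<rho> ^ Suc k"
        using 2 s by (simp add: power_divide field_simps)
      then have "norm B * s ^ Suc k \<le> K * \<rho>"
        using p by (simp add: field_simps)
      also have "\<dots> \<le> (K + 1) * \<rho>" using p by (simp add: field_simps)
      also have "\<dots> < (K + 1) * e" using \<rho> K by (intro mult_strict_left_mono) auto
      also have "\<dots> \<le> (K + 1) * (norm B * s ^ Suc k / (K + 1))"
        using K by (intro mult_left_mono) (auto simp: e_def)
      also have "\<dots> = norm B * s ^ Suc k" using K by simp
      finally show False by simp
    qed
    then show "x = 0 \<and> y = 0" using \<rho> by simp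
  qed
qed


text \<open>The implicit function theorem for the complexified equation \<open>\<partial>\<^sub>1u = 0\<close>, by a contraction. The
  solution \<open>\<phi>\<close> is holomorphic, so isolated zeros of \<open>w \<mapsto> \<partial>\<^sub>2u (\<phi> w, w)\<close> give the final alternative.\<close>

lemma critical_curve:
  fixes c :: "nat \<Rightarrow> nat \<Rightarrow> real"
  assumes pc: "pconv c r" "r > 0" and c1: "c 1 0 = 0" "c 0 1 = 0" and c2: "c 2 0 \<noteq> 0"
  obtains \<psi> \<psi>' :: "real \<Rightarrow> real" and \<delta> \<epsilon> where "0 < \<delta>" "0 < \<epsilon>" "\<delta> < r" "\<epsilon> < r" "\<psi> 0 = 0"
    "\<And>t. \<bar>t\<bar> < \<epsilon> \<Longrightarrow> \<bar>\<psi> t\<bar> < \<delta> \<and> (\<psi> has_real_derivative \<psi>' t) (at t)"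
    "\<And>x t. \<lbrakk>\<bar>x\<bar> < \<delta>; \<bar>t\<bar> < \<epsilon>\<rbrakk> \<Longrightarrow> pser (dx c) x t = 0 \<longleftrightarrow> x = \<psi> t"
    "\<And>x t. \<lbrakk>\<bar>x\<bar> < \<delta>; \<bar>t\<bar> < \<epsilon>\<rbrakk> \<Longrightarrow> pser (dx (dx c)) x t / c 2 0 > 0"
    "(\<forall>t. \<bar>t\<bar> < \<epsilon> \<longrightarrow> pser (dy c) (\<psi> t) t = 0) \<or> (\<forall>t. 0 < \<bar>t\<bar> \<and> \<bar>t\<bar> < \<epsilon> \<longrightarrow> pser (dy c) (\<psi> t) t \<noteq> 0)"
proof -
  define s where "s = r / 2"
  have s: "0 < s" "s < r" using pc by (auto simp: s_def)
  \<comment> \<open>\<open>F\<close> and \<open>G\<close> converge on radius \<open>s\<close>; the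
    second derivative costs one more reduction.\<close>
  define s2 where "s2 = s / 2"
  have s2: "0 < s2" "s2 < s" using s by (auto simp: s2_def)
  define F where "F i j = complex_of_real (dx c i j)" for i j
  define G where "G i j = complex_of_real (dy c i j)" for i j
  define \<alpha> where "\<alpha> = 2 * c 2 0"
  have \<alpha>: "\<alpha> \<noteq> 0" using c2 by (simp add: \<alpha>_def)
  have \<alpha>F: "dx (dx c) 0 0 = \<alpha>" by (simp add: dx_def \<alpha>_def numeral_2_eq_2)
  have pdx: "pconv (dx c) s" and pdy: "pconv (dy c) s"
    using pconv_dx[OF pc(1)] pconv_dy[OF pc(1)] s by auto
  have pdxx: "pconv (dx (dx c)) s2" using pconv_dx[OF pdx] s2 by auto
  have pF: "pconv F s" and pG: "pconv G s"
    using pdx pdy by (simp_all add: F_def[abs_def] G_def[abs_def])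
  have dxF: "dx F = (\<lambda>i j. complex_of_real (dx (dx c) i j))"
    by (simp add: F_def[abs_def] dx_def fun_eq_iff)
  have pFF: "pconv (dx F) s2" using pdxx by (simp add: dxF)
  have F0: "pser F 0 0 = 0" using c1 by (simp add: F_def dx_def)
  have FR: "pser F (of_real x) (of_real t) = of_real (pser (dx c) x t)" if "\<bar>x\<bar> \<le> s" "\<bar>t\<bar> \<le> s" for x t
    using pser_of_real[OF pdx that] by (simp add: F_def[abs_def])
  have GR: "pser G (of_real x) (of_real t) = of_real (pser (dy c) x t)" if "\<bar>x\<bar> \<le> s" "\<bar>t\<bar> \<le> s" for x t
    using pser_of_real[OF pdy that] by (simp add: G_def[abs_def])
  have FFR: "pser (dx F) (of_real x) (of_real t) = of_real (pser (dx (dx c)) x t)" if "\<bar>x\<bar> \<le> s2" "\<bar>t\<bar> \<le> s2" for x t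
    using pser_of_real[OF pdxx that] by (simp add: dxF)
  have near0: "\<exists>d>0. d < s2 \<and> (\<forall>x y. norm x \<le> d \<longrightarrow> norm y \<le> d \<longrightarrow> norm (pser H x y - H 0 0) < \<eta>)"
    if pH: "pconv H s2" and \<eta>: "\<eta> > 0" for H :: "nat \<Rightarrow> nat \<Rightarrow> complex" and \<eta>
  proof -
    have "continuous_on {p. norm (fst p) \<le> s2 \<and> norm (snd p) \<le> s2} (\<lambda>p. pser H (fst p) (snd p))"
      using continuous_on_pser[OF pH] s2 by simp
    from this[unfolded continuous_on_iff, rule_format, of "(0, 0)" \<eta>]
    have "\<exists>d>0. \<forall>p\<in>{p. norm (fst p) \<le> s2 \<and> norm (snd p)
        \<le> s2}. dist p (0, 0) < d \<longrightarrow> dist (pser H (fst p) (snd p)) (H 0 0) < \<eta>"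
      using s2 \<eta> by simp
    then obtain d where d: "d > 0" "\<And>p. norm (fst p) \<le> s2 \<Longrightarrow> norm (snd p) \<le> s2 \<Longrightarrow> dist p (0, 0) < d
        \<Longrightarrow> dist (pser H (fst p) (snd p)) (H 0 0) < \<eta>"
      by blast
    define d' where "d' = min (d / 3) (s2 / 2)"
    have "norm (pser H x y - H 0 0) < \<eta>" if "norm x \<le> d'" "norm y \<le> d'" for x y
    proof -
      have "dist (x, y) (0, 0) \<le> norm x + norm y"
        by (simp add: dist_Pair_Pair sqrt_sum_squares_le_sum)
      also have "\<dots> < d" using that d(1) by (auto simp: d'_def)
      finally show ?thesis using d(2)[of "(x, y)"] that s2 d(1) by (auto simp: d'_def dist_norm)
    qed
    then show ?thesis using d(1) s2 by (intro exI[of _ d']) (auto simp: d'_def)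
  qed
  \<comment> \<open>Keeping \<open>dx F\<close> within \<open>\<bar>\<alpha>\<bar> / 2\<close> of
    its value \<open>\<alpha>\<close> at the origin gives \<open>\<Psi>\<close> the contraction
    factor 1/2, and at the end fixes the sign of the second derivative.\<close>
  obtain \<delta> where \<delta>: "\<delta> > 0" "\<delta> < s2"
    and FF: "\<And>x y. norm x \<le> \<delta> \<Longrightarrow> norm y \<le> \<delta> \<Longrightarrow> norm (pser (dx F) x y - of_real \<alpha>) < \<bar>\<alpha>\<bar> / 2"
    using near0[OF pFF, of "\<bar>\<alpha>\<bar> / 2"] \<alpha> by (auto simp: dxF \<alpha>F)
  have pFs2: "pconv F s2" using pconv_mono[OF pF] s2 by simp
  \<comment> \<open>This bound gives \<open>norm (\<Psi> 0 w) \<le> \<delta> / 4\<close>, so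
    \<open>\<Psi>\<close> maps the disc of radius \<open>\<delta>\<close> into that of radius
    \<open>3/4 * \<delta>\<close>, which keeps \<open>\<phi>\<close> off the boundary.\<close>
  obtain e where e: "e > 0" "e < s2"
    and Fe: "\<And>x y. norm x \<le> e \<Longrightarrow> norm y \<le> e \<Longrightarrow> norm (pser F x y) < \<bar>\<alpha>\<bar> * \<delta> / 4"
    using near0[OF pFs2, of "\<bar>\<alpha>\<bar> * \<delta> / 4"] \<alpha> \<delta> s2 F0 by auto
  define \<epsilon>0 where "\<epsilon>0 = min e \<delta>"
  have \<epsilon>0: "\<epsilon>0 > 0" "\<epsilon>0 \<le> e" "\<epsilon>0 \<le> \<delta>" using e \<delta> by (auto simp: \<epsilon>0_def)
  \<comment> \<open>Newton's step with the derivative frozen at the origin; its fixed points in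
    \<open>z\<close> are the zeros of \<open>F\<close> over \<open>w\<close>.\<close>
  define \<Psi> where "\<Psi> z w = z - pser F z w / of_real \<alpha>" for z w
  have lip: "norm (\<Psi> z w - \<Psi> z' w) \<le> 1/2 * norm (z - z')"
    if "norm z \<le> \<delta>" "norm z' \<le> \<delta>" "norm w \<le> \<delta>" for z z' w
  proof (rule field_differentiable_bound[where S = "cball 0 \<delta>" and f = "\<lambda>z. \<Psi> z w" and f'
      = "\<lambda>z. 1 - pser (dx F) z w / of_real \<alpha>"])
    fix z :: complex assume z: "z \<in> cball 0 \<delta>"
    show "((\<lambda>z. \<Psi> z w) has_field_derivative 1 - pser (dx F) z w / of_real \<alpha>) (at z within cball 0 \<delta>)"
      unfolding \<Psi>_def
      using DERIV_pser_x[OF pF, of z w] z that(3) \<delta> s2 \<alpha>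
      by (auto intro!: derivative_eq_intros DERIV_subset[OF DERIV_pser_x[OF pF]])
    have "norm (1 - pser (dx F) z w / of_real \<alpha>) = norm (pser (dx F) z w - of_real \<alpha>) / \<bar>\<alpha>\<bar>"
    proof -
      have "1 - pser (dx F) z w / of_real \<alpha> = (of_real \<alpha> - pser (dx F) z w) / of_real \<alpha>"
        using \<alpha> by (simp add: field_simps)
      then show ?thesis by (simp add: norm_divide norm_minus_commute)
    qed
    also have "\<dots> \<le> 1/2" using FF[of z w] z that(3) \<alpha> by (simp add: field_simps)
    finally show "norm (1 - pser (dx F) z w / of_real \<alpha>) \<le> 1/2" .
  qed (use that in auto)
  have \<Psi>bd: "norm (\<Psi> z w) \<le> 3/4 * \<delta>" if "norm z \<le> \<delta>" "norm w \<le> \<epsilon>0" for z w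
  proof -
    have "norm (pser F 0 w) / \<bar>\<alpha>\<bar> \<le> \<delta> / 4" using Fe[of 0 w] that \<epsilon>0 e \<alpha> by (simp add: field_simps)
    then have "norm (\<Psi> 0 w) \<le> \<delta> / 4" by (simp add: \<Psi>_def norm_divide)
    moreover have "norm (\<Psi> z w - \<Psi> 0 w) \<le> 1/2 * norm z" using lip[of z 0 w] that \<epsilon>0 \<delta> by simp
    ultimately show ?thesis using that norm_triangle_sub[of "\<Psi> z w" "\<Psi> 0 w"] by linarith
  qed
  have "\<exists>!z. z \<in> cball 0 \<delta> \<and> \<Psi> z w = z" if "norm w \<le> \<epsilon>0" for w
    by (rule Banach_fix[where c = "1/2"])
      (use \<delta> \<Psi>bd[OF _ that] lip that \<epsilon>0 in \<open>force simp: compact_imp_complete dist_norm\<close>)+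
  then obtain \<phi> where \<phi>: "\<And>w. norm w \<le> \<epsilon>0 \<Longrightarrow> norm (\<phi> w) \<le> \<delta> \<and> \<Psi> (\<phi> w) w = \<phi> w"
    and uniq: "\<And>w z. norm w \<le> \<epsilon>0 \<Longrightarrow> norm z \<le> \<delta> \<Longrightarrow> \<Psi> z w = z \<Longrightarrow> z = \<phi> w"
    by (simp add: mem_cball_0) metis
  have fix_iff: "\<Psi> z w = z \<longleftrightarrow> pser F z w = 0" for z w using \<alpha> by (auto simp: \<Psi>_def)
  \<comment> \<open>The iterates are kept explicit because two properties pass from them to the
    limit \<open>\<phi>\<close>: holomorphy in \<open>w\<close>, and real values at real
    \<open>w\<close>.\<close>
  define it where "it n w = ((\<lambda>z. \<Psi> z w) ^^ n) 0" for n w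
  have itbd: "norm (it n w) \<le> 3/4 * \<delta>" if "norm w \<le> \<epsilon>0" for n w
  proof (induction n)
    case (Suc n)
    then show ?case using \<Psi>bd[of "it n w" w] that \<delta> by (simp add: it_def)
  qed (use \<delta> in \<open>simp add: it_def\<close>)
  have ithol: "it n holomorphic_on ball 0 \<epsilon>0" for n
  proof (induction n)
    case (Suc n)
    have "(\<lambda>w. it n w - pser F (it n w) w / of_real \<alpha>) holomorphic_on ball 0 \<epsilon>0"
    proof (intro holomorphic_intros Suc holomorphic_pser[OF pF])
      show "norm (it n w) \<le> s" if "w \<in> ball 0 \<epsilon>0" for w
        using itbd[of w n] that \<delta> s2 by simp
    qed (use s \<alpha> \<epsilon>0 e s2 in auto)
    moreover have "it (Suc n) = (\<lambda>w. it n w - pser F (it n w) w / of_real \<alpha>)"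
      by (simp add: it_def \<Psi>_def fun_eq_iff)
    ultimately show ?case by simp
  qed (simp add: it_def)
  have itconv: "norm (it n w - \<phi> w) \<le> (1/2) ^ n * \<delta>" if w: "norm w \<le> \<epsilon>0" for n w
  proof (induction n)
    case (Suc n)
    have "norm (it (Suc n) w - \<phi> w) = norm (\<Psi> (it n w) w - \<Psi> (\<phi> w) w)"
      using \<phi>[OF w] by (simp add: it_def)
    also have "\<dots> \<le> 1/2 * norm (it n w - \<phi> w)"
      using itbd[OF w, of n] \<phi>[OF w] w \<epsilon>0 \<delta> by (intro lip) auto
    finally show ?case using Suc by simp
  qed (use \<phi>[OF w] in \<open>simp add: it_def\<close>)
  have ul: "uniform_limit (ball 0 \<epsilon>0) it \<phi> sequentially"
  proof (rule uniform_limitI)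
    fix \<eta> :: real assume "\<eta> > 0"
    have "(\<lambda>n. (1/2) ^ n * \<delta>) \<longlonglongrightarrow> 0"
      by (intro tendsto_mult_left_zero LIMSEQ_power_zero) auto
    then have "\<forall>\<^sub>F n in sequentially. (1/2) ^ n * \<delta> < \<eta>"
      using \<open>\<eta> > 0\<close> by (rule order_tendstoD(2))
    then show "\<forall>\<^sub>F n in sequentially. \<forall>w\<in>ball 0 \<epsilon>0. dist (it n w) (\<phi> w) < \<eta>"
    proof (rule eventually_mono, intro ballI)
      fix n w assume "(1/2) ^ n * \<delta> < \<eta>" "w \<in> ball (0::complex) \<epsilon>0"
      then show "dist (it n w) (\<phi> w) < \<eta>" using itconv[of w n] by (simp add: dist_norm)
    qed
  qed
  have \<phi>hol: "\<phi> holomorphic_on ball 0 \<epsilon>0"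
  proof (rule holomorphic_uniform_sequence[OF open_ball ithol])
    fix x :: complex assume "x \<in> ball 0 \<epsilon>0"
    then obtain d where "d > 0" "cball x d \<subseteq> ball 0 \<epsilon>0"
      using open_contains_cball[of "ball (0::complex) \<epsilon>0"] open_ball by blast
    then show "\<exists>d>0. cball x d \<subseteq> ball 0 \<epsilon>0 \<and> uniform_limit (cball x d) it \<phi> sequentially"
      using uniform_limit_on_subset[OF ul] by blast
  qed
  have \<phi>F: "pser F (\<phi> w) w = 0" if "norm w \<le> \<epsilon>0" for w using \<phi>[OF that] fix_iff by blast
  have \<phi>lt: "norm (\<phi> w) < \<delta>" if "norm w \<le> \<epsilon>0" for w
    using \<Psi>bd[of "\<phi> w" w] \<phi>[OF that] that \<delta> by simp
  have \<phi>0: "\<phi> 0 = 0" using uniq[of 0 0] F0 fix_iff \<epsilon>0 \<delta> by simp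
  define \<psi> where "\<psi> t = Re (\<phi> (of_real t))" for t
  have itreal: "it n (of_real t) \<in> \<real>" if t: "\<bar>t\<bar> \<le> \<epsilon>0" for n t
  proof (induction n)
    case (Suc n)
    then obtain x where x: "it n (of_real t) = of_real x" by (auto elim: Reals_cases)
    then have "\<bar>x\<bar> \<le> s" using itbd[of "of_real t" n] t \<delta> s2 by simp
    then have "it (Suc n) (of_real t) = of_real (x - pser (dx c) x t / \<alpha>)"
      using FR[of x t] x t \<epsilon>0 \<delta> s2 by (simp add: it_def \<Psi>_def)
    then show ?case by simp
  qed (simp add: it_def)
  have \<psi>: "\<phi> (of_real t) = of_real (\<psi> t)" if t: "\<bar>t\<bar> < \<epsilon>0" for t
  proof -
    have "(\<lambda>n. it n (of_real t)) \<longlonglongrightarrow> \<phi> (of_real t)"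
      using tendsto_uniform_limitI[OF ul, of "of_real t"] t by simp
    then have "\<phi> (of_real t) \<in> \<real>"
      using closed_sequentially[OF closed_complex_Reals] itreal[of t] t by (meson less_imp_le)
    then show ?thesis by (simp add: \<psi>_def)
  qed
  define \<psi>' where "\<psi>' t = Re (deriv \<phi> (of_real t))" for t
  have \<psi>d: "(\<psi> has_real_derivative \<psi>' t) (at t)" if t: "\<bar>t\<bar> < \<epsilon>0" for t
  proof -
    have "(\<phi> has_field_derivative deriv \<phi> (of_real t)) (at (of_real t))"
      using \<phi>hol t by (intro holomorphic_derivI[of _ "ball 0 \<epsilon>0"]) auto
    from has_field_derivative_Re[OF has_vector_derivative_real_field[OF this]]
    show ?thesis by (simp add: \<psi>_def[abs_def] \<psi>'_def)
  qed
  \<comment> \<open>The other partial derivative along the curve. Being holomorphic with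
    \<open>H 0 = 0\<close>, it vanishes identically or has an isolated zero at 0, which is the
    claimed dichotomy.\<close>
  define H where "H w = pser G (\<phi> w) w" for w
  have Hhol: "H holomorphic_on ball 0 \<epsilon>0"
    unfolding H_def[abs_def]
  proof (rule holomorphic_pser[OF pG _ open_ball \<phi>hol holomorphic_on_ident])
    fix w :: complex assume "w \<in> ball 0 \<epsilon>0"
    then show "norm (\<phi> w) \<le> s" "norm w \<le> s"
      using \<phi>lt[of w] \<delta> s2 \<epsilon>0 e by auto
  qed (use s in simp)
  have H0: "H 0 = 0" using c1 by (simp add: H_def \<phi>0 G_def dy_def)
  have HR: "H (of_real t) = of_real (pser (dy c) (\<psi> t) t)" if t: "\<bar>t\<bar> < \<epsilon>0" for t
  proof -
    have "\<bar>\<psi> t\<bar> < \<delta>" using \<phi>lt[of "of_real t"] \<psi>[OF t] t by simp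
    then show ?thesis using GR[of "\<psi> t" t] \<psi>[OF t] t \<epsilon>0 \<delta> s2 by (simp add: H_def)
  qed
  obtain \<epsilon> where \<epsilon>: "0 < \<epsilon>" "\<epsilon> \<le> \<epsilon>0"
    and dich: "(\<forall>t. \<bar>t\<bar> < \<epsilon> \<longrightarrow> pser (dy c) (\<psi> t) t = 0) \<or> (\<forall>t. 0 < \<bar>t\<bar> \<and> \<bar>t\<bar> < \<epsilon> \<longrightarrow> pser (dy c) (\<psi> t) t \<noteq> 0)"
  proof (cases "\<forall>w\<in>ball 0 \<epsilon>0. H w = 0")
    case True
    then have "\<forall>t. \<bar>t\<bar> < \<epsilon>0 \<longrightarrow> pser (dy c) (\<psi> t) t = 0"
      using HR by (metis dist_0_norm mem_ball norm_of_real of_real_eq_0_iff)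
    then show thesis using that[of \<epsilon>0] \<epsilon>0 by blast
  next
    case False
    then obtain \<beta> where \<beta>: "\<beta> \<in> ball 0 \<epsilon>0" "H \<beta> \<noteq> 0" by blast
    have "0 \<in> ball (0::complex) \<epsilon>0" using \<epsilon>0 by simp
    from isolated_zeros[OF Hhol open_ball connected_ball this H0 \<beta>]
    obtain \<rho> where \<rho>: "0 < \<rho>" "\<And>z. z \<in> ball 0 \<rho> - {0} \<Longrightarrow> H z \<noteq> 0" by metis
    have "pser (dy c) (\<psi> t) t \<noteq> 0" if "0 < \<bar>t\<bar>" "\<bar>t\<bar> < min \<rho> \<epsilon>0" for t
      using \<rho>(2)[of "of_real t"] HR[of t] that by auto
    then show thesis using that[of "min \<rho> \<epsilon>0"] \<rho>(1) \<epsilon>0 by auto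
  qed
  show thesis
  proof (rule that[of \<delta> \<epsilon> \<psi> \<psi>'])
    show "0 < \<delta>" "0 < \<epsilon>" "\<delta> < r" "\<epsilon> < r" using \<delta> \<epsilon> \<epsilon>0 s2 s by auto
    show "\<psi> 0 = 0" using \<phi>0 by (simp add: \<psi>_def)
    show "\<bar>\<psi> t\<bar> < \<delta> \<and> (\<psi> has_real_derivative \<psi>' t) (at t)" if "\<bar>t\<bar> < \<epsilon>" for t
      using \<phi>lt[of "of_real t"] \<psi>[of t] \<psi>d[of t] that \<epsilon> by simp
    show "pser (dx c) x t = 0 \<longleftrightarrow> x = \<psi> t" if "\<bar>x\<bar> < \<delta>" "\<bar>t\<bar> < \<epsilon>" for x t
    proof -
      have "pser F (of_real x) (of_real t) = 0 \<longleftrightarrow> complex_of_real x = \<phi> (of_real t)"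
        using uniq[of "of_real t" "of_real x"] \<phi>F[of "of_real t"] fix_iff that \<epsilon> by auto
      then show ?thesis using FR[of x t] \<psi>[of t] that \<epsilon> \<epsilon>0 \<delta> s2 by simp
    qed
    show "pser (dx (dx c)) x t / c 2 0 > 0" if "\<bar>x\<bar> < \<delta>" "\<bar>t\<bar> < \<epsilon>" for x t
    proof -
      have "norm (complex_of_real (pser (dx (dx c)) x t - \<alpha>)) < \<bar>\<alpha>\<bar> / 2"
        using FF[of "of_real x" "of_real t"] FFR[of x t] that \<epsilon> \<epsilon>0 \<delta> by simp
      then have "\<bar>pser (dx (dx c)) x t - \<alpha>\<bar> < \<bar>\<alpha>\<bar> / 2" by (simp only: norm_of_real)
      then have "0 < pser (dx (dx c)) x t \<and> 0 < c 2 0 \<or> pser (dx (dx c)) x t < 0 \<and> c 2 0 < 0"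
        using c2 unfolding \<alpha>_def by linarith
      then show ?thesis by (simp add: zero_less_divide_iff)
    qed
  qed (rule dich)
qed

section \<open>Semiflows of Lipschitz vector fields\<close>

lemma has_vector_derivative_imp_continuous_on:
  assumes "\<And>x. x \<in> S \<Longrightarrow> (f has_vector_derivative f' x) (at x within S)"
  shows "continuous_on S f"
  using assms has_vector_derivative_continuous continuous_on_eq_continuous_within by blast

text \<open>For \<open>t < 0\<close> the interval is empty and the integral 0, so the function is
  continuous on the whole line, as \<open>bcontfun\<close> demands.\<close>

lemma continuous_on_integral_from_0:
  fixes g :: "real \<Rightarrow> 'a::banach"
  assumes "continuous_on UNIV g"
  shows "continuous_on UNIV (\<lambda>t. integral {0..t} g)"
proof -
  have 1: "isCont (\<lambda>t. integral {0..max 0 t} g) t" for t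
  proof -
    have "continuous_on {0..\<bar>t\<bar> + 1} (\<lambda>t. integral {0..t} g)"
      by (intro indefinite_integral_continuous_1 integrable_continuous_real continuous_on_subset[OF assms]) auto
    then have "continuous_on {- \<bar>t\<bar> - 1<..<\<bar>t\<bar> + 1} (\<lambda>t. integral {0..max 0 t} g)"
      by (rule continuous_on_compose2) (auto intro!: continuous_intros)
    then have "\<forall>s\<in>{- \<bar>t\<bar> - 1<..<\<bar>t\<bar> + 1}. isCont (\<lambda>t. integral {0..max 0 t} g) s"
      by (simp add: continuous_on_eq_continuous_at)
    moreover have "t \<in> {- \<bar>t\<bar> - 1<..<\<bar>t\<bar> + 1}" by (auto simp: abs_if)
    ultimately show ?thesis by blast
  qed
  have "integral {0..t} g = integral {0..max 0 t} g" for t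
    by (cases "t \<ge> 0") (auto simp: max_def)
  then show ?thesis using 1 by (simp add: continuous_at_imp_continuous_on)
qed

text \<open>Picard iteration in one contraction step, by weighting \<open>\<gamma> t - x0\<close> with \<open>exp (- K t)\<close>.\<close>

lemma lipschitz_ode_solution:
  fixes X :: "'a::euclidean_space \<Rightarrow> 'a"
  assumes lip: "L-lipschitz_on UNIV X" and bd: "\<And>x. norm (X x) \<le> M"
  obtains \<gamma> where "\<gamma> 0 = x0" "\<And>t. t \<ge> 0 \<Longrightarrow> (\<gamma> has_vector_derivative X (\<gamma> t)) (at t within {0..})"
proof -
  have L: "L \<ge> 0" using lip by (rule lipschitz_on_nonneg)
  have M: "M \<ge> 0" using bd[of 0] norm_ge_zero order_trans by blast
  define K where "K = L + 1"
  have K: "K > 0" "L / K < 1" "0 \<le> L / K" using L by (auto simp: K_def)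
  \<comment> \<open>The unknown \<open>y\<close> stands for
    \<open>exp (- K * t) *\<^sub>R (\<gamma> t - x0)\<close>, so this is \<open>X\<close> along the
    curve that \<open>y\<close> encodes; any \<open>K > L\<close> makes \<open>L / K\<close> a
    contraction factor.\<close>
  define g where "g y s = X (x0 + exp (K * s) *\<^sub>R apply_bcontfun y s)" for y s
  have cX: "continuous_on UNIV X" using lip by (rule lipschitz_on_continuous_on)
  have cy: "continuous_on UNIV (apply_bcontfun y)" for y :: "real \<Rightarrow>\<^sub>C 'a"
    using apply_bcontfun[of y] by (simp add: bcontfun_def)
  have cg: "continuous_on UNIV (g y)" for y
    unfolding g_def by (rule continuous_on_compose2[OF cX]) (auto intro!: continuous_intros cy)
  have ig: "g y integrable_on {0..t}" for y t
    by (intro integrable_continuous_real continuous_on_subset[OF cg]) auto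
  define T where "T y t = exp (- K * t) *\<^sub>R integral {0..t} (g y)" for y t
  have Tneg: "T y t = 0" if "t < 0" for y t using that by (simp add: T_def)
  \<comment> \<open>The integral grows at most linearly because \<open>X\<close> is bounded, and the
    exponential weight turns this into a uniform bound.\<close>
  have Tbd: "norm (T y t) \<le> M / K" for y t
  proof (cases "t \<ge> 0")
    case True
    have "norm (integral {0..t} (g y)) \<le> M * (t - 0)"
      using True by (intro Henstock_Kurzweil_Integration.integral_bound continuous_on_subset[OF cg])
          (auto simp: g_def bd)
    also have "\<dots> \<le> M * (exp (K * t) / K)"
    proof (rule mult_left_mono[OF _ M])
      have "K * t \<le> exp (K * t)" using exp_ge_add_one_self[of "K * t"] by linarith
      then show "t - 0 \<le> exp (K * t) / K" using K by (simp add: field_simps)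
    qed
    finally have "exp (- K * t) * norm (integral {0..t} (g y)) \<le> exp (- K * t) * (M * (exp (K * t) / K))"
      by (rule mult_left_mono) simp
    also have "\<dots> = M / K" by (simp add: exp_minus field_simps)
    finally show ?thesis by (simp add: T_def)
  qed (use Tneg M K in auto)
  have Tbc: "T y \<in> bcontfun" for y
  proof (rule bcontfun_normI)
    show "continuous_on UNIV (T y)"
      unfolding T_def by (intro continuous_intros continuous_on_integral_from_0 cg)
  qed (rule Tbd)
  have contr: "dist (Bcontfun (T y)) (Bcontfun (T z)) \<le> L / K * dist y z" for y z
  proof (rule dist_bound)
    fix t
    show "dist (Bcontfun (T y) t) (Bcontfun (T z) t) \<le> L / K * dist y z"
    proof (cases "t \<ge> 0")
      case True
      have ge: "norm (g y s - g z s) \<le> L * dist y z * exp (K * s)" for s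
      proof -
        have "norm (g y s - g z s) \<le> L * norm (exp (K * s) *\<^sub>R (apply_bcontfun y s - apply_bcontfun z s))"
          using lipschitz_onD[OF lip, of "x0 + exp (K * s) *\<^sub>R apply_bcontfun y s" "x0
              + exp (K * s) *\<^sub>R apply_bcontfun z s"]
          by (simp add: g_def dist_norm scaleR_diff_right)
        also have "\<dots> \<le> L * (exp (K * s) * dist y z)"
          using L dist_bounded[of y s z] by (intro mult_left_mono) (auto simp: dist_norm)
        finally show ?thesis by (simp add: mult_ac)
      qed
      have I: "((\<lambda>s. L * dist y z * exp (K * s)) has_integral (L * dist y z * exp (K * t) / K - L * dist y z
          * exp (K * 0) / K)) {0..t}"
        using True K
        by (intro fundamental_theorem_of_calculus)
          (auto intro!: derivative_eq_intros simp: has_real_derivative_iff_has_vector_derivative[symmetric])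
      have "norm (integral {0..t} (g y) - integral {0..t} (g z)) = norm (integral {0..t} (\<lambda>s. g y s - g z s))"
        by (simp add: Henstock_Kurzweil_Integration.integral_diff ig)
      also have "\<dots> \<le> integral {0..t} (\<lambda>s. L * dist y z * exp (K * s))"
        by (intro Henstock_Kurzweil_Integration.integral_norm_bound_integral integrable_diff ig
            has_integral_integrable[OF I] ge)
      also have "\<dots> \<le> L * dist y z * exp (K * t) / K"
        using integral_unique[OF I] L K by simp
      finally have "exp (- K * t) * norm (integral {0..t} (g y) - integral {0..t} (g z))
          \<le> exp (- K * t) * (L * dist y z * exp (K * t) / K)"
        by (rule mult_left_mono) simp
      also have "\<dots> = L / K * dist y z" by (simp add: exp_minus field_simps)
      finally show ?thesis
        by (simp add: Bcontfun_inverse[OF Tbc] dist_norm) (simp add: T_def scaleR_diff_right[symmetric])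
    next
      case False
      then show ?thesis using mult_nonneg_nonneg[OF K(3) zero_le_dist[of y z]]
        by (simp add: Bcontfun_inverse[OF Tbc] Tneg)
    qed
  qed
  obtain y where y: "Bcontfun (T y) = y"
    using banach_fix_type[of "L / K" "\<lambda>y. Bcontfun (T y)"] K contr by blast
  have yT: "apply_bcontfun y t = T y t" for t using Bcontfun_inverse[OF Tbc, of y] y by simp
  define \<gamma> where "\<gamma> t = x0 + integral {0..t} (g y)" for t
  have g\<gamma>: "g y t = X (\<gamma> t)" for t
    by (simp add: g_def \<gamma>_def yT T_def exp_minus)
  show thesis
  proof (rule that[of \<gamma>])
    show "\<gamma> 0 = x0" by (simp add: \<gamma>_def)
    fix t :: real assume t: "t \<ge> 0"
    have "((\<lambda>u. integral {0..u} (g y)) has_vector_derivative g y t) (at t within {0..t + 1})"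
      using t by (intro integral_has_vector_derivative continuous_on_subset[OF cg]) auto
    from has_vector_derivative_add[OF has_vector_derivative_const this]
    have "((\<lambda>u. x0 + integral {0..u} (g y)) has_vector_derivative g y t) (at t within {0..t + 1})" by simp
    moreover have "(\<lambda>u. x0 + integral {0..u} (g y)) = \<gamma>" by (simp add: \<gamma>_def fun_eq_iff)
    ultimately have "(\<gamma> has_vector_derivative X (\<gamma> t)) (at t within {0..t + 1})"
      by (simp only: g\<gamma>)
    moreover have "at t within {0..t + 1} = at t within {0..}"
      by (rule at_within_nhd[of _ "{..<t + 1}"]) auto
    ultimately show "(\<gamma> has_vector_derivative X (\<gamma> t)) (at t within {0..})" by simp
  qed
qed

text \<open>Gronwall's estimate: the Lipschitz bound makes \<open>exp (- 2 * L * t)\<close> times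
  the squared distance nonincreasing. Squaring avoids differentiating the norm at 0.\<close>

lemma lipschitz_ode_dist:
  fixes X :: "'a::euclidean_space \<Rightarrow> 'a"
  assumes lip: "L-lipschitz_on UNIV X" and T: "0 \<le> T"
    and a: "\<And>t. t \<in> {0..T} \<Longrightarrow> (\<alpha> has_vector_derivative X (\<alpha> t)) (at t within {0..T})"
    and b: "\<And>t. t \<in> {0..T} \<Longrightarrow> (\<beta> has_vector_derivative X (\<beta> t)) (at t within {0..T})"
  shows "dist (\<alpha> T) (\<beta> T) \<le> exp (L * T) * dist (\<alpha> 0) (\<beta> 0)"
proof -
  define D where "D t = exp (- 2 * L * t) * ((\<alpha> t - \<beta> t) \<bullet> (\<alpha> t - \<beta> t))" for t
  have "D T \<le> D 0"
  proof (rule DERIV_nonpos_imp_decreasing_open[OF T])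
    fix t assume t: "0 < t" "t < T"
    then have "at t within {0..T} = at t" by (simp add: at_within_Icc_at)
    then have ab: "(\<alpha> has_vector_derivative X (\<alpha> t)) (at t)" "(\<beta> has_vector_derivative X (\<beta> t)) (at t)"
      using a[of t] b[of t] t by auto
    have 1: "((\<lambda>t. (\<alpha> t - \<beta> t) \<bullet> (\<alpha> t - \<beta> t)) has_real_derivative 2 * ((\<alpha> t - \<beta> t) \<bullet> (X (\<alpha> t) - X (\<beta> t)))) (at t)"
      using ab unfolding has_vector_derivative_def has_field_derivative_def
      by (auto intro!: derivative_eq_intros simp: inner_commute inner_simps algebra_simps)
    have "(D has_real_derivative exp (- 2 * L * t) * (2 * ((\<alpha> t - \<beta> t) \<bullet> (X (\<alpha> t) - X (\<beta> t))))
        - 2 * L * exp (- 2 * L * t) * ((\<alpha> t - \<beta> t) \<bullet> (\<alpha> t - \<beta> t))) (at t)"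
      unfolding D_def by (auto intro!: derivative_eq_intros 1)
    moreover have "(\<alpha> t - \<beta> t) \<bullet> (X (\<alpha> t) - X (\<beta> t)) \<le> L * ((\<alpha> t - \<beta> t) \<bullet> (\<alpha> t - \<beta> t))"
    proof -
      have "(\<alpha> t - \<beta> t) \<bullet> (X (\<alpha> t) - X (\<beta> t)) \<le> norm (\<alpha> t - \<beta> t) * norm (X (\<alpha> t) - X (\<beta> t))"
        by (rule norm_cauchy_schwarz)
      also have "\<dots> \<le> norm (\<alpha> t - \<beta> t) * (L * norm (\<alpha> t - \<beta> t))"
        using lipschitz_onD[OF lip, of "\<alpha> t" "\<beta> t"] by (intro mult_left_mono) (auto simp: dist_norm)
      finally show ?thesis by (simp add: dot_square_norm power2_eq_square mult_ac)
    qed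
    then have "exp (- 2 * L * t) * (2 * ((\<alpha> t - \<beta> t) \<bullet> (X (\<alpha> t) - X (\<beta> t))))
        \<le> exp (- 2 * L * t) * (2 * (L * ((\<alpha> t - \<beta> t) \<bullet> (\<alpha> t - \<beta> t))))"
      by (intro mult_left_mono) auto
    ultimately show "\<exists>y. (D has_real_derivative y) (at t) \<and> y \<le> 0"
      by (intro exI conjI) (assumption, simp add: mult_ac)
  next
    have "continuous_on {0..T} \<alpha>" by (rule has_vector_derivative_imp_continuous_on[OF a])
    moreover have "continuous_on {0..T} \<beta>" by (rule has_vector_derivative_imp_continuous_on[OF b])
    ultimately show "continuous_on {0..T} D" unfolding D_def by (intro continuous_intros)
  qed
  then have "exp (- 2 * L * T) * (norm (\<alpha> T - \<beta> T))\<^sup>2 \<le> (norm (\<alpha> 0 - \<beta> 0))\<^sup>2"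
    by (simp add: D_def dot_square_norm)
  then have "exp (2 * L * T) * (exp (- 2 * L * T) * (norm (\<alpha> T - \<beta> T))\<^sup>2) \<le> exp (2 * L * T) * (norm (\<alpha> 0 - \<beta> 0))\<^sup>2"
    by (rule mult_left_mono) simp
  moreover have "exp (2 * L * T) * (exp (- 2 * L * T) * (norm (\<alpha> T - \<beta> T))\<^sup>2) = (norm (\<alpha> T - \<beta> T))\<^sup>2"
    by (simp add: exp_minus)
  moreover have "exp (2 * L * T) = (exp (L * T))\<^sup>2"
    by (simp add: power2_eq_square exp_add[symmetric] algebra_simps)
  ultimately have "(norm (\<alpha> T - \<beta> T))\<^sup>2 \<le> (exp (L * T) * norm (\<alpha> 0 - \<beta> 0))\<^sup>2"
    by (simp only: power_mult_distrib)
  then show ?thesis unfolding dist_norm by (rule power2_le_imp_le) simp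
qed

locale lipschitz_semiflow =
  fixes X :: "'a::euclidean_space \<Rightarrow> 'a" and L :: real and \<Phi> :: "real \<Rightarrow> 'a \<Rightarrow> 'a"
  assumes lip: "L-lipschitz_on UNIV X"
    and flow_0 [simp]: "\<Phi> 0 x = x"
    and flow_deriv: "t \<ge> 0 \<Longrightarrow> ((\<lambda>t. \<Phi> t x) has_vector_derivative X (\<Phi> t x)) (at t within {0..})"
begin

lemma flow_deriv_at:
  assumes "t > 0" shows "((\<lambda>t. \<Phi> t x) has_vector_derivative X (\<Phi> t x)) (at t)"
  using flow_deriv[of t x] assms at_within_interior[of t "{0..}"] by (simp add: interior_real_atLeast)

lemma flow_continuous_on: "continuous_on {0..} (\<lambda>t. \<Phi> t x)"
  by (rule has_vector_derivative_imp_continuous_on) (use flow_deriv in auto)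

lemma flow_unique:
  assumes "\<And>t. t \<in> {0..T} \<Longrightarrow> (\<alpha> has_vector_derivative X (\<alpha> t)) (at t within {0..T})" "0 \<le> T"
  shows "\<alpha> T = \<Phi> T (\<alpha> 0)"
proof -
  have "dist (\<alpha> T) ((\<lambda>t. \<Phi> t (\<alpha> 0)) T) \<le> exp (L * T) * dist (\<alpha> 0) (\<Phi> 0 (\<alpha> 0))"
    by (rule lipschitz_ode_dist[OF lip assms(2,1)])
      (auto intro: has_vector_derivative_within_subset[OF flow_deriv])
  then show ?thesis by simp
qed

lemma flow_dist:
  assumes "0 \<le> t" shows "dist (\<Phi> t x) (\<Phi> t y) \<le> exp (L * t) * dist x y"
proof -
  have "dist ((\<lambda>t. \<Phi> t x) t) ((\<lambda>t. \<Phi> t y) t) \<le> exp (L * t) * dist (\<Phi> 0 x) (\<Phi> 0 y)"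
    by (rule lipschitz_ode_dist[OF lip assms])
      (auto intro: has_vector_derivative_within_subset[OF flow_deriv])
  then show ?thesis by simp
qed

lemma flow_continuous:
  assumes "0 \<le> t" shows "continuous_on UNIV (\<Phi> t)"
  by (rule lipschitz_on_continuous_on[of "exp (L * t)"], rule lipschitz_onI)
    (use flow_dist[OF assms] in auto)

lemma flow_add:
  assumes "0 \<le> s" "0 \<le> t" shows "\<Phi> (s + t) x = \<Phi> s (\<Phi> t x)"
proof -
  have "((\<lambda>s. \<Phi> (s + t) x) has_vector_derivative X (\<Phi> (r + t) x)) (at r within {0..s})" if "r \<in> {0..s}" for r
  proof -
    have 1: "((\<lambda>s. s + t) has_vector_derivative 1) (at r within {0..s})"
      by (auto intro!: derivative_eq_intros)
    have 2: "((\<lambda>t. \<Phi> t x) has_vector_derivative X (\<Phi> (r + t) x)) (at (r + t) within (\<lambda>s. s + t) ` {0..s})"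
      by (rule has_vector_derivative_within_subset[OF flow_deriv]) (use that assms in auto)
    show ?thesis using vector_diff_chain_within[OF 1 2] by (simp add: o_def)
  qed
  from flow_unique[OF this assms(1)] show ?thesis by simp
qed

lemma flow_equilibrium:
  assumes "X q = 0" "0 \<le> t" shows "\<Phi> t q = q"
  using flow_unique[of t "\<lambda>_. q"] assms by simp

text \<open>Backward uniqueness: reversing time turns the orbit into a solution for
  \<open>- X\<close> that starts at an equilibrium and is therefore constant.\<close>

lemma flow_reaches_equilibrium:
  assumes "X (\<Phi> t x) = 0" "0 \<le> t" shows "\<Phi> t x = x"
proof -
  have lip': "L-lipschitz_on UNIV (\<lambda>x. - X x)" using lip by (simp add: lipschitz_on_minus)
  have "dist ((\<lambda>s. \<Phi> (t - s) x) t) ((\<lambda>s. \<Phi> t x) t) \<le> exp (L * t) * dist (\<Phi> (t - 0) x) (\<Phi> t x)"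
  proof (rule lipschitz_ode_dist[OF lip' assms(2)])
    fix s assume s: "s \<in> {0..t}"
    have 1: "((\<lambda>s. t - s) has_vector_derivative - 1) (at s within {0..t})"
      by (auto intro!: derivative_eq_intros)
    have 2: "((\<lambda>t. \<Phi> t x) has_vector_derivative X (\<Phi> (t - s) x)) (at (t - s) within (\<lambda>s. t - s) ` {0..t})"
      by (rule has_vector_derivative_within_subset[OF flow_deriv]) (use s in auto)
    show "((\<lambda>s. \<Phi> (t - s) x) has_vector_derivative - X (\<Phi> (t - s) x)) (at s within {0..t})"
      using vector_diff_chain_within[OF 1 2] by (simp add: o_def)
  qed (use assms in auto)
  then show ?thesis by simp
qed

end

section \<open>Global semiflows and the cutoff of a vector field\<close>

lemma ex_lipschitz_semiflow:
  fixes X :: "'a::euclidean_space \<Rightarrow> 'a"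
  assumes "L-lipschitz_on UNIV X" "\<And>x. norm (X x) \<le> M"
  obtains \<Phi> where "lipschitz_semiflow X L \<Phi>"
proof -
  have "\<forall>x. \<exists>\<gamma>. \<gamma> 0 = x \<and> (\<forall>t\<ge>0. (\<gamma> has_vector_derivative X (\<gamma> t)) (at t within {0..}))"
    using lipschitz_ode_solution[OF assms] by metis
  then obtain \<Gamma> where "\<And>x. \<Gamma> x 0 = x \<and> (\<forall>t\<ge>0. (\<Gamma> x has_vector_derivative X (\<Gamma> x t)) (at t within {0..}))"
    by metis
  then have "lipschitz_semiflow X L (\<lambda>t x. \<Gamma> x t)"
    using assms(1) by unfold_locales auto
  then show thesis by (rule that)
qed

text \<open>Multiplication by a positive scalar only changes the speed along orbits, and on
  \<open>C\<close> the speed is unchanged. The set \<open>V\<close> where \<open>k\<close> is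
  positive will be invariant under the semiflow.\<close>

lemma lipschitz_cutoff:
  fixes g :: "'a::euclidean_space \<Rightarrow> 'a"
  assumes C: "compact C" "open U" "C \<subseteq> U" "C \<noteq> {}"
    and g: "\<And>x. x \<in> U \<Longrightarrow> \<exists>e>0. \<exists>L. L-lipschitz_on (cball x e) g"
  obtains X V k L M where "open V" "C \<subseteq> V" "V \<subseteq> U" "L-lipschitz_on UNIV X" "\<And>x. norm (X x) \<le> M"
    "\<And>x. X x = k x *\<^sub>R g x" "\<And>x. x \<in> C \<Longrightarrow> k x = (1::real)" "\<And>x. x \<in> V \<Longrightarrow> k x > 0" "\<And>x. x \<notin> V \<Longrightarrow> k x = 0"
proof -
  obtain \<delta> where \<delta>: "\<delta> > 0" "{x. infdist x C \<le> \<delta>} \<subseteq> U"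
    using compact_in_open_separated[OF C(4,1,2,3)] by auto
  define Q where "Q = {x. infdist x C \<le> \<delta>}"
  have cQ: "compact Q" unfolding Q_def using C by (intro compact_infdist_le) (use \<delta> in auto)
  have "local_lipschitz {0::real} Q (\<lambda>_. g)"
  proof (rule local_lipschitzI)
    fix t :: real and x assume "x \<in> Q"
    then obtain e L where "e > 0" "L-lipschitz_on (cball x e) g" using g \<delta>(2) unfolding Q_def by blast
    then show "\<exists>u>0. \<exists>L. \<forall>t\<in>cball t u \<inter> {0}. L-lipschitz_on (cball x u \<inter> Q) g"
      by (meson inf_le1 lipschitz_on_subset)
  qed
  then obtain L0 where L0: "L0-lipschitz_on Q g"
    using local_lipschitz_compact_implies_lipschitz[where X = Q and T = "{0}" and f = "\<lambda>_. g"] cQ by auto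
  have "bounded (g ` Q)"
    using compact_continuous_image[OF lipschitz_on_continuous_on[OF L0] cQ] by (rule compact_imp_bounded)
  then obtain M where M: "M > 0" "\<And>x. x \<in> Q \<Longrightarrow> norm (g x) \<le> M"
    unfolding bounded_pos by auto
  \<comment> \<open>A tent function of the distance to \<open>C\<close>: 1 on \<open>C\<close>, 0
    from distance \<open>\<delta>\<close> on.\<close>
  define k where "k x = max 0 (1 - infdist x C / \<delta>)" for x
  have k01: "0 \<le> k x" "k x \<le> 1" for x using \<delta> infdist_nonneg[of x C] by (auto simp: k_def)
  have kQ: "k x = 0" if "x \<notin> Q" for x using that \<delta> by (auto simp: k_def Q_def field_simps)
  have klip: "\<bar>k x - k y\<bar> \<le> dist x y / \<delta>" for x y
  proof -
    have "\<bar>infdist x C - infdist y C\<bar> \<le> dist x y" by (rule infdist_triangle_abs)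
    then have "\<bar>infdist x C / \<delta> - infdist y C / \<delta>\<bar> \<le> dist x y / \<delta>"
      using \<delta> by (simp add: diff_divide_distrib[symmetric] divide_right_mono)
    then show ?thesis by (auto simp: k_def max_def)
  qed
  define X where "X x = k x *\<^sub>R g x" for x
  define L where "L = L0 + M / \<delta>"
  have L0': "L0 \<ge> 0" using L0 by (rule lipschitz_on_nonneg)
  \<comment> \<open>One point in \<open>Q\<close> suffices: outside \<open>Q\<close> the field is 0,
    and the drop of \<open>k\<close> to 0 is itself controlled by the distance.\<close>
  have inQ: "dist (X x) (X y) \<le> L * dist x y" if "x \<in> Q" for x y
  proof (cases "y \<in> Q")
    case True
    have "dist (X x) (X y) = norm ((k x - k y) *\<^sub>R g x + k y *\<^sub>R (g x - g y))"
      by (simp add: X_def dist_norm algebra_simps)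
    also have "\<dots> \<le> \<bar>k x - k y\<bar> * norm (g x) + k y * norm (g x - g y)"
      using k01[of y] by (intro order_trans[OF norm_triangle_ineq]) simp
    also have "\<dots> \<le> dist x y / \<delta> * M + 1 * (L0 * dist x y)"
      using klip[of x y] M(2)[OF that] k01[of y] lipschitz_onD[OF L0 that True] L0' \<delta>
      by (intro add_mono mult_mono) (auto simp: dist_norm)
    finally show ?thesis by (simp add: L_def algebra_simps)
  next
    case False
    have "dist (X x) (X y) = \<bar>k x - k y\<bar> * norm (g x)"
      using kQ[OF False] by (simp add: X_def dist_norm)
    also have "\<dots> \<le> dist x y / \<delta> * M"
      using klip[of x y] M(2)[OF that] \<delta> by (intro mult_mono) auto
    also have "\<dots> \<le> L * dist x y" using L0' by (simp add: L_def algebra_simps)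
    finally show ?thesis .
  qed
  show thesis
  proof (rule that[of "{x. infdist x C < \<delta>}" L X M k])
    show "open {x. infdist x C < \<delta>}" by (intro open_Collect_less continuous_intros)
    show "C \<subseteq> {x. infdist x C < \<delta>}" using \<delta> by auto
    show "{x. infdist x C < \<delta>} \<subseteq> U" using \<delta> by auto
    show "L-lipschitz_on UNIV X"
    proof (rule lipschitz_onI)
      fix x y
      consider "x \<in> Q" | "y \<in> Q" | "x \<notin> Q" "y \<notin> Q" by blast
      then show "dist (X x) (X y) \<le> L * dist x y"
      proof cases
        case 2 then show ?thesis using inQ[of y x] by (simp add: dist_commute)
      next
        case 3 then show ?thesis using kQ L0' M \<delta> by (simp add: X_def L_def)
      qed (rule inQ)
    qed (use L0' M \<delta> in \<open>simp add: L_def\<close>)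
    show "norm (X x) \<le> M" for x
    proof (cases "x \<in> Q")
      case True
      have "k x * norm (g x) \<le> 1 * M" using k01[of x] M(2)[OF True] by (intro mult_mono) auto
      then show ?thesis using k01[of x] by (simp add: X_def)
    qed (use kQ M in \<open>simp add: X_def\<close>)
  qed (use \<delta> in \<open>auto simp: X_def k_def field_simps\<close>)
qed

section \<open>Maxima of analytic functions\<close>

lemma partial_deriv_cong:
  assumes "open A" "x \<in> A" "\<And>y. y \<in> A \<Longrightarrow> u y = v y"
  shows "partial_deriv i u x = partial_deriv i v x"
proof -
  have "open ((\<lambda>t::real. x + t *\<^sub>R axis i 1) -` A)"
    by (rule open_vimage) (auto intro!: continuous_intros assms)
  moreover have "0 \<in> (\<lambda>t::real. x + t *\<^sub>R axis i 1) -` A" using assms by simp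
  ultimately have "\<forall>\<^sub>F t in nhds 0. t \<in> (\<lambda>t::real. x + t *\<^sub>R axis i 1) -` A"
    by (rule eventually_nhds_in_open)
  then have "\<forall>\<^sub>F t in nhds 0. u (x + t *\<^sub>R axis i 1) = v (x + t *\<^sub>R axis i 1)"
    by (rule eventually_mono) (use assms in auto)
  then show ?thesis unfolding partial_deriv_def by (rule deriv_cong_ev) simp
qed

lemma partial_deriv_minus:
  assumes "real_analytic_on u U" "x \<in> U"
  shows "partial_deriv i (\<lambda>x. - u x) x = - partial_deriv i u x"
  unfolding partial_deriv_def[of i "\<lambda>x. - u x"]
  by (rule DERIV_imp_deriv) (rule DERIV_minus[OF real_analytic_on_DERIV[OF assms]])

lemma real_analytic_on_DERIV_line:
  assumes "real_analytic_on u U" "a + s *\<^sub>R axis i 1 \<in> U"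
  shows "((\<lambda>t. u (a + t *\<^sub>R axis i 1)) has_field_derivative partial_deriv i u (a + s *\<^sub>R axis i 1)) (at s)"
  using real_analytic_on_DERIV[OF assms, of i] DERIV_shift[of "\<lambda>t. u (a + t *\<^sub>R axis i 1)" _ 0 s]
  by (simp add: algebra_simps)

lemma local_max_second_deriv:
  fixes g g' :: "real \<Rightarrow> real"
  assumes g: "\<And>t. \<bar>t\<bar> < e \<Longrightarrow> (g has_real_derivative g' t) (at t)" and e: "e > 0"
    and d: "(g' has_real_derivative d) (at 0)" and mx: "\<And>t. \<bar>t\<bar> < e \<Longrightarrow> g t \<le> g 0"
  shows "d \<le> 0"
proof (rule ccontr)
  assume "\<not> d \<le> 0"
  then have "d > 0" by simp
  then obtain h where h: "h > 0" "\<And>t. 0 < t \<Longrightarrow> t < h \<Longrightarrow> g' 0 < g' (0 + t)"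
    using DERIV_pos_inc_right[OF d] by blast
  have "g' 0 = 0"
    by (rule DERIV_local_max[OF g e]) (use e mx in auto)
  define s where "s = min h e / 2"
  have s: "0 < s" "s < h" "s < e" using h(1) e by (auto simp: s_def)
  obtain z where z: "0 < z" "z < s" "g s - g 0 = (s - 0) * g' z"
    using MVT2[of 0 s g g'] s g by auto
  have "g' z > 0" using h(2)[of z] z s \<open>g' 0 = 0\<close> by simp
  then have "s * g' z > 0" using s by simp
  then have "g s > g 0" using z by simp
  then show False using mx[of s] s by simp
qed

lemma ball_axis_line:
  fixes y :: "real^2"
  assumes "\<bar>t\<bar> < e" shows "y + t *\<^sub>R axis i 1 \<in> ball y e"
  using assms by (simp add: dist_norm norm_axis_1)

lemma local_max_grad:
  assumes "real_analytic_on u U" "x \<in> U" "\<forall>\<^sub>F y in nhds x. u y \<le> u x"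
  shows "grad u x = 0"
proof -
  obtain e where e: "e > 0" "\<And>y. dist y x < e \<Longrightarrow> u y \<le> u x"
    using assms(3) unfolding eventually_nhds_metric by blast
  have "partial_deriv i u x = 0" for i
  proof (rule DERIV_local_max[OF real_analytic_on_DERIV[OF assms(1,2)] e(1)], intro allI impI)
    fix t :: real assume "\<bar>0 - t\<bar> < e"
    then show "u (x + t *\<^sub>R axis i 1) \<le> u (x + 0 *\<^sub>R axis i 1)"
      using ball_axis_line[of t e x i] e(2) by (simp add: dist_commute)
  qed
  then show ?thesis by (simp add: grad_def vec_eq_iff)
qed

text \<open>The quadratic term adds \<open>2 * K\<close> to each pure second derivative.
  \<open>K = 0\<close> is the usual second-order condition, \<open>K > 0\<close> the perturbed one
  for the maximum principle.\<close>

lemma second_partial_at_max: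
  assumes u: "real_analytic_on u U" and "open U" "y \<in> U" and K: "K \<ge> 0"
    and mx: "\<forall>\<^sub>F z in nhds y. u z + K * (dist x z)\<^sup>2 \<le> u y + K * (dist x y)\<^sup>2"
  shows "partial_deriv i (partial_deriv i u) y + 2 * K \<le> 0"
proof -
  obtain e1 where e1: "e1 > 0" "\<And>z. dist z y < e1 \<Longrightarrow> u z + K * (dist x z)\<^sup>2 \<le> u y + K * (dist x y)\<^sup>2"
    using mx unfolding eventually_nhds_metric by blast
  obtain e2 where e2: "e2 > 0" "ball y e2 \<subseteq> U" using assms open_contains_ball by blast
  define e where "e = min e1 e2"
  have e: "e > 0" using e1 e2 by (simp add: e_def)
  have q: "(dist x (y + t *\<^sub>R axis i 1))\<^sup>2 = (dist x y)\<^sup>2 + 2 * t * (y - x) $ i + t\<^sup>2" for t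
  proof -
    have "(dist x (y + t *\<^sub>R axis i 1))\<^sup>2 = ((y - x) + t *\<^sub>R axis i 1) \<bullet> ((y - x) + t *\<^sub>R axis i 1)"
      by (simp add: dist_norm power2_norm_eq_inner inner_simps algebra_simps inner_commute)
    also have "\<dots> = (dist x y)\<^sup>2 + 2 * t * (y - x) $ i + t\<^sup>2"
      by (simp add: inner_add_left inner_add_right inner_axis inner_axis' dist_norm norm_minus_commute[of x]
          power2_norm_eq_inner algebra_simps)
        (simp add: power2_eq_square)
    finally show ?thesis .
  qed
  define g where "g t = u (y + t *\<^sub>R axis i 1) + K * ((dist x y)\<^sup>2 + 2 * t * (y - x) $ i + t\<^sup>2)" for t
  define g' where "g' t = partial_deriv i u (y + t *\<^sub>R axis i 1) + K * (2 * (y - x) $ i + 2 * t)" for t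
  show ?thesis
  proof (rule local_max_second_deriv[of e g g'])
    fix t :: real assume t: "\<bar>t\<bar> < e"
    have tU: "y + t *\<^sub>R axis i 1 \<in> U" using ball_axis_line[of t e2 y i] t e2 by (auto simp: e_def)
    show "(g has_real_derivative g' t) (at t)"
      unfolding g_def g'_def
      by (auto intro!: derivative_eq_intros real_analytic_on_DERIV_line[OF u tU] simp: algebra_simps)
    show "g t \<le> g 0"
      using e1(2)[of "y + t *\<^sub>R axis i 1"] ball_axis_line[of t e1 y i] t
      by (simp add: g_def q e_def dist_commute)
  next
    show "(g' has_real_derivative partial_deriv i (partial_deriv i u) y + 2 * K) (at 0)"
      unfolding g'_def
      by (auto intro!: derivative_eq_intros real_analytic_on_DERIV[OF real_analytic_on_partial[OF u] assms(3)])
  qed (rule e)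
qed

text \<open>The Laplacian is only known to be nonnegative, so a small multiple of the squared
  distance is added to \<open>u\<close>: at an interior maximum of the sum the Laplacian of
  \<open>u\<close> would be at most \<open>- 4 * K < 0\<close>.\<close>

lemma weak_maximum_principle:
  assumes u: "real_analytic_on u U" "open U" and A: "open A" "bounded A" "closure A \<subseteq> U"
    and lap: "\<And>x. x \<in> A \<Longrightarrow> laplacian u x \<ge> 0" and bd: "\<And>x. x \<in> frontier A \<Longrightarrow> u x \<le> b"
    and x: "x \<in> A"
  shows "u x \<le> b"
proof (rule ccontr)
  assume "\<not> u x \<le> b"
  then have gap: "u x > b" by simp
  have cA: "compact (closure A)" using A by simp
  obtain R where R: "\<And>y. y \<in> closure A \<Longrightarrow> dist x y \<le> R"
    using bounded_closure[OF A(2)] bounded_any_center[of "closure A" x] by auto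
  \<comment> \<open>On the frontier the perturbation then adds at most half of the gap
    \<open>u x - b\<close>; \<open>R\<^sup>2 + 1\<close> keeps the denominator positive.\<close>
  define K where "K = (u x - b) / (2 * (R\<^sup>2 + 1))"
  have K: "K > 0" using gap by (simp add: K_def add_nonneg_pos)
  define f where "f y = u y + K * (dist x y)\<^sup>2" for y
  have "continuous_on (closure A) f"
    unfolding f_def by (intro continuous_intros continuous_on_subset[OF real_analytic_on_continuous(2)[OF
        u(1)] A(3)])
  then obtain y where y: "y \<in> closure A" "\<And>z. z \<in> closure A \<Longrightarrow> f z \<le> f y"
    using continuous_attains_sup[OF cA, of f] x closure_subset by blast
  have fy: "f y \<ge> u x" using y(2)[of x] x closure_subset by (auto simp: f_def)
  have "y \<notin> frontier A"
  proof
    assume "y \<in> frontier A"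
    then have "f y \<le> b + K * R\<^sup>2"
      unfolding f_def using bd[of y] R[OF y(1)] K by (intro add_mono mult_left_mono power_mono) auto
    also have "K * R\<^sup>2 \<le> K * (R\<^sup>2 + 1)" using K by simp
    also have "K * (R\<^sup>2 + 1) = (u x - b) / 2"
      using add_nonneg_pos[of "R\<^sup>2" 1] by (simp add: K_def field_simps)
    finally show False using fy gap by (simp add: field_simps)
  qed
  then have yA: "y \<in> A" using y(1) A(1) by (simp add: frontier_def interior_open)
  have mx: "\<forall>\<^sub>F z in nhds y. u z + K * (dist x z)\<^sup>2 \<le> u y + K * (dist x y)\<^sup>2"
    using eventually_nhds_in_open[OF A(1) yA]
    by (rule eventually_mono) (use y(2) closure_subset in \<open>auto simp: f_def\<close>)
  have "y \<in> U" using y(1) A(3) by auto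
  from second_partial_at_max[OF u this _ mx] K
  have "partial_deriv i (partial_deriv i u) y + 2 * K \<le> 0" for i by simp
  from this[of 1] this[of 2] lap[OF yA] K show False by (simp add: laplacian_def UNIV_2)
qed

section \<open>The critical set near a point with a negative pure second derivative\<close>

lemma concave_max:
  fixes f f' f'' :: "real \<Rightarrow> real"
  assumes f: "\<And>x. \<bar>x\<bar> < \<delta> \<Longrightarrow> (f has_real_derivative f' x) (at x)"
    and f': "\<And>x. \<bar>x\<bar> < \<delta> \<Longrightarrow> (f' has_real_derivative f'' x) (at x)"
    and neg: "\<And>x. \<bar>x\<bar> < \<delta> \<Longrightarrow> f'' x \<le> 0" and p: "\<bar>p\<bar> < \<delta>" "f' p = 0" and x: "\<bar>x\<bar> < \<delta>"
  shows "f x \<le> f p"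
proof -
  have mono: "f' b \<le> f' a" if "a \<le> b" "\<bar>a\<bar> < \<delta>" "\<bar>b\<bar> < \<delta>" for a b
    proof (rule DERIV_nonpos_imp_nonincreasing[of a b f', OF that(1)])
    fix z assume "a \<le> z" "z \<le> b"
    then have "\<bar>z\<bar> < \<delta>" using that by linarith
    then show "\<exists>y. (f' has_real_derivative y) (at z) \<and> y \<le> 0" using f' neg by blast
  qed
  show ?thesis
  proof (cases "x \<le> p")
    case True
    show ?thesis
    proof (rule DERIV_nonneg_imp_nondecreasing[of x p f, OF True])
      fix z assume "x \<le> z" "z \<le> p"
      then show "\<exists>y. (f has_real_derivative y) (at z) \<and> 0 \<le> y"
        using f[of z] mono[of z p] p x by (intro exI[of _ "f' z"]) auto
    qed
  next
    case False
    show ?thesis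
    proof (rule DERIV_nonpos_imp_nonincreasing[of p x f])
      fix z assume "p \<le> z" "z \<le> x"
      then show "\<exists>y. (f has_real_derivative y) (at z) \<and> y \<le> 0"
        using f[of z] mono[of p z] p x by (intro exI[of _ "f' z"]) auto
    qed (use False in simp)
  qed
qed

lemma grad_0_iff: "i \<noteq> j \<Longrightarrow> grad u x = 0 \<longleftrightarrow> partial_deriv i u x = 0 \<and> partial_deriv j u x = 0"
  for i j :: 2 and u :: "real^2 \<Rightarrow> real"
  using exhaust_2[of i] exhaust_2[of j] by (auto simp: grad_def vec_eq_iff forall_2)

text \<open>In direction \<open>i\<close> the function is strictly concave near \<open>a\<close>, so
  the zeros of the \<open>i\<close>-th partial derivative form a graph. If the \<open>j\<close>-th
  one vanishes along it, \<open>u\<close> is constant on this curve and each segment in direction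
  \<open>i\<close> has its maximum there; otherwise \<open>a\<close> is the only critical point
  nearby. The indices are parameters because either coordinate may be the concave one.\<close>

lemma critical_set_local_structure:
  fixes u :: "real^2 \<Rightarrow> real" and i j :: 2
  defines "P \<equiv> \<lambda>a x y. a + x *\<^sub>R axis i 1 + y *\<^sub>R axis j (1::real)"
  assumes ij: "i \<noteq> j" and u: "real_analytic_on u U" "open U" "a \<in> U"
    and r: "r > 0" "pconv c r"
    and P: "\<And>x y. \<lbrakk>\<bar>x\<bar> < r; \<bar>y\<bar> < r\<rbrakk> \<Longrightarrow> u (P a x y) = pser c x y"
    and Pi: "\<And>x y. \<lbrakk>\<bar>x\<bar> < r; \<bar>y\<bar> < r\<rbrakk> \<Longrightarrow> partial_deriv i u (P a x y) = pser (dx c) x y"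
    and Pj: "\<And>x y. \<lbrakk>\<bar>x\<bar> < r; \<bar>y\<bar> < r\<rbrakk> \<Longrightarrow> partial_deriv j u (P a x y) = pser (dy c) x y"
    and g0: "grad u a = 0" and c2: "c 2 0 < 0" and W: "open W" "a \<in> W" "W \<subseteq> U"
  obtains V where "open V" "a \<in> V" "V \<subseteq> W"
    "(\<forall>x\<in>V. grad u x = 0 \<longrightarrow> x = a) \<or>
     connected {x\<in>V. grad u x = 0} \<and> (\<forall>x\<in>V. grad u x = 0 \<longrightarrow> u x = u a) \<and> (\<forall>x\<in>V. u x \<le> u a)"
proof -
  have Pn: "P a x y $ i = a $ i + x" "P a x y $ j = a $ j + y" for x y
    using ij exhaust_2[of i] exhaust_2[of j] by (auto simp: P_def)
  have Psurj: "z = P a (z $ i - a $ i) (z $ j - a $ j)" for z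
    using ij exhaust_2[of i] exhaust_2[of j] by (auto simp: P_def intro!: vec2_eqI)
  obtain e where e: "e > 0" "ball a e \<subseteq> W" using W open_contains_ball by blast
  define s where "s = min r (e / 2)"
  have s: "s > 0" "s \<le> r" "s \<le> e / 2" using r e by (auto simp: s_def)
  have PW: "P a x y \<in> W" if "\<bar>x\<bar> < s" "\<bar>y\<bar> < s" for x y
  proof -
    have "dist (P a x y) a \<le> \<bar>x\<bar> + \<bar>y\<bar>"
      using norm_triangle_ineq[of "x *\<^sub>R axis i 1" "y *\<^sub>R axis j 1 :: real^2"]
      by (simp add: P_def dist_norm add.assoc)
    then show ?thesis using that s e by (auto intro!: subsetD[OF e(2)] simp: dist_commute)
  qed
  have P0: "P a 0 0 = a" by (simp add: P_def)
  have gP: "grad u (P a x y) = 0 \<longleftrightarrow> pser (dx c) x y = 0 \<and> pser (dy c) x y = 0" if "\<bar>x\<bar> < r" "\<bar>y\<bar> < r" for x y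
    using grad_0_iff[OF ij, of u "P a x y"] Pi[OF that] Pj[OF that] by simp
  have c1: "c 1 0 = 0" "c 0 1 = 0"
    using gP[of 0 0] P0 g0 r by (auto simp: dx_def dy_def)
  have ps: "pconv c s" using pconv_mono[OF r(2)] s by simp
  have c2': "c 2 0 \<noteq> 0" using c2 by simp
  show thesis
  proof (rule critical_curve[OF ps s(1) c1 c2'])
    fix \<psi> \<psi>' :: "real \<Rightarrow> real" and \<delta> \<epsilon> :: real
    assume \<delta>: "0 < \<delta>" "0 < \<epsilon>" "\<delta> < s" "\<epsilon> < s" and \<psi>0: "\<psi> 0 = 0"
      and \<psi>: "\<And>t. \<bar>t\<bar> < \<epsilon> \<Longrightarrow> \<bar>\<psi> t\<bar> < \<delta> \<and> (\<psi> has_real_derivative \<psi>' t) (at t)"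
      and zero: "\<And>x t. \<lbrakk>\<bar>x\<bar> < \<delta>; \<bar>t\<bar> < \<epsilon>\<rbrakk> \<Longrightarrow> pser (dx c) x t = 0 \<longleftrightarrow> x = \<psi> t"
      and sgn2: "\<And>x t. \<lbrakk>\<bar>x\<bar> < \<delta>; \<bar>t\<bar> < \<epsilon>\<rbrakk> \<Longrightarrow> pser (dx (dx c)) x t / c 2 0 > 0"
      and dich: "(\<forall>t. \<bar>t\<bar> < \<epsilon> \<longrightarrow> pser (dy c) (\<psi> t) t = 0) \<or> (\<forall>t. 0 < \<bar>t\<bar> \<and> \<bar>t\<bar> < \<epsilon> \<longrightarrow> pser (dy c) (\<psi> t) t \<noteq> 0)"
    define V where "V = {z. \<bar>z $ i - a $ i\<bar> < \<delta> \<and> \<bar>z $ j - a $ j\<bar> < \<epsilon>}"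
    have VP: "\<exists>x y. \<bar>x\<bar> < \<delta> \<and> \<bar>y\<bar> < \<epsilon> \<and> z = P a x y" if "z \<in> V" for z
      using that Psurj[of z] unfolding V_def mem_Collect_eq by blast
    have PV: "P a x y \<in> V \<longleftrightarrow> \<bar>x\<bar> < \<delta> \<and> \<bar>y\<bar> < \<epsilon>" for x y by (simp add: V_def Pn)
    have VW: "V \<subseteq> W" using VP PW \<delta> by fastforce
    have opV: "open V" unfolding V_def by (intro open_Collect_conj open_Collect_less continuous_intros)
    have aV: "a \<in> V" using \<delta> by (simp add: V_def)
    show thesis
    proof (cases "\<forall>t. \<bar>t\<bar> < \<epsilon> \<longrightarrow> pser (dy c) (\<psi> t) t = 0")
      case False
      have "x = a" if x: "x \<in> V" "grad u x = 0" for x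
      proof -
        obtain s' t where st: "\<bar>s'\<bar> < \<delta>" "\<bar>t\<bar> < \<epsilon>" "x = P a s' t" using VP[OF x(1)] by blast
        then have "s' = \<psi> t" "pser (dy c) s' t = 0" using gP[of s' t] zero[of s' t] x(2) \<delta> s by auto
        then have "t = 0" using False dich st(2) by auto
        then show ?thesis using st \<open>s' = \<psi> t\<close> \<psi>0 P0 by simp
      qed
      then show thesis using that[OF opV aV VW] by blast
    next
      case True
      define \<gamma> where "\<gamma> t = P a (\<psi> t) t" for t
      have \<gamma>V: "\<gamma> t \<in> V" "grad u (\<gamma> t) = 0" if "\<bar>t\<bar> < \<epsilon>" for t
        using \<psi>[OF that] that True zero[of "\<psi> t" t] gP[of "\<psi> t" t] \<delta> s by (auto simp: \<gamma>_def PV)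
      have crit: "{x\<in>V. grad u x = 0} = \<gamma> ` {-\<epsilon><..<\<epsilon>}"
      proof (intro subset_antisym subsetI)
        fix x assume "x \<in> {x\<in>V. grad u x = 0}"
        then obtain s' t where st: "\<bar>s'\<bar> < \<delta>" "\<bar>t\<bar> < \<epsilon>" "x = P a s' t" "grad u x = 0" using VP[of x] by blast
        then have "s' = \<psi> t" using gP[of s' t] zero[of s' t] \<delta> s by auto
        then show "x \<in> \<gamma> ` {-\<epsilon><..<\<epsilon>}" using st by (auto simp: \<gamma>_def abs_less_iff intro!: image_eqI[of _ _ t])
      next
        fix x assume "x \<in> \<gamma> ` {-\<epsilon><..<\<epsilon>}"
        then show "x \<in> {x\<in>V. grad u x = 0}" using \<gamma>V by (auto simp: abs_less_iff)
      qed
      have \<gamma>d: "(\<gamma> has_vector_derivative (\<psi>' t *\<^sub>R axis i 1 + axis j 1)) (at t)" if "\<bar>t\<bar> < \<epsilon>" for t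
      proof -
        have "(\<psi> has_vector_derivative \<psi>' t) (at t)"
          using \<psi>[OF that] by (simp add: has_real_derivative_iff_has_vector_derivative)
        then have 1: "((\<lambda>t. \<psi> t *\<^sub>R axis i 1) has_vector_derivative \<psi>' t *\<^sub>R axis i (1::real)) (at t)"
          unfolding has_vector_derivative_def by (auto intro!: derivative_eq_intros)
        have 2: "((\<lambda>t. t *\<^sub>R axis j 1) has_vector_derivative axis j (1::real)) (at t)"
          unfolding has_vector_derivative_def by (auto intro!: derivative_eq_intros)
        from has_vector_derivative_add[OF has_vector_derivative_const[of a] has_vector_derivative_add[OF 1 2]]
        show ?thesis by (simp add: \<gamma>_def[abs_def] P_def add.assoc)
      qed
      \<comment> \<open>The curve consists of critical points, so the chain rule gives derivative
        0.\<close>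
      have u\<gamma>: "((\<lambda>t. u (\<gamma> t)) has_real_derivative 0) (at t)" if "\<bar>t\<bar> < \<epsilon>" for t
      proof -
        have "(u has_derivative (\<lambda>h. grad u (\<gamma> t) \<bullet> h)) (at (\<gamma> t))"
          using \<gamma>V(1)[OF that] VW W by (intro real_analytic_on_grad_has_derivative[OF u(1,2)]) auto
        then have "(u has_derivative (\<lambda>h. 0)) (at (\<gamma> t))" using \<gamma>V(2)[OF that] by simp
        from has_derivative_compose[OF \<gamma>d[OF that, unfolded has_vector_derivative_def] this]
        show ?thesis by (simp add: has_field_derivative_def lambda_zero)
      qed
      have u\<gamma>a: "u (\<gamma> t) = u a" if "\<bar>t\<bar> < \<epsilon>" for t
      proof -
        have "u (\<gamma> t) = u (\<gamma> 0)"
          proof -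
          have "\<exists>k. \<forall>t\<in>{-\<epsilon><..<\<epsilon>}. u (\<gamma> t) = k"
            by (rule has_field_derivative_zero_constant) (auto intro!: DERIV_subset[OF u\<gamma>])
          then show ?thesis using that \<delta> by (auto simp: abs_less_iff)
        qed
        then show ?thesis by (simp add: \<gamma>_def \<psi>0 P0)
      qed
      have "connected (\<gamma> ` {-\<epsilon><..<\<epsilon>})"
      proof (rule connected_continuous_image)
        show "continuous_on {-\<epsilon><..<\<epsilon>} \<gamma>"
          by (intro continuous_at_imp_continuous_on ballI has_vector_derivative_continuous[OF \<gamma>d]) auto
      qed simp
      then have "connected {x\<in>V. grad u x = 0}" by (simp only: crit)
      moreover have "\<forall>x\<in>V. grad u x = 0 \<longrightarrow> u x = u a"
      proof (intro ballI impI)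
        fix x assume "x \<in> V" "grad u x = 0"
        then have "x \<in> \<gamma> ` {-\<epsilon><..<\<epsilon>}" using crit by blast
        then show "u x = u a" using u\<gamma>a by (auto simp: abs_less_iff)
      qed
      moreover have "u x \<le> u a" if xV: "x \<in> V" for x
      proof -
        obtain s' t where st: "\<bar>s'\<bar> < \<delta>" "\<bar>t\<bar> < \<epsilon>" "x = P a s' t" using VP[OF xV] by blast
        define s2 where "s2 = (\<delta> + s) / 2"
        have s2: "\<delta> < s2" "s2 < s" "\<epsilon> < s" using \<delta> by (auto simp: s2_def)
        define s3 where "s3 = (max s2 \<epsilon> + s) / 2"
        have s3: "s2 < s3" "\<epsilon> < s3" "s3 < s" "0 \<le> s3" using s2 \<delta> by (auto simp: s3_def)
        have "pser c s' t \<le> pser c (\<psi> t) t"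
        proof (rule concave_max[of \<delta> "\<lambda>x. pser c x t" "\<lambda>x. pser (dx c) x t" "\<lambda>x. pser (dx (dx c)) x t"])
          fix x assume x: "\<bar>x\<bar> < \<delta>"
          show "((\<lambda>x. pser c x t) has_real_derivative pser (dx c) x t) (at x)"
            using x st \<delta> by (intro DERIV_pser_x[OF ps]) auto
          show "((\<lambda>x. pser (dx c) x t) has_real_derivative pser (dx (dx c)) x t) (at x)"
            using x st \<delta> s3 s2 by (intro DERIV_pser_x[OF pconv_dx[OF ps, of s3]]) auto
          show "pser (dx (dx c)) x t \<le> 0"
            using sgn2[OF x st(2)] c2 by (simp add: zero_less_divide_iff)
        qed (use \<psi>[OF st(2)] zero[of "\<psi> t" t] st in auto)
        then show ?thesis using u\<gamma>a[OF st(2)] P[of s' t] P[of "\<psi> t" t] st \<psi>[OF st(2)] \<delta> s by (simp add: \<gamma>_def)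
      qed
      ultimately show thesis using that[OF opV aV VW] by blast
    qed
  qed
qed

section \<open>Critical points of Dirichlet eigenfunctions\<close>

locale dirichlet_eigenfunction =
  fixes \<Omega> U :: "(real^2) set" and u :: "real^2 \<Rightarrow> real" and \<mu> :: real
  assumes open_\<Omega>: "open \<Omega>" and connected_\<Omega>: "connected \<Omega>" and bounded_\<Omega>: "bounded \<Omega>"
    and open_U: "open U" and closure_subset_U: "closure \<Omega> \<subseteq> U" and analytic: "real_analytic_on u U"
    and eigen: "\<And>x. x \<in> \<Omega> \<Longrightarrow> - laplacian u x = \<mu> * u x"
    and boundary: "\<And>x. x \<in> frontier \<Omega> \<Longrightarrow> u x = 0"
    and nonzero: "\<exists>x\<in>\<Omega>. u x \<noteq> 0"
begin

lemma in_U: "x \<in> \<Omega> \<Longrightarrow> x \<in> U" "x \<in> closure \<Omega> \<Longrightarrow> x \<in> U"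
  using closure_subset_U closure_subset by auto

lemma grad_minus: "x \<in> U \<Longrightarrow> grad (\<lambda>x. - u x) x = - grad u x"
  by (simp add: grad_def vec_eq_iff partial_deriv_minus[OF analytic])

text \<open>Makes every result of this locale available for minima and for descending
  orbits.\<close>

lemma neg: "dirichlet_eigenfunction \<Omega> U (\<lambda>x. - u x) \<mu>"
proof
  show "real_analytic_on (\<lambda>x. - u x) U"
    using real_analytic_on_lincomb[OF analytic analytic, of "-1" 0] by simp
  fix x assume x: "x \<in> \<Omega>"
  have "partial_deriv i (partial_deriv i (\<lambda>x. - u x)) x = - partial_deriv i (partial_deriv i u) x" for i
  proof -
    have "partial_deriv i (partial_deriv i (\<lambda>x. - u x)) x = partial_deriv i (\<lambda>x. - partial_deriv i u x) x"
      by (rule partial_deriv_cong[OF open_U]) (use x in_U partial_deriv_minus[OF analytic] in auto)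
    then show ?thesis using partial_deriv_minus[OF real_analytic_on_partial[OF analytic] in_U(1)[OF x]] by simp
  qed
  then have "laplacian (\<lambda>x. - u x) x = - laplacian u x"
    by (simp add: laplacian_def sum_negf)
  then show "- laplacian (\<lambda>x. - u x) x = \<mu> * - u x" using eigen[OF x] by simp
qed (use open_\<Omega> connected_\<Omega> bounded_\<Omega> open_U closure_subset_U boundary nonzero in auto)

lemma compact_closure_\<Omega>: "compact (closure \<Omega>)"
  using bounded_\<Omega> by simp

lemma mem_\<Omega>_if: "x \<in> closure \<Omega> \<Longrightarrow> u x \<noteq> 0 \<Longrightarrow> x \<in> \<Omega>"
  using boundary[of x] open_\<Omega> by (auto simp: frontier_def interior_open)

text \<open>The factors 1 bring the sum into the shape \<open>\<alpha> * u x + \<beta> * v x\<close>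
  of the linear-combination lemmas, so that its expansion can be read off.\<close>

definition defect :: "real^2 \<Rightarrow> real" where
  "defect x = 1 * (1 * partial_deriv 1 (partial_deriv 1 u) x + 1 * partial_deriv 2 (partial_deriv 2 u) x)
      + \<mu> * u x"

lemma defect_eq: "defect x = laplacian u x + \<mu> * u x"
  by (simp add: defect_def laplacian_def UNIV_2)

lemma defect_analytic: "real_analytic_on defect U"
  unfolding defect_def by (intro real_analytic_on_lincomb real_analytic_on_partial analytic)

lemma defect_0: "x \<in> \<Omega> \<Longrightarrow> defect x = 0"
  using eigen[of x] by (simp add: defect_eq)

text \<open>The eigenvalue equation is given in \<open>\<Omega>\<close> only; the identity theorem
  for points of the closure carries it to the coefficients at boundary points.\<close>

lemma expands_pde:
  assumes "p \<in> closure \<Omega>" "expands u p c r"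
  shows "dx (dx c) i j + dy (dy c) i j + \<mu> * c i j = 0"
proof -
  have r: "0 < r / 2" "r / 2 < r" "0 < r / 4" "r / 4 < r / 2" using assms by (auto simp: expands_def)
  have "expands defect p (\<lambda>i j. 1 * (1 * dx (dx c) i j + 1 * dy (dy c) i j) + \<mu> * c i j) (r / 4)"
    unfolding defect_def[abs_def]
    by (intro expands_lincomb expands_partial[OF expands_partial(1)[OF assms(2) r(1,2)] r(3,4)]
        expands_partial[OF expands_partial(2)[OF assms(2) r(1,2)] r(3,4)] expands_mono[OF assms(2)])
      (use r in auto)
  from expands_coeff_0[OF open_\<Omega> _ defect_analytic defect_0 assms(1) in_U(2)[OF assms(1)] this, of i j]
  show ?thesis using in_U by auto
qed

text \<open>The same principle on a full neighbourhood: the maximum principle will be applied on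
  discs that may reach beyond \<open>\<Omega>\<close>.\<close>

lemma pde_near_closure:
  assumes "p \<in> closure \<Omega>"
  obtains e where "e > 0" "ball p e \<subseteq> U" "\<And>x. x \<in> ball p e \<Longrightarrow> laplacian u x = - \<mu> * u x"
proof -
  obtain c r where c: "expands defect p c r"
    using real_analytic_on_expands[OF defect_analytic in_U(2)[OF assms]] by blast
  obtain e where e: "e > 0" "ball p e \<subseteq> U" using open_U in_U(2)[OF assms] open_contains_ball by blast
  have z: "defect x = 0" if "x \<in> ball p r" for x
    by (rule expands_eq_0[OF open_\<Omega> _ defect_analytic defect_0 assms in_U(2)[OF assms] c that]) (use in_U in auto)
  show thesis
  proof (rule that[of "min e r"])
    show "laplacian u x = - \<mu> * u x" if "x \<in> ball p (min e r)" for x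
      using z[of x] that by (simp add: defect_eq)
  qed (use e c in \<open>auto simp: expands_def\<close>)
qed

text \<open>Unique continuation: the interior of the zero set meets \<open>\<Omega>\<close> in a set
  that is open, relatively closed by the identity theorem, and here nonempty, hence all of the
  connected \<open>\<Omega>\<close>.\<close>

lemma not_locally_zero:
  assumes "p \<in> closure \<Omega>" shows "\<not> (\<forall>\<^sub>F x in nhds p. u x = 0)"
proof
  assume "\<forall>\<^sub>F x in nhds p. u x = 0"
  then obtain S where S: "open S" "p \<in> S" "\<And>x. x \<in> S \<Longrightarrow> u x = 0"
    unfolding eventually_nhds by blast
  define A where "A = \<Omega> \<inter> interior {x. u x = 0}"
  have oA: "open A" by (simp add: A_def open_\<Omega> open_Int)
  have "S \<inter> \<Omega> \<noteq> {}" using assms S(1,2) by (meson disjoint_iff closure_iff_nhds_not_empty subset_refl inf_commute)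
  moreover have "S \<subseteq> interior {x. u x = 0}" using S by (intro interior_maximal) auto
  ultimately have "A \<noteq> {}" by (auto simp: A_def)
  moreover have "q \<in> A" if q: "q \<in> \<Omega>" "q \<in> closure A" for q
  proof -
    obtain c r where c: "expands u q c r"
      using real_analytic_on_expands[OF analytic in_U(1)[OF q(1)]] by blast
    have "u x = 0" if "x \<in> ball q r" for x
    proof (rule expands_eq_0[OF oA _ analytic _ q(2) in_U(1)[OF q(1)] c that])
      show "A \<subseteq> U" using in_U by (auto simp: A_def)
      show "u x = 0" if "x \<in> A" for x using that interior_subset by (auto simp: A_def)
    qed
    then have "ball q r \<subseteq> interior {x. u x = 0}" by (intro interior_maximal) auto
    then show ?thesis using q c by (auto simp: A_def expands_def)
  qed
  then have "closedin (top_of_set \<Omega>) A"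
    unfolding closedin_closed using closure_subset[of A] by (intro exI[of _ "closure A"]) (auto simp: A_def)
  moreover have "openin (top_of_set \<Omega>) A"
    using oA by (simp add: openin_open_eq[OF open_\<Omega>]) (simp add: A_def)
  ultimately have "A = \<Omega>" using connected_\<Omega> unfolding connected_clopen by blast
  then show False using nonzero interior_subset by (auto simp: A_def)
qed

lemma expands_nonzero:
  assumes "p \<in> closure \<Omega>" "expands u p c r"
  shows "\<exists>i j. c i j \<noteq> 0"
proof (rule ccontr)
  assume "\<not> (\<exists>i j. c i j \<noteq> 0)"
  then have "u x = 0" if "x \<in> ball p r" for x
    using assms(2) that by (simp add: expands_def pser_def case_prod_unfold)
  then have "\<forall>\<^sub>F x in nhds p. u x = 0"
    using assms(2) eventually_nhds_in_open[of "ball p r" p]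
    by (auto simp: expands_def elim: eventually_mono)
  then show False using not_locally_zero[OF assms(1)] by blast
qed

lemma nodal_critical_isolated:
  assumes p: "p \<in> closure \<Omega>" "u p = 0"
  obtains e where "e > 0" "\<And>x. \<lbrakk>x \<in> ball p e; grad u x = 0\<rbrakk> \<Longrightarrow> x = p"
proof -
  obtain c r where c: "expands u p c r" using real_analytic_on_expands[OF analytic in_U(2)[OF p(1)]] by blast
  then have r: "r > 0" "pconv c r" "0 < r / 2" "r / 2 < r" by (auto simp: expands_def)
  have "c 0 0 = 0" using expands_at[OF c] p by simp
  then obtain e where e: "e > 0"
    "\<And>x y. \<lbrakk>\<bar>x\<bar> < e; \<bar>y\<bar> < e; pser (dx c) x y = 0; pser (dy c) x y = 0\<rbrakk> \<Longrightarrow> x = 0 \<and> y = 0"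
    using nodal_gradient_isolated_zero[OF r(2,1) expands_pde[OF p(1) c] _ expands_nonzero[OF p(1) c]] by blast
  show thesis
  proof (rule that[of "min e (r / 2)"])
    show "min e (r / 2) > 0" using e r by simp
    fix x assume x: "x \<in> ball p (min e (r / 2))" "grad u x = 0"
    have "partial_deriv 1 u x = 0" "partial_deriv 2 u x = 0"
      using x(2) by (simp_all add: grad_def vec_eq_iff forall_2)
    moreover have "partial_deriv 1 u x = pser (dx c) (x$1 - p$1) (x$2 - p$2)"
      "partial_deriv 2 u x = pser (dy c) (x$1 - p$1) (x$2 - p$2)"
      using expands_partial[OF c r(3,4)] x(1) by (auto simp: expands_def)
    ultimately have "x$1 - p$1 = 0 \<and> x$2 - p$2 = 0"
      using mem_ball_vec2[OF x(1)] by (intro e(2)) auto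
    then show "x = p" by (intro vec2_eqI) auto
  qed
qed

text \<open>If \<open>\<mu> \<le> 0\<close>, then \<open>u\<close> is subharmonic where it is
  positive and at most 0 on the boundary of that region, so the maximum principle rules out positive
  values; the same holds for \<open>- u\<close>.\<close>

lemma eigenvalue_pos: "\<mu> > 0"
proof (rule ccontr)
  assume "\<not> \<mu> > 0"
  then have \<mu>: "\<mu> \<le> 0" by simp
  have le: "v x \<le> 0" if v: "dirichlet_eigenfunction \<Omega> U v \<mu>" and x: "x \<in> \<Omega>" for v x
  proof (rule ccontr)
    interpret v: dirichlet_eigenfunction \<Omega> U v \<mu> by (rule v)
    assume "\<not> v x \<le> 0"
    define A where "A = {x\<in>\<Omega>. v x > 0}"
    have vc: "continuous_on (closure \<Omega>) v"
      using real_analytic_on_continuous(2)[OF v.analytic] v.closure_subset_U continuous_on_subset by blast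
    have oA: "open A"
    proof -
      have "continuous_on \<Omega> v" using vc closure_subset continuous_on_subset by blast
      then have "open (\<Omega> \<inter> v -` {0<..})" using continuous_open_preimage open_\<Omega> open_greaterThan by blast
      moreover have "\<Omega> \<inter> v -` {0<..} = A" by (auto simp: A_def)
      ultimately show ?thesis by simp
    qed
    have "v x \<le> 0"
    proof (rule weak_maximum_principle[OF v.analytic open_U oA])
      show "bounded A" using bounded_\<Omega> by (rule bounded_subset) (auto simp: A_def)
      have cA: "closure A \<subseteq> closure \<Omega>" by (rule closure_mono) (auto simp: A_def)
      then show "closure A \<subseteq> U" using closure_subset_U by blast
      show "laplacian v y \<ge> 0" if "y \<in> A" for y
      proof -
        have "\<mu> * v y \<le> 0" using \<mu> that by (intro mult_nonpos_nonneg) (auto simp: A_def)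
        then show ?thesis using v.eigen[of y] that by (simp add: A_def)
      qed
      show "v y \<le> 0" if "y \<in> frontier A" for y
      proof (rule ccontr)
        assume "\<not> v y \<le> 0"
        have y: "y \<in> closure \<Omega>" "y \<notin> A" using that cA oA by (auto simp: frontier_def interior_open)
        then have "y \<in> \<Omega>" using v.mem_\<Omega>_if[of y] \<open>\<not> v y \<le> 0\<close> by auto
        then show False using y \<open>\<not> v y \<le> 0\<close> by (auto simp: A_def)
      qed
      show "x \<in> A" using x \<open>\<not> v x \<le> 0\<close> by (simp add: A_def)
    qed
    then show False using \<open>\<not> v x \<le> 0\<close> by simp
  qed
  have "u x = 0" if "x \<in> \<Omega>" for x
    using le[OF _ that, of u] le[OF neg that] dirichlet_eigenfunction_axioms by simp
  then show False using nonzero by blast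
qed

lemma critical_points_subset: "critical_points \<Omega> u \<subseteq> closure \<Omega>"
  by (auto simp: critical_points_def)

lemma continuous_u: "continuous_on (closure \<Omega>) u"
  using real_analytic_on_continuous(2)[OF analytic] closure_subset_U continuous_on_subset by blast

lemma continuous_grad: "continuous_on U (grad u)"
proof -
  have "continuous_on U (\<lambda>x. \<chi> i. partial_deriv i u x)"
    by (intro continuous_on_vec_lambda real_analytic_on_continuous(2)[OF real_analytic_on_partial[OF analytic]])
  then show ?thesis by (simp add: grad_def[abs_def])
qed

lemma compact_critical_points: "compact (critical_points \<Omega> u)"
proof -
  have "closedin (top_of_set (closure \<Omega>)) {x \<in> closure \<Omega>. grad u x = 0}"
    using continuous_on_subset[OF continuous_grad closure_subset_U]
    by (rule continuous_closedin_preimage_constant)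
  then show ?thesis
    unfolding critical_points_def using compact_closure_\<Omega> closedin_compact by blast
qed

text \<open>At a maximum with \<open>u p < 0\<close> the equation would make the Laplacian positive.
  If \<open>u p = 0\<close>, then \<open>u\<close> is negative and subharmonic on a punctured disc,
  so its value at \<open>p\<close> would be at most its negative maximum over a circle. Both
  arguments cover boundary points, where the equation persists.\<close>

lemma local_maximum_positive:
  assumes p: "p \<in> local_maxima \<Omega> u"
  shows "u p > 0"
proof -
  have pc: "p \<in> closure \<Omega>" "grad u p = 0" and mx: "\<forall>\<^sub>F y in nhds p. u y \<le> u p"
    using p by (auto simp: local_maxima_def critical_points_def)
  obtain e0 where e0: "e0 > 0" "ball p e0 \<subseteq> U" "\<And>x. x \<in> ball p e0 \<Longrightarrow> laplacian u x = - \<mu> * u x"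
    using pde_near_closure[OF pc(1)] by blast
  have "\<not> u p < 0"
  proof
    assume "u p < 0"
    have "partial_deriv i (partial_deriv i u) p + 2 * 0 \<le> 0" for i
      by (rule second_partial_at_max[OF analytic open_U in_U(2)[OF pc(1)], of 0 p]) (use mx in auto)
    from this[of 1] this[of 2] have "laplacian u p \<le> 0" by (simp add: laplacian_def UNIV_2)
    moreover have "laplacian u p = - \<mu> * u p" using e0 by auto
    moreover have "\<mu> * u p < 0" using \<open>u p < 0\<close> eigenvalue_pos by (simp add: mult_pos_neg)
    ultimately show False by simp
  qed
  moreover have "u p \<noteq> 0"
  proof
    assume up: "u p = 0"
    obtain e1 where e1: "e1 > 0" "\<And>x. \<lbrakk>x \<in> ball p e1; grad u x = 0\<rbrakk> \<Longrightarrow> x = p"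
      using nodal_critical_isolated[OF pc(1) up] by blast
    obtain e2 where e2: "e2 > 0" "\<And>y. dist y p < e2 \<Longrightarrow> u y \<le> 0"
      using mx up unfolding eventually_nhds_metric by auto
    define e where "e = min e0 (min e1 e2)"
    have e: "e > 0" "e \<le> e0" "e \<le> e1" "e \<le> e2"
      using e0 e1 e2 by (auto simp: e_def)
    then have eU: "ball p e \<subseteq> U" using e0(2) subset_ball[OF e(2)] by blast
    \<comment> \<open>Another zero in the disc would again be a local maximum, hence critical,
      against the isolation of \<open>p\<close>.\<close>
    have neg: "u x < 0" if x: "x \<in> ball p e" "x \<noteq> p" for x
    proof -
      have "u x \<noteq> 0"
      proof
        assume "u x = 0"
        have "\<forall>\<^sub>F y in nhds x. y \<in> ball p e" using x by (intro eventually_nhds_in_open) auto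
        then have "\<forall>\<^sub>F y in nhds x. u y \<le> u x"
          by (rule eventually_mono) (use e2 e(4) \<open>u x = 0\<close> in \<open>auto simp: dist_commute\<close>)
        then have "grad u x = 0" using x eU by (intro local_max_grad[OF analytic]) auto
        then show False using e1(2)[of x] x e by auto
      qed
      moreover have "u x \<le> 0" using e2(2)[of x] x e(4) by (auto simp: dist_commute)
      ultimately show ?thesis by simp
    qed
    define \<rho> where "\<rho> = e / 2"
    have \<rho>: "\<rho> > 0" "cball p \<rho> \<subseteq> ball p e" using e by (auto simp: \<rho>_def)
    have sph: "sphere p \<rho> \<subseteq> ball p e" using \<rho>(2) sphere_cball by blast
    have "sphere p \<rho> \<noteq> {}" using \<rho> by simp
    moreover have "continuous_on (sphere p \<rho>) u"
      by (rule continuous_on_subset[OF real_analytic_on_continuous(2)[OF analytic]]) (use sph eU in blast)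
    ultimately obtain y where y: "y \<in> sphere p \<rho>" "\<And>z. z \<in> sphere p \<rho> \<Longrightarrow> u z \<le> u y"
      using continuous_attains_sup[OF compact_sphere] by blast
    have "u y < 0" using neg[of y] y(1) sph \<rho> by auto
    have "u p \<le> u y"
    proof (rule weak_maximum_principle[OF analytic open_U, of "ball p \<rho>"])
      show "closure (ball p \<rho>) \<subseteq> U" using \<rho> eU by auto
      show "laplacian u x \<ge> 0" if "x \<in> ball p \<rho>" for x
      proof -
        have x: "x \<in> ball p e" using that e(1) by (simp add: \<rho>_def)
        then have "u x \<le> 0" using e2(2)[of x] e(4) by (auto simp: dist_commute)
        then have "\<mu> * u x \<le> 0" using eigenvalue_pos by (simp add: mult_nonneg_nonpos)
        then show ?thesis using e0(3)[of x] x e by auto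
      qed
      show "u z \<le> u y" if "z \<in> frontier (ball p \<rho>)" for z
        using y(2) that \<rho> by (simp add: frontier_ball)
    qed (use \<rho> in auto)
    then show False using up \<open>u y < 0\<close> by simp
  qed
  ultimately show ?thesis by simp
qed

lemma local_maxima_subset: "local_maxima \<Omega> u \<subseteq> \<Omega>"
  using local_maximum_positive mem_\<Omega>_if critical_points_subset by (fastforce simp: local_maxima_def)

text \<open>Since \<open>\<Delta>u = - \<mu> * u < 0\<close> at \<open>p\<close>, one pure second
  derivative is negative; \<open>flip\<close> moves it to the first coordinate if necessary.\<close>

lemma positive_critical_structure:
  assumes p: "p \<in> critical_points \<Omega> u" "u p > 0"
  obtains V where "open V" "p \<in> V" "connected (critical_points \<Omega> u \<inter> V)"
    "\<And>x. x \<in> critical_points \<Omega> u \<inter> V \<Longrightarrow> u x = u p"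
    "critical_points \<Omega> u \<inter> V = {p} \<or> critical_points \<Omega> u \<inter> V \<subseteq> local_maxima \<Omega> u"
proof -
  have pc: "p \<in> closure \<Omega>" "grad u p = 0" using p by (auto simp: critical_points_def)
  then have p\<Omega>: "p \<in> \<Omega>" using mem_\<Omega>_if p by simp
  obtain c r0 where c0: "expands u p c r0" using real_analytic_on_expands[OF analytic in_U(2)[OF pc(1)]] by blast
  \<comment> \<open>The square of half-side \<open>r0 / 4\<close> fits into the ball of radius
    \<open>r0 / 2\<close> on which the partial derivatives are expanded.\<close>
  define r where "r = r0 / 4"
  have r0: "0 < r0 / 2" "r0 / 2 < r0" and r: "r > 0" using c0 by (auto simp: expands_def r_def)
  have inb: "x \<in> ball p (r0 / 2)" if "\<bar>x$1 - p$1\<bar> < r" "\<bar>x$2 - p$2\<bar> < r" for x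
    using dist_vec2_le[of p x] that by (simp add: r_def abs_minus_commute)
  have c: "pconv c r" using c0 pconv_mono[of c r0 r] r by (auto simp: expands_def r_def)
  have ux: "u x = pser c (x$1 - p$1) (x$2 - p$2)"
    "partial_deriv 1 u x = pser (dx c) (x$1 - p$1) (x$2 - p$2)"
    "partial_deriv 2 u x = pser (dy c) (x$1 - p$1) (x$2 - p$2)"
    if "\<bar>x$1 - p$1\<bar> < r" "\<bar>x$2 - p$2\<bar> < r" for x
    using inb[OF that] expands_partial[OF c0 r0] c0 by (auto simp: expands_def)
  have "dx (dx c) 0 0 + dy (dy c) 0 0 + \<mu> * u p = 0"
    using expands_pde[OF pc(1) c0, of 0 0] expands_at[OF c0] by simp
  moreover have "\<mu> * u p > 0" using eigenvalue_pos p by simp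
  ultimately have "c 2 0 < 0 \<or> c 0 2 < 0"
    by (auto simp: dx_def dy_def numeral_2_eq_2)
  then obtain V where V: "open V" "p \<in> V" "V \<subseteq> \<Omega>"
    "(\<forall>x\<in>V. grad u x = 0 \<longrightarrow> x = p) \<or>
     connected {x\<in>V. grad u x = 0} \<and> (\<forall>x\<in>V. grad u x = 0 \<longrightarrow> u x = u p) \<and> (\<forall>x\<in>V. u x \<le> u p)"
  proof
    assume c2: "c 2 0 < 0"
    show thesis
    proof (rule critical_set_local_structure[where i = 1 and j = 2 and a = p and u = u and r = r and c
        = c and W = \<Omega> and U = U])
      fix x y assume xy: "\<bar>x\<bar> < r" "\<bar>y\<bar> < r"
      show "u (p + x *\<^sub>R axis 1 1 + y *\<^sub>R axis 2 1) = pser c x y"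
        "partial_deriv 1 u (p + x *\<^sub>R axis 1 1 + y *\<^sub>R axis 2 1) = pser (dx c) x y"
        "partial_deriv 2 u (p + x *\<^sub>R axis 1 1 + y *\<^sub>R axis 2 1) = pser (dy c) x y"
        using ux[of "p + x *\<^sub>R axis 1 1 + y *\<^sub>R axis 2 1"] xy by simp_all
    qed (use that analytic open_U in_U open_\<Omega> pc p\<Omega> r c c2 in auto)
  next
    assume c2: "c 0 2 < 0"
    show thesis
    proof (rule critical_set_local_structure[where i = 2 and j = 1 and a = p and u = u and r = r and c
        = "flip c" and W = \<Omega> and U = U])
      fix x y assume xy: "\<bar>x\<bar> < r" "\<bar>y\<bar> < r"
      show "u (p + x *\<^sub>R axis 2 1 + y *\<^sub>R axis 1 1) = pser (flip c) x y"
        "partial_deriv 2 u (p + x *\<^sub>R axis 2 1 + y *\<^sub>R axis 1 1) = pser (dx (flip c)) x y"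
        "partial_deriv 1 u (p + x *\<^sub>R axis 2 1 + y *\<^sub>R axis 1 1) = pser (dy (flip c)) x y"
        using ux[of "p + x *\<^sub>R axis 2 1 + y *\<^sub>R axis 1 1"] xy by (simp_all add: dx_flip dy_flip pser_flip)
    qed (use that analytic open_U in_U open_\<Omega> pc p\<Omega> r c c2 in \<open>auto simp: flip_def[of c 2 0]\<close>)
  qed
  have cV: "critical_points \<Omega> u \<inter> V = {x\<in>V. grad u x = 0}"
    using V(3) closure_subset by (auto simp: critical_points_def)
  show thesis
    using V(4)
  proof
    assume "\<forall>x\<in>V. grad u x = 0 \<longrightarrow> x = p"
    then have "{x\<in>V. grad u x = 0} = {p}" using pc(2) V(2) by blast
    then have "critical_points \<Omega> u \<inter> V = {p}" by (simp only: cV)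
    then show thesis using V(1,2) by (intro that[of V]) auto
  next
    assume h: "connected {x\<in>V. grad u x = 0} \<and> (\<forall>x\<in>V. grad u x = 0 \<longrightarrow> u x = u p) \<and> (\<forall>x\<in>V. u x \<le> u p)"
    have "critical_points \<Omega> u \<inter> V \<subseteq> local_maxima \<Omega> u"
    proof
      fix x assume x: "x \<in> critical_points \<Omega> u \<inter> V"
      then have ux: "u x = u p" using h cV by auto
      have "\<forall>\<^sub>F y in nhds x. y \<in> V" using V(1) x by (intro eventually_nhds_in_open) auto
      then have "\<forall>\<^sub>F y in nhds x. u y \<le> u x"
        by (rule eventually_mono) (use ux h in auto)
      then show "x \<in> local_maxima \<Omega> u" using x by (simp add: local_maxima_def)
    qed
    then show thesis using V(1,2) h by (intro that[of V]) (simp_all add: cV)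
  qed
qed

lemma nonneg_critical_isolated:
  assumes p: "p \<in> critical_points \<Omega> u" "u p \<ge> 0" "p \<notin> local_maxima \<Omega> u"
  obtains V where "open V" "critical_points \<Omega> u \<inter> V = {p}"
proof (cases "u p = 0")
  case True
  obtain e where e: "e > 0" "\<And>x. \<lbrakk>x \<in> ball p e; grad u x = 0\<rbrakk> \<Longrightarrow> x = p"
    using nodal_critical_isolated[OF _ True] p by (auto simp: critical_points_def)
  then have "critical_points \<Omega> u \<inter> ball p e = {p}" using p by (auto simp: critical_points_def)
  then show thesis using that open_ball by blast
next
  case False
  then have "u p > 0" using p by simp
  obtain V where V: "open V" "p \<in> V"
    "critical_points \<Omega> u \<inter> V = {p} \<or> critical_points \<Omega> u \<inter> V \<subseteq> local_maxima \<Omega> u"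
    using positive_critical_structure[OF p(1) \<open>u p > 0\<close>] by metis
  then show thesis using that p by blast
qed

section \<open>Saddle points and minima by symmetry, topology of the set of maxima\<close>

lemma critical_points_minus: "critical_points \<Omega> (\<lambda>x. - u x) = critical_points \<Omega> u"
  using grad_minus in_U by (auto simp: critical_points_def)

lemma local_minima_minus: "local_minima \<Omega> u = local_maxima \<Omega> (\<lambda>x. - u x)"
  by (simp add: local_minima_def local_maxima_def critical_points_minus)

lemma local_maxima_minus: "local_maxima \<Omega> u = local_minima \<Omega> (\<lambda>x. - u x)"
  by (simp add: local_minima_def local_maxima_def critical_points_minus)

lemma saddle_points_minus: "saddle_points \<Omega> (\<lambda>x. - u x) = saddle_points \<Omega> u"
  unfolding saddle_points_def critical_points_minus local_minima_minus local_maxima_minus by blast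

lemma saddle_isolated:
  assumes "p \<in> saddle_points \<Omega> u"
  obtains V where "open V" "critical_points \<Omega> u \<inter> V = {p}"
proof (cases "u p \<ge> 0")
  case True
  have "p \<in> critical_points \<Omega> u" "p \<notin> local_maxima \<Omega> u" using assms by (auto simp: saddle_points_def)
  then show thesis using nonneg_critical_isolated[OF _ True] that by metis
next
  case False
  have p: "p \<in> critical_points \<Omega> (\<lambda>x. - u x)" "- u p \<ge> 0" "p \<notin> local_maxima \<Omega> (\<lambda>x. - u x)"
    using assms False by (auto simp: saddle_points_def critical_points_minus local_minima_minus)
  show thesis
    by (rule dirichlet_eigenfunction.nonneg_critical_isolated[OF neg p]) (use that critical_points_minus in simp)
qed

lemma local_maxima_openin: "openin (top_of_set (critical_points \<Omega> u)) (local_maxima \<Omega> u)"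
proof (subst openin_subopen, intro ballI)
  fix p assume p: "p \<in> local_maxima \<Omega> u"
  then have pc: "p \<in> critical_points \<Omega> u" by (simp add: local_maxima_def)
  obtain V where V: "open V" "p \<in> V"
    "critical_points \<Omega> u \<inter> V = {p} \<or> critical_points \<Omega> u \<inter> V \<subseteq> local_maxima \<Omega> u"
    using positive_critical_structure[OF pc local_maximum_positive[OF p]] by metis
  then have "critical_points \<Omega> u \<inter> V \<subseteq> local_maxima \<Omega> u" using p by auto
  then show "\<exists>T. openin (top_of_set (critical_points \<Omega> u)) T \<and> p \<in> T \<and> T \<subseteq> local_maxima \<Omega> u"
    using V pc by (intro exI[of _ "critical_points \<Omega> u \<inter> V"]) (auto intro: openin_open_Int)
qed

text \<open>A limit of maxima is critical with \<open>u \<ge> 0\<close>; were it not a maximum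
  itself, it would be isolated among the critical points.\<close>

lemma closed_local_maxima: "closed (local_maxima \<Omega> u)"
proof (subst closure_subset_eq[symmetric], rule subsetI)
  fix p assume p: "p \<in> closure (local_maxima \<Omega> u)"
  have sub: "local_maxima \<Omega> u \<subseteq> critical_points \<Omega> u" by (auto simp: local_maxima_def)
  have pc: "p \<in> critical_points \<Omega> u"
    using p closure_minimal[OF sub] compact_critical_points compact_imp_closed by blast
  obtain f where f: "\<And>n. f n \<in> local_maxima \<Omega> u" "f \<longlonglongrightarrow> p"
    using p unfolding closure_sequential by blast
  have "p \<in> U" using pc critical_points_subset in_U by blast
  then have "(\<lambda>n. u (f n)) \<longlonglongrightarrow> u p"
    using isCont_tendsto_compose[OF real_analytic_on_continuous(1)[OF analytic] f(2)] by blast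
  then have "u p \<ge> 0"
    by (rule LIMSEQ_le_const) (use local_maximum_positive[OF f(1)] less_imp_le in blast)
  show "p \<in> local_maxima \<Omega> u"
  proof (rule ccontr)
    assume n: "p \<notin> local_maxima \<Omega> u"
    obtain V where V: "open V" "critical_points \<Omega> u \<inter> V = {p}"
      using nonneg_critical_isolated[OF pc \<open>u p \<ge> 0\<close> n] by blast
    have "V \<inter> local_maxima \<Omega> u \<noteq> {}"
      using p V by (metis IntD2 closure_iff_nhds_not_empty inf_commute insertI1 subset_refl)
    then show False using V sub n by auto
  qed
qed

text \<open>Connectedness of the neighbourhood keeps it within one component of the set of maxima,
  so these components are open in the critical set.\<close>

lemma u_locally_constant_on_maxima:
  assumes "p \<in> local_maxima \<Omega> u"
  obtains T where "openin (top_of_set (critical_points \<Omega> u)) T" "p \<in> T" "T \<subseteq> local_maxima \<Omega> u" "connected T"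
    "\<And>x. x \<in> T \<Longrightarrow> u x = u p"
proof -
  have pc: "p \<in> critical_points \<Omega> u" using assms by (simp add: local_maxima_def)
  show thesis
  proof (rule positive_critical_structure[OF pc local_maximum_positive[OF assms]])
    fix V assume V: "open V" "p \<in> V" "connected (critical_points \<Omega> u \<inter> V)"
      "\<And>x. x \<in> critical_points \<Omega> u \<inter> V \<Longrightarrow> u x = u p"
      "critical_points \<Omega> u \<inter> V = {p} \<or> critical_points \<Omega> u \<inter> V \<subseteq> local_maxima \<Omega> u"
    show thesis
    proof (rule that[of "critical_points \<Omega> u \<inter> V"])
      show "critical_points \<Omega> u \<inter> V \<subseteq> local_maxima \<Omega> u"
        using V(5) assms by (metis empty_subsetI insert_subset)
      show "openin (top_of_set (critical_points \<Omega> u)) (critical_points \<Omega> u \<inter> V)"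
        using V(1) by (rule openin_open_Int)
      show "p \<in> critical_points \<Omega> u \<inter> V" using pc V(2) by (rule IntI)
    qed (rule V(3), rule V(4))
  qed
qed

text \<open>On an open set of critical points the Laplacian vanishes, hence so does \<open>u\<close>
  in \<open>\<Omega>\<close>; but critical zeros are isolated.\<close>

lemma critical_points_empty_interior: "interior (critical_points \<Omega> u) = {}"
proof (rule ccontr)
  assume "interior (critical_points \<Omega> u) \<noteq> {}"
  define S where "S = interior (critical_points \<Omega> u)"
  have oS: "open S" by (simp add: S_def)
  have Sc: "x \<in> closure \<Omega>" "grad u x = 0" if "x \<in> S" for x
    using that interior_subset[of "critical_points \<Omega> u"] by (auto simp: S_def critical_points_def)
  have "S \<inter> \<Omega> \<noteq> {}"
  proof -
    obtain q where q: "q \<in> S" using \<open>interior (critical_points \<Omega> u) \<noteq> {}\<close> by (auto simp: S_def)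
    then have "\<Omega> \<inter> S \<noteq> {}" using Sc(1)[OF q] oS unfolding closure_iff_nhds_not_empty by blast
    then show ?thesis by blast
  qed
  then obtain p where p: "p \<in> S" "p \<in> \<Omega>" by blast
  have "partial_deriv i u x = 0" if "x \<in> S" for i x
    using Sc(2)[OF that] by (simp add: grad_def vec_eq_iff)
  then have "partial_deriv i (partial_deriv i u) p = 0" for i
    by (rule partial_deriv_eq_0[OF oS p(1)])
  then have "laplacian u p = 0" by (simp add: laplacian_def)
  then have "u p = 0" using eigen[OF p(2)] eigenvalue_pos by simp
  then obtain e where e: "e > 0" "\<And>x. \<lbrakk>x \<in> ball p e; grad u x = 0\<rbrakk> \<Longrightarrow> x = p"
    using nodal_critical_isolated[of p] p closure_subset by blast
  have "S \<inter> ball p e \<subseteq> {p}" using e Sc by blast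
  then have "S \<inter> ball p e = {p}" using p e by auto
  moreover have "open (S \<inter> ball p e)" by (intro open_Int oS open_ball)
  ultimately show False using not_open_singleton[of p] by simp
qed

end

section \<open>The ascending gradient semiflow\<close>

text \<open>The cutoff \<open>k\<close> makes the semiflow global; on \<open>closure \<Omega>\<close> it is the one of \<open>grad u\<close>. The descending
  semiflow of \<open>u\<close> is the ascending one of the eigenfunction \<open>-u\<close>.\<close>

locale gradient_semiflow = dirichlet_eigenfunction \<Omega> U u \<mu> + lipschitz_semiflow X L \<Phi>
  for \<Omega> U :: "(real^2) set" and u :: "real^2 \<Rightarrow> real" and \<mu> :: real
    and X :: "real^2 \<Rightarrow> real^2" and L :: real and \<Phi> :: "real \<Rightarrow> real^2 \<Rightarrow> real^2" +
  fixes V :: "(real^2) set" and k :: "real^2 \<Rightarrow> real"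
  assumes open_V: "open V" and closure_subset_V: "closure \<Omega> \<subseteq> V" and V_subset_U: "V \<subseteq> U"
    and X_eq: "X x = k x *\<^sub>R grad u x" and k_1: "x \<in> closure \<Omega> \<Longrightarrow> k x = 1"
    and k_pos: "x \<in> V \<Longrightarrow> k x > 0" and k_0: "x \<notin> V \<Longrightarrow> k x = 0"

lemma real_analytic_on_lipschitz:
  assumes "real_analytic_on u U" "open U" "x \<in> U"
  shows "\<exists>e>0. \<exists>L. L-lipschitz_on (cball x e) u"
proof -
  obtain e where e: "e > 0" "cball x e \<subseteq> U" using assms(2,3) open_contains_cball by blast
  have "continuous_on U (\<lambda>x. \<chi> i. partial_deriv i u x)"
    by (intro continuous_on_vec_lambda real_analytic_on_continuous(2)[OF real_analytic_on_partial[OF assms(1)]])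
  then have "continuous_on (cball x e) (grad u)"
    using continuous_on_subset[OF _ e(2)] by (simp add: grad_def[abs_def])
  then have "bounded (grad u ` cball x e)"
    using compact_continuous_image compact_cball compact_imp_bounded by blast
  then obtain B where B: "B > 0" "\<And>y. y \<in> cball x e \<Longrightarrow> norm (grad u y) \<le> B"
    unfolding bounded_pos by auto
  have "B-lipschitz_on (cball x e) u"
  proof (rule lipschitz_onI)
    fix y z assume yz: "y \<in> cball x e" "z \<in> cball x e"
    have "norm (u y - u z) \<le> B * norm (y - z)"
    proof (rule differentiable_bound[OF convex_cball _ _ yz])
      fix w assume w: "w \<in> cball x e"
      show "(u has_derivative (\<lambda>h. grad u w \<bullet> h)) (at w within cball x e)"
        using real_analytic_on_grad_has_derivative[OF assms(1,2)] w e has_derivative_at_withinI by blast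
      show "onorm (\<lambda>h. grad u w \<bullet> h) \<le> B"
      proof (rule onorm_le)
        fix h
        have "norm (grad u w \<bullet> h) \<le> norm (grad u w) * norm h" by (simp add: Cauchy_Schwarz_ineq2)
        also have "\<dots> \<le> B * norm h" using B(2)[OF w] by (rule mult_right_mono) simp
        finally show "norm (grad u w \<bullet> h) \<le> B * norm h" .
      qed
    qed
    then show "dist (u y) (u z) \<le> B * dist y z" by (simp add: dist_norm)
  qed (use B in simp)
  then show ?thesis using e by blast
qed

context dirichlet_eigenfunction
begin

lemma ex_gradient_semiflow:
  obtains X L \<Phi> V k where "gradient_semiflow \<Omega> U u \<mu> X L \<Phi> V k"
proof -
  have ne: "closure \<Omega> \<noteq> {}" using nonzero closure_subset by blast
  have "\<exists>e>0. \<exists>L. L-lipschitz_on (cball x e) (grad u)" if "x \<in> U" for x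
  proof -
    obtain e1 L1 e2 L2 where e: "e1 > 0" "L1-lipschitz_on (cball x e1) (partial_deriv 1 u)"
      "e2 > 0" "L2-lipschitz_on (cball x e2) (partial_deriv 2 u)"
      using real_analytic_on_lipschitz[OF real_analytic_on_partial[OF analytic] open_U \<open>x \<in> U\<close>] by metis
    have "(L1 + L2)-lipschitz_on (cball x (min e1 e2)) (grad u)"
    proof (rule lipschitz_onI)
      fix y z assume yz: "y \<in> cball x (min e1 e2)" "z \<in> cball x (min e1 e2)"
      have "dist (grad u y) (grad u z) \<le> dist (partial_deriv 1 u y) (partial_deriv 1 u z)
          + dist (partial_deriv 2 u y) (partial_deriv 2 u z)"
        using dist_vec2_le[of "grad u y" "grad u z"] by (simp add: grad_def dist_real_def)
      also have "\<dots> \<le> L1 * dist y z + L2 * dist y z"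
        using yz by (intro add_mono lipschitz_onD[OF e(2)] lipschitz_onD[OF e(4)]) auto
      finally show "dist (grad u y) (grad u z) \<le> (L1 + L2) * dist y z" by (simp add: algebra_simps)
    qed (use e lipschitz_on_nonneg in \<open>auto intro!: add_nonneg_nonneg\<close>)
    then show ?thesis using e by (intro exI[of _ "min e1 e2"]) auto
  qed
  from lipschitz_cutoff[OF compact_closure_\<Omega> open_U closure_subset_U ne this]
  obtain X V k L M where *: "open V" "closure \<Omega> \<subseteq> V" "V \<subseteq> U" "L-lipschitz_on UNIV X" "\<And>x. norm (X x) \<le> M"
    "\<And>x. X x = k x *\<^sub>R grad u x" "\<And>x. x \<in> closure \<Omega> \<Longrightarrow> k x = (1::real)" "\<And>x. x \<in> V \<Longrightarrow> k x > 0" "\<And>x. x \<notin> V \<Longrightarrow> k x = 0"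
    by metis
  obtain \<Phi> where "lipschitz_semiflow X L \<Phi>" using ex_lipschitz_semiflow[OF *(4,5)] by blast
  then have "gradient_semiflow \<Omega> U u \<mu> X L \<Phi> V k"
    unfolding gradient_semiflow_def gradient_semiflow_axioms_def
    using * dirichlet_eigenfunction_axioms by blast
  then show thesis by (rule that)
qed

end

context gradient_semiflow
begin

lemma \<Omega>_subset_V: "x \<in> \<Omega> \<Longrightarrow> x \<in> V"
  using closure_subset_V closure_subset by blast

text \<open>The field vanishes off \<open>V\<close>, and an equilibrium cannot be reached in finite
  time from a different point.\<close>

lemma flow_in_V:
  assumes "x \<in> V" "0 \<le> t" shows "\<Phi> t x \<in> V"
proof (rule ccontr)
  assume n: "\<Phi> t x \<notin> V"
  then have "X (\<Phi> t x) = 0" by (simp add: X_eq k_0)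
  then show False using flow_reaches_equilibrium[of t x] assms n by simp
qed

lemma flow_noncritical:
  assumes "x \<in> V" "0 \<le> t" "grad u x \<noteq> 0" shows "grad u (\<Phi> t x) \<noteq> 0"
proof
  assume "grad u (\<Phi> t x) = 0"
  then have "X (\<Phi> t x) = 0" by (simp add: X_eq)
  then show False using flow_reaches_equilibrium[of t x] assms \<open>grad u (\<Phi> t x) = 0\<close> by simp
qed

lemma flow_critical:
  assumes "grad u x = 0" "0 \<le> t" shows "\<Phi> t x = x"
  using assms flow_equilibrium by (simp add: X_eq)

lemma u_flow_DERIV:
  assumes "x \<in> V" "t > 0"
  shows "((\<lambda>t. u (\<Phi> t x)) has_real_derivative k (\<Phi> t x) * (norm (grad u (\<Phi> t x)))\<^sup>2) (at t)"
proof -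
  have "\<Phi> t x \<in> U" using flow_in_V assms V_subset_U by auto
  from has_derivative_compose[OF flow_deriv_at[OF assms(2), unfolded has_vector_derivative_def]
      real_analytic_on_grad_has_derivative[OF analytic open_U this]]
  show ?thesis
    by (simp add: has_field_derivative_def X_eq power2_norm_eq_inner mult_ac mult_commute_abs)
qed

lemma continuous_u_flow:
  assumes "x \<in> V" shows "continuous_on {0..} (\<lambda>t. u (\<Phi> t x))"
  by (rule continuous_on_compose2[OF real_analytic_on_continuous(2)[OF analytic] flow_continuous_on])
    (use flow_in_V[OF assms] V_subset_U in auto)

lemma u_flow_mono:
  assumes "x \<in> V" "0 \<le> s" "s \<le> t"
  shows "u (\<Phi> s x) \<le> u (\<Phi> t x)"
proof (rule DERIV_nonneg_imp_increasing_open[OF assms(3)])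
  fix r assume "s < r" "r < t"
  then show "\<exists>y. ((\<lambda>t. u (\<Phi> t x)) has_real_derivative y) (at r) \<and> 0 \<le> y"
    using u_flow_DERIV[OF assms(1), of r] assms(2) k_pos[OF flow_in_V[OF assms(1), of r]]
    by (intro exI[of _ "k (\<Phi> r x) * (norm (grad u (\<Phi> r x)))\<^sup>2"] conjI) auto
next
  show "continuous_on {s..t} (\<lambda>t. u (\<Phi> t x))"
    using continuous_on_subset[OF continuous_u_flow[OF assms(1)]] assms(2) by auto
qed

lemma u_flow_strict:
  assumes "x \<in> V" "grad u x \<noteq> 0" "0 \<le> s" "s < t"
  shows "u (\<Phi> s x) < u (\<Phi> t x)"
proof (rule DERIV_pos_imp_increasing_open[OF assms(4)])
  fix r assume r: "s < r" "r < t"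
  then have "r > 0" using assms by simp
  then have "k (\<Phi> r x) * (norm (grad u (\<Phi> r x)))\<^sup>2 > 0"
    using k_pos[OF flow_in_V[OF assms(1), of r]] flow_noncritical[OF assms(1) _ assms(2), of r] by simp
  then show "\<exists>y. ((\<lambda>t. u (\<Phi> t x)) has_real_derivative y) (at r) \<and> 0 < y"
    using u_flow_DERIV[OF assms(1) \<open>r > 0\<close>] by blast
next
  show "continuous_on {s..t} (\<lambda>t. u (\<Phi> t x))"
    using continuous_on_subset[OF continuous_u_flow[OF assms(1)]] assms(3) by auto
qed

section \<open>Orbits in the closure; stable and unstable sets\<close>

definition stays :: "real^2 \<Rightarrow> bool" where
  "stays x \<longleftrightarrow> (\<forall>t\<ge>0. \<Phi> t x \<in> closure \<Omega>)"

definition asc :: "real^2 \<Rightarrow> (real^2) set" where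
  "asc p = {x. stays x \<and> ((\<lambda>t. \<Phi> t x) \<longlongrightarrow> p) at_top}"

lemma stays_closure: "stays x \<Longrightarrow> x \<in> closure \<Omega>"
  unfolding stays_def by (metis flow_0 order_refl)

lemma stays_V: "stays x \<Longrightarrow> x \<in> V"
  using stays_closure closure_subset_V by blast

text \<open>On \<open>closure \<Omega>\<close> the cutoff is 1, so by uniqueness the existentially
  quantified curves in the stable and unstable sets are orbits of the semiflow.\<close>

lemma integral_curve_eq_flow:
  assumes "\<And>t. t \<ge> 0 \<Longrightarrow> \<gamma> t \<in> closure \<Omega> \<and> (\<gamma> has_vector_derivative grad u (\<gamma> t)) (at t within {0..})"
    and "t \<ge> 0"
  shows "\<gamma> t = \<Phi> t (\<gamma> 0)"
proof (rule flow_unique[OF _ assms(2)])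
  fix s assume s: "s \<in> {0..t}"
  then have "(\<gamma> has_vector_derivative X (\<gamma> s)) (at s within {0..})"
    using assms(1)[of s] k_1[of "\<gamma> s"] by (simp add: X_eq)
  then show "(\<gamma> has_vector_derivative X (\<gamma> s)) (at s within {0..t})"
    by (rule has_vector_derivative_within_subset) auto
qed

lemma flow_is_integral_curve:
  assumes "stays x" "t \<ge> 0"
  shows "((\<lambda>t. \<Phi> t x) has_vector_derivative grad u (\<Phi> t x)) (at t within {0..})"
  using flow_deriv[OF assms(2), of x] assms k_1[of "\<Phi> t x"] by (simp add: X_eq stays_def)

lemma asc_iff:
  "x \<in> asc p \<longleftrightarrow> (\<exists>\<gamma>. (\<forall>t\<ge>0. \<gamma> t \<in> closure \<Omega> \<and> (\<gamma> has_vector_derivative grad u (\<gamma> t)) (at t within {0..}))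
      \<and> \<gamma> 0 = x \<and> (\<gamma> \<longlongrightarrow> p) at_top)"
  (is "?l \<longleftrightarrow> ?r")
proof
  assume ?l
  then show ?r using flow_is_integral_curve[of x]
    by (intro exI[of _ "\<lambda>t. \<Phi> t x"]) (auto simp: asc_def stays_def)
next
  assume ?r
  then obtain \<gamma> where g: "\<And>t. t \<ge> 0 \<Longrightarrow> \<gamma> t \<in> closure \<Omega> \<and> (\<gamma> has_vector_derivative grad u (\<gamma> t)) (at t within {0..})"
    "\<gamma> 0 = x" "(\<gamma> \<longlongrightarrow> p) at_top" by blast
  have e: "\<gamma> t = \<Phi> t x" if "t \<ge> 0" for t using integral_curve_eq_flow[OF g(1) that] g(2) by simp
  have "((\<lambda>t. \<Phi> t x) \<longlongrightarrow> p) at_top"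
    using g(3) by (rule Lim_transform_eventually) (auto intro!: eventually_mono[OF eventually_ge_at_top[of 0]] e)
  then show ?l using e g(1) by (auto simp: asc_def stays_def)
qed

text \<open>Time reversal: a descending curve on \<open>{..0}\<close> is an ascending one on
  \<open>{0..}\<close>, so forward orbits suffice.\<close>

lemma unstable_set_eq_asc: "unstable_set \<Omega> u p = asc p"
proof (intro set_eqI iffI)
  fix x assume "x \<in> unstable_set \<Omega> u p"
  then obtain \<gamma> where g: "\<And>t. t \<le> 0 \<Longrightarrow> \<gamma> t \<in> closure \<Omega>
      \<and> (\<gamma> has_vector_derivative - grad u (\<gamma> t)) (at t within {..0})"
    "\<gamma> 0 = x" "(\<gamma> \<longlongrightarrow> p) at_bot"
    by (auto simp: unstable_set_def integral_curve_on_def)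
  show "x \<in> asc p"
    unfolding asc_iff
  proof (intro exI[of _ "\<lambda>t. \<gamma> (- t)"] conjI allI impI)
    fix t :: real assume t: "t \<ge> 0"
    show "\<gamma> (- t) \<in> closure \<Omega>" using g(1)[of "- t"] t by simp
    have 1: "((\<lambda>t. - t) has_vector_derivative - 1) (at t within {0..})"
      by (auto intro!: derivative_eq_intros)
    have "(\<gamma> has_vector_derivative - grad u (\<gamma> (- t))) (at (- t) within uminus ` {0..})"
      using g(1)[of "- t"] t by simp
    from vector_diff_chain_within[OF 1 this]
    show "((\<lambda>t. \<gamma> (- t)) has_vector_derivative grad u (\<gamma> (- t))) (at t within {0..})"
      by (simp add: o_def)
  next
    show "((\<lambda>t. \<gamma> (- t)) \<longlongrightarrow> p) at_top"
      using g(3) by (simp add: filterlim_at_bot_mirror)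
  qed (use g in simp)
next
  fix x assume "x \<in> asc p"
  then have x: "stays x" "((\<lambda>t. \<Phi> t x) \<longlongrightarrow> p) at_top" by (auto simp: asc_def)
  have "integral_curve_on \<Omega> u (\<lambda>t. \<Phi> (- t) x) {..0}"
    unfolding integral_curve_on_def
  proof (intro ballI conjI)
    fix t :: real assume t: "t \<in> {..0}"
    show "\<Phi> (- t) x \<in> closure \<Omega>" using x(1) t by (simp add: stays_def)
    have 1: "((\<lambda>t. - t) has_vector_derivative - 1) (at t within {..0})"
      by (auto intro!: derivative_eq_intros)
    have "((\<lambda>t. \<Phi> t x) has_vector_derivative grad u (\<Phi> (- t) x)) (at (- t) within uminus ` {..0})"
      using flow_is_integral_curve[OF x(1), of "- t"] t by simp
    from vector_diff_chain_within[OF 1 this]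
    show "((\<lambda>t. \<Phi> (- t) x) has_vector_derivative - grad u (\<Phi> (- t) x)) (at t within {..0})"
      by (simp add: o_def)
  qed
  moreover have "((\<lambda>t. \<Phi> (- t) x) \<longlongrightarrow> p) at_bot"
    using x(2) by (simp add: filterlim_at_bot_mirror)
  ultimately show "x \<in> unstable_set \<Omega> u p"
    unfolding unstable_set_def using stays_closure[OF x(1)] by (auto intro!: exI[of _ "\<lambda>t. \<Phi> (- t) x"])
qed

lemma stable_set_minus_eq_asc: "stable_set \<Omega> (\<lambda>x. - u x) p = asc p"
proof -
  have "- grad (\<lambda>x. - u x) y = grad u y" if "y \<in> closure \<Omega>" for y
    using grad_minus[OF in_U(2)[OF that]] by simp
  then have e: "integral_curve_on \<Omega> (\<lambda>x. - u x) \<gamma> {0..} \<longleftrightarrow>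
      (\<forall>t\<ge>0. \<gamma> t \<in> closure \<Omega> \<and> (\<gamma> has_vector_derivative grad u (\<gamma> t)) (at t within {0..}))" for \<gamma>
    unfolding integral_curve_on_def by (metis (no_types, lifting) atLeast_iff)
  have c: "\<gamma> 0 \<in> closure \<Omega>" if "integral_curve_on \<Omega> (\<lambda>x. - u x) \<gamma> {0..}" for \<gamma>
    using that unfolding e by simp
  show ?thesis
    unfolding set_eq_iff asc_iff stable_set_def e[symmetric] using c by blast
qed

section \<open>Omega-limit points\<close>

definition limit_pt :: "real^2 \<Rightarrow> real^2 \<Rightarrow> bool" where
  "limit_pt x q \<longleftrightarrow> (\<exists>f. filterlim f at_top sequentially \<and> (\<lambda>n::nat. \<Phi> (f n) x) \<longlonglongrightarrow> q)"

lemma limit_pt_if_tendsto: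
  assumes "((\<lambda>t. \<Phi> t x) \<longlongrightarrow> q) at_top" shows "limit_pt x q"
  unfolding limit_pt_def
  by (intro exI[of _ real] conjI filterlim_real_sequentially filterlim_compose[OF assms])

text \<open>Compactness of \<open>closure \<Omega>\<close> extracts the limit. The set
  \<open>S\<close> is free so that limit points can be located, for instance on a level set of the
  distance to \<open>K\<close>.\<close>

lemma limit_pt_if_sequence:
  assumes "stays x" "closed S" "\<And>n::nat. \<exists>t\<ge>real n. \<Phi> t x \<in> S"
  obtains q where "limit_pt x q" "q \<in> S"
proof -
  obtain s where s: "\<And>n. s n \<ge> real n" "\<And>n. \<Phi> (s n) x \<in> S" using assms(3) by metis
  have "compact (closure \<Omega> \<inter> S)" using compact_closure_\<Omega> assms(2) by blast
  moreover have "\<forall>n. \<Phi> (s n) x \<in> closure \<Omega> \<inter> S"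
    using s assms(1) by (auto simp: stays_def intro: order_trans[OF of_nat_0_le_iff s(1)])
  ultimately obtain q r where q: "q \<in> closure \<Omega> \<inter> S" "strict_mono r" "((\<lambda>n. \<Phi> (s n) x) \<circ> r) \<longlonglongrightarrow> q"
    unfolding compact_def by (metis (lifting))
  have "filterlim s at_top sequentially"
    by (rule filterlim_at_top_mono[OF filterlim_real_sequentially]) (use s in auto)
  then have "filterlim (s \<circ> r) at_top sequentially"
    unfolding o_def by (rule filterlim_compose) (rule filterlim_subseq[OF q(2)])
  then have "limit_pt x q" unfolding limit_pt_def using q(3) by (auto simp: o_def)
  then show thesis using that q by blast
qed

lemma limit_pt_closure:
  assumes "stays x" "limit_pt x q" shows "q \<in> closure \<Omega>"
proof -
  obtain f where f: "filterlim f at_top sequentially" "(\<lambda>n::nat. \<Phi> (f n) x) \<longlonglongrightarrow> q"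
    using assms(2) by (auto simp: limit_pt_def)
  have "\<forall>\<^sub>F n in sequentially. f n \<ge> 0" using f(1) by (simp add: filterlim_at_top)
  then have "\<forall>\<^sub>F n in sequentially. \<Phi> (f n) x \<in> closure \<Omega>"
    by (rule eventually_mono) (use assms in \<open>auto simp: stays_def\<close>)
  then show ?thesis using Lim_in_closed_set[OF closed_closure _ _ f(2)] by simp
qed

lemma u_flow_le_limit_pt:
  assumes "stays x" "limit_pt x q" "0 \<le> t"
  shows "u (\<Phi> t x) \<le> u q"
proof -
  obtain f where f: "filterlim f at_top sequentially" "(\<lambda>n::nat. \<Phi> (f n) x) \<longlonglongrightarrow> q"
    using assms(2) by (auto simp: limit_pt_def)
  have "q \<in> U" using limit_pt_closure[OF assms(1,2)] in_U by blast
  then have 1: "(\<lambda>n. u (\<Phi> (f n) x)) \<longlonglongrightarrow> u q"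
    using isCont_tendsto_compose[OF real_analytic_on_continuous(1)[OF analytic] f(2)] by blast
  have "\<forall>\<^sub>F n in sequentially. f n \<ge> t" using f(1) by (simp add: filterlim_at_top)
  then have "\<forall>\<^sub>F n in sequentially. u (\<Phi> t x) \<le> u (\<Phi> (f n) x)"
    by (rule eventually_mono) (use u_flow_mono[OF stays_V[OF assms(1)] assms(3)] in auto)
  then show ?thesis using tendsto_lowerbound[OF 1] by simp
qed

lemma u_flow_less_limit_pt:
  assumes "stays x" "limit_pt x q" "0 \<le> t" "grad u x \<noteq> 0"
  shows "u (\<Phi> t x) < u q"
  using u_flow_le_limit_pt[OF assms(1,2), of "t + 1"] u_flow_strict[OF stays_V[OF assms(1)] assms(4,3), of
      "t + 1"] assms(3)
  by linarith

text \<open>LaSalle's argument: if \<open>grad u q\<close> were nonzero, one more unit of time would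
  give the limit point \<open>\<Phi> 1 q\<close> with a larger value, whereas \<open>u q\<close>
  bounds \<open>u\<close> along the orbit.\<close>

lemma limit_pt_critical:
  assumes "stays x" "limit_pt x q" shows "q \<in> critical_points \<Omega> u"
proof -
  obtain f where f: "filterlim f at_top sequentially" "(\<lambda>n::nat. \<Phi> (f n) x) \<longlonglongrightarrow> q"
    using assms(2) by (auto simp: limit_pt_def)
  have q: "q \<in> closure \<Omega>" by (rule limit_pt_closure[OF assms])
  have "grad u q = 0"
  proof (rule ccontr)
    assume "grad u q \<noteq> 0"
    then have 1: "u q < u (\<Phi> 1 q)" using u_flow_strict[of q 0 1] q closure_subset_V by auto
    have "(\<lambda>n. \<Phi> 1 (\<Phi> (f n) x)) \<longlonglongrightarrow> \<Phi> 1 q"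
      using flow_continuous[of 1] f(2) by (intro isCont_tendsto_compose[of _ "\<Phi> 1"])
          (auto simp: continuous_on_eq_continuous_at)
    moreover have ev: "\<forall>\<^sub>F n in sequentially. f n \<ge> 0" using f(1) by (simp add: filterlim_at_top)
    then have "\<forall>\<^sub>F n in sequentially. \<Phi> 1 (\<Phi> (f n) x) = \<Phi> (1 + f n) x"
      by (rule eventually_mono) (simp add: flow_add)
    ultimately have lim1: "(\<lambda>n. \<Phi> (1 + f n) x) \<longlonglongrightarrow> \<Phi> 1 q" by (rule Lim_transform_eventually)
    moreover have "filterlim (\<lambda>n. 1 + f n) at_top sequentially"
      by (rule filterlim_tendsto_add_at_top[OF tendsto_const f(1)])
    ultimately have "limit_pt x (\<Phi> 1 q)" unfolding limit_pt_def by blast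
    then have l1: "limit_pt x (\<Phi> 1 q)" .
    have "\<Phi> 1 q \<in> U" using limit_pt_closure[OF assms(1) l1] in_U by blast
    then have "(\<lambda>n. u (\<Phi> (1 + f n) x)) \<longlonglongrightarrow> u (\<Phi> 1 q)"
      using isCont_tendsto_compose[OF real_analytic_on_continuous(1)[OF analytic] lim1] by blast
    moreover have "\<forall>\<^sub>F n in sequentially. u (\<Phi> (1 + f n) x) \<le> u q"
      using ev by (rule eventually_mono) (use u_flow_le_limit_pt[OF assms] in auto)
    ultimately have "u (\<Phi> 1 q) \<le> u q" by (rule tendsto_upperbound) simp
    then show False using 1 by simp
  qed
  then show ?thesis using q by (simp add: critical_points_def)
qed

end

section \<open>Basins of attraction\<close>

context dirichlet_eigenfunction
begin

text \<open>Openness in the critical set separates \<open>K\<close> from the other critical points,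
  and the common value makes \<open>u\<close> a Lyapunov function. \<open>K\<close> may be
  disconnected, so whole levels of maxima qualify.\<close>

definition attractor :: "(real^2) set \<Rightarrow> bool" where
  "attractor K \<longleftrightarrow> K \<noteq> {} \<and> compact K \<and> K \<subseteq> local_maxima \<Omega> u \<and>
     openin (top_of_set (critical_points \<Omega> u)) K \<and> (\<exists>v. \<forall>x\<in>K. u x = v)"

lemma closed_critical_minus:
  assumes "openin (top_of_set (critical_points \<Omega> u)) K"
  shows "closed (critical_points \<Omega> u - K)"
proof -
  obtain W where "open W" "K = critical_points \<Omega> u \<inter> W" using assms by (auto simp: openin_open)
  then have "critical_points \<Omega> u - K = critical_points \<Omega> u - W" by blast
  then show ?thesis using closed_Diff[OF compact_imp_closed[OF compact_critical_points] \<open>open W\<close>] by simp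
qed

lemma local_maxima_critical: "local_maxima \<Omega> u \<subseteq> critical_points \<Omega> u"
  by (auto simp: local_maxima_def)

lemma compact_local_maxima: "compact (local_maxima \<Omega> u)"
  using compact_Int_closed[OF compact_critical_points closed_local_maxima] local_maxima_critical
  by (metis inf.absorb2)

lemma maxima_level_openin:
  "openin (top_of_set (critical_points \<Omega> u)) {x \<in> local_maxima \<Omega> u. u x = v}"
proof (subst openin_subopen, intro ballI)
  fix p assume p: "p \<in> {x \<in> local_maxima \<Omega> u. u x = v}"
  show "\<exists>T. openin (top_of_set (critical_points \<Omega> u)) T \<and> p \<in> T \<and> T \<subseteq> {x \<in> local_maxima \<Omega> u. u x = v}"
  proof (rule u_locally_constant_on_maxima[of p])
    show "p \<in> local_maxima \<Omega> u" using p by simp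
    fix T assume T: "openin (top_of_set (critical_points \<Omega> u)) T" "p \<in> T" "T \<subseteq> local_maxima \<Omega> u"
      "\<And>x. x \<in> T \<Longrightarrow> u x = u p"
    have "T \<subseteq> {x \<in> local_maxima \<Omega> u. u x = v}" using T(3,4) p by auto
    with T(1,2) show ?thesis by blast
  qed
qed

lemma maxima_level_compact: "compact {x \<in> local_maxima \<Omega> u. u x = v}"
proof -
  have "closedin (top_of_set (local_maxima \<Omega> u)) {x \<in> local_maxima \<Omega> u. u x = v}"
    using continuous_on_subset[OF continuous_u, of "local_maxima \<Omega> u"] local_maxima_critical critical_points_subset
    by (intro continuous_closedin_preimage_constant) auto
  then show ?thesis using compact_local_maxima closedin_compact by blast
qed

text \<open>Serves for an orbit with a limit point among the maxima outside \<open>K\<close>: the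
  rest of that level is an attractor disjoint from \<open>K\<close>. The case \<open>K = {}\<close>
  yields the whole level.\<close>

lemma attractor_level:
  assumes "{x \<in> local_maxima \<Omega> u. u x = v} - K \<noteq> {}" "attractor K \<or> K = {}"
  shows "attractor ({x \<in> local_maxima \<Omega> u. u x = v} - K)"
proof -
  let ?M = "{x \<in> local_maxima \<Omega> u. u x = v}"
  obtain W where W: "open W" "K = critical_points \<Omega> u \<inter> W"
    using assms(2) by (auto simp: attractor_def openin_open)
  have "?M - K = ?M - W" using W(2) local_maxima_critical by blast
  then have "compact (?M - K)" using compact_diff[OF maxima_level_compact W(1)] by simp
  moreover have "closedin (top_of_set (critical_points \<Omega> u)) K"
    using assms(2) local_maxima_critical
    by (auto simp: attractor_def intro!: closed_subset compact_imp_closed)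
  then have "openin (top_of_set (critical_points \<Omega> u)) (?M - K)"
    by (rule openin_diff[OF maxima_level_openin])
  ultimately show ?thesis using assms(1) unfolding attractor_def by blast
qed

end

context gradient_semiflow
begin

text \<open>Since \<open>infdist\<close> to the empty set is 0, the notion is meaningful for
  nonempty \<open>K\<close> only, which \<open>attractor\<close> provides.\<close>

definition tends_to_set :: "real^2 \<Rightarrow> (real^2) set \<Rightarrow> bool" where
  "tends_to_set x K \<longleftrightarrow> ((\<lambda>t. infdist (\<Phi> t x) K) \<longlongrightarrow> 0) at_top"

text \<open>If the orbit kept returning to \<open>K\<close> and leaving again, it would be at
  distance exactly \<open>e\<close> from \<open>K\<close> at arbitrarily late times and have a
  critical limit point there, inside the gap between \<open>K\<close> and the other critical
  points.\<close>

lemma tends_to_set_if_limit_pt: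
  assumes x: "stays x" "limit_pt x q" "q \<in> K" and K: "compact K" "closed (critical_points \<Omega> u - K)"
  shows "tends_to_set x K"
proof -
  have K0: "K \<noteq> {}" "closed K" using x(3) K(1) compact_imp_closed by auto
  obtain \<delta> where \<delta>: "\<delta> > 0" "\<And>y z. y \<in> K \<Longrightarrow> z \<in> critical_points \<Omega> u - K \<Longrightarrow> \<delta> \<le> dist y z"
    using separate_compact_closed[OF K] by (metis Diff_disjoint)
  have far: "infdist z K \<ge> \<delta>" if "z \<in> critical_points \<Omega> u - K" for z
    using infdist_attains_inf[OF K0(2,1), of z] \<delta>(2)[OF _ that] by (metis dist_commute)
  have cont: "continuous_on {0..} (\<lambda>t. infdist (\<Phi> t x) K)"
    by (intro continuous_intros flow_continuous_on)
  obtain f where f: "filterlim f at_top sequentially" "(\<lambda>n::nat. \<Phi> (f n) x) \<longlonglongrightarrow> q"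
    using x(2) by (auto simp: limit_pt_def)
  have fK: "(\<lambda>n. infdist (\<Phi> (f n) x) K) \<longlonglongrightarrow> 0"
    using tendsto_infdist[OF f(2), of K] x(3) by simp
  have main: "\<forall>\<^sub>F t in at_top. infdist (\<Phi> t x) K < e" if e: "0 < e" "e < \<delta>" for e
  proof (rule ccontr)
    assume "\<not> (\<forall>\<^sub>F t in at_top. infdist (\<Phi> t x) K < e)"
    then have far_often: "\<exists>t\<ge>T. infdist (\<Phi> t x) K \<ge> e" for T
      unfolding eventually_at_top_linorder by (meson not_le)
    have "\<exists>s\<ge>real n. \<Phi> s x \<in> {y. infdist y K = e}" for n :: nat
    proof -
      obtain t where t: "t \<ge> real n" "infdist (\<Phi> t x) K \<ge> e" using far_often by blast
      have "\<forall>\<^sub>F m in sequentially. infdist (\<Phi> (f m) x) K < e" using fK e(1) by (rule order_tendstoD)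
      moreover have "\<forall>\<^sub>F m in sequentially. f m \<ge> t" using f(1) by (simp add: filterlim_at_top)
      ultimately have "\<forall>\<^sub>F m in sequentially. infdist (\<Phi> (f m) x) K < e \<and> f m \<ge> t" by (rule eventually_conj)
      then obtain m where m: "infdist (\<Phi> (f m) x) K < e" "f m \<ge> t" using eventually_happens'
          sequentially_bot by blast
      have "0 \<le> t" using t(1) of_nat_0_le_iff[of n] by linarith
      then have "continuous_on {t..f m} (\<lambda>t. infdist (\<Phi> t x) K)" by (intro continuous_on_subset[OF cont]) auto
      then obtain s where "s \<ge> t" "infdist (\<Phi> s x) K = e"
        using IVT2'[of "\<lambda>t. infdist (\<Phi> t x) K" "f m" e t] m t by auto
      then show ?thesis using t(1) by (intro exI[of _ s]) auto
    qed
    moreover have "closed {y. infdist y K = e}" by (intro closed_Collect_eq continuous_intros)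
    ultimately obtain q' where q': "limit_pt x q'" "infdist q' K = e"
      using limit_pt_if_sequence[OF x(1), of "{y. infdist y K = e}"] by auto
    then have "q' \<in> critical_points \<Omega> u" using limit_pt_critical[OF x(1)] by blast
    moreover have "q' \<notin> K" using q'(2) e(1) by auto
    ultimately show False using far[of q'] q'(2) e(2) by auto
  qed
  show ?thesis
    unfolding tends_to_set_def
  proof (rule order_tendstoI)
    fix a :: real assume "a < 0"
    then show "\<forall>\<^sub>F t in at_top. a < infdist (\<Phi> t x) K"
      by (intro always_eventually allI) (rule less_le_trans[OF _ infdist_nonneg])
  next
    fix a :: real assume "0 < a"
    then have "\<forall>\<^sub>F t in at_top. infdist (\<Phi> t x) K < min a (\<delta> / 2)" using \<delta>(1) by (intro main) auto
    then show "\<forall>\<^sub>F t in at_top. infdist (\<Phi> t x) K < a" by (rule eventually_mono) auto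
  qed
qed

lemma limit_pt_in_if_tends_to_set:
  assumes "tends_to_set x K" "limit_pt x q" "closed K" "K \<noteq> {}"
  shows "q \<in> K"
proof -
  obtain f where f: "filterlim f at_top sequentially" "(\<lambda>n::nat. \<Phi> (f n) x) \<longlonglongrightarrow> q"
    using assms(2) by (auto simp: limit_pt_def)
  have "(\<lambda>n. infdist (\<Phi> (f n) x) K) \<longlonglongrightarrow> 0"
    using filterlim_compose[OF assms(1)[unfolded tends_to_set_def] f(1)] .
  then have "infdist q K = 0"
    using tendsto_infdist[OF f(2), of K] LIMSEQ_unique by blast
  then show ?thesis using in_closed_iff_infdist_zero[OF assms(3,4)] by blast
qed

lemma tends_to_singleton: "tends_to_set x {p} \<longleftrightarrow> ((\<lambda>t. \<Phi> t x) \<longlongrightarrow> p) at_top"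
  unfolding tends_to_set_def by (simp add: tendsto_dist_iff[of _ p])

lemma ex_limit_pt:
  assumes "stays x" obtains q where "limit_pt x q"
  by (rule limit_pt_if_sequence[OF assms closed_UNIV]) (use that in auto)

text \<open>Between two points of \<open>\<Omega>\<close> an orbit can touch \<open>frontier \<Omega>\<close> only at the instant where \<open>u\<close> changes sign.\<close>

lemma flow_between:
  assumes x: "x \<in> \<Omega>" and T: "\<Phi> T x \<in> \<Omega>" and t: "0 \<le> t" "t \<le> T"
  shows "\<Phi> t x \<in> closure \<Omega>"
proof -
  have xV: "x \<in> V" using x by (rule \<Omega>_subset_V)
  \<comment> \<open>While \<open>u\<close> is nonzero along it, an orbit segment is a connected set
    that misses \<open>frontier \<Omega>\<close>, so one end in \<open>\<Omega>\<close> forces the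
    other to be there.\<close>
  have path: "\<Phi> b x \<in> \<Omega> \<and> \<Phi> a x \<in> \<Omega>"
    if ab: "0 \<le> a" "a \<le> b" "\<Phi> a x \<in> \<Omega> \<or> \<Phi> b x \<in> \<Omega>" and ne: "\<And>s. a \<le> s \<Longrightarrow> s \<le> b \<Longrightarrow> u (\<Phi> s x) \<noteq> 0" for a b
  proof -
    let ?S = "(\<lambda>t. \<Phi> t x) ` {a..b}"
    have "connected ?S"
      using ab by (intro connected_continuous_image continuous_on_subset[OF flow_continuous_on]) auto
    moreover have "?S \<inter> \<Omega> \<noteq> {}" using ab by fastforce
    moreover have "?S \<inter> frontier \<Omega> = {}" using ne boundary by fastforce
    ultimately have "?S \<subseteq> \<Omega>" using connected_Int_frontier[of ?S \<Omega>] by blast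
    then show ?thesis using ab by auto
  qed
  have neg: "\<Phi> s x \<in> \<Omega>" if "0 \<le> s" "u (\<Phi> s x) < 0" for s
  proof -
    have "u (\<Phi> r x) \<noteq> 0" if "0 \<le> r" "r \<le> s" for r
      using u_flow_mono[OF xV that] \<open>u (\<Phi> s x) < 0\<close> by linarith
    then show ?thesis using path[of 0 s] that x by simp
  qed
  consider "u (\<Phi> t x) < 0" | "u (\<Phi> t x) > 0" | "u (\<Phi> t x) = 0" by linarith
  then show ?thesis
  proof cases
    case 1
    then show ?thesis using neg[OF t(1)] closure_subset by blast
  next
    case 2
    have "u (\<Phi> r x) \<noteq> 0" if "t \<le> r" "r \<le> T" for r
      using u_flow_mono[OF xV t(1) that(1)] 2 by linarith
    then show ?thesis using path[of t T] t T closure_subset by blast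
  next
    case 3
    show ?thesis
    proof (cases "t = 0 \<or> grad u x = 0")
      case True
      then show ?thesis using flow_critical[of x t] t x subsetD[OF closure_subset, of x \<Omega>] by auto
    next
      case False
      \<comment> \<open>Strict growth makes \<open>u\<close> negative before time \<open>t\<close>,
        so the orbit was in \<open>\<Omega>\<close> until then and is in the closure at time
        \<open>t\<close>.\<close>
      have "\<Phi> s x \<in> \<Omega>" if "s \<in> {0..<t}" for s
        using u_flow_strict[OF xV, of s t] that False 3 by (intro neg) auto
      then have "closure ((\<lambda>t. \<Phi> t x) ` {0..<t}) \<subseteq> closure \<Omega>" by (intro closure_mono) auto
      moreover have cl: "closure {0..<t} = {0..t}" using False t by simp
      moreover have "(\<lambda>t. \<Phi> t x) ` closure {0..<t} \<subseteq> closure ((\<lambda>t. \<Phi> t x) ` {0..<t})"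
        unfolding cl
        by (rule image_closure_subset[of "{0..<t}", unfolded cl])
          (auto intro!: continuous_on_subset[OF flow_continuous_on] subsetD[OF closure_subset])
      ultimately show ?thesis using t by fastforce
    qed
  qed
qed

definition basin :: "(real^2) set \<Rightarrow> (real^2) set" where
  "basin K = {x \<in> \<Omega>. tends_to_set x K}"

text \<open>\<open>basin\<close> speaks only of the end of the orbit, which lies near
  \<open>K\<close> and so inside \<open>\<Omega>\<close>; \<open>flow_between\<close> excludes
  excursions out of \<open>closure \<Omega>\<close> before that.\<close>

lemma basin_stays:
  assumes K: "attractor K" and x: "x \<in> basin K"
  shows "stays x"
proof -
  have K': "K \<noteq> {}" "compact K" "K \<subseteq> \<Omega>" using K local_maxima_subset by (auto simp: attractor_def)
  obtain e where e: "e > 0" "{x. infdist x K \<le> e} \<subseteq> \<Omega>"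
    using compact_in_open_separated[OF K'(1,2) open_\<Omega> K'(3)] by auto
  have "\<forall>\<^sub>F t in at_top. infdist (\<Phi> t x) K < e"
    using x e(1) unfolding basin_def tends_to_set_def by (auto intro: order_tendstoD)
  then obtain T where T: "\<And>t. t \<ge> T \<Longrightarrow> infdist (\<Phi> t x) K < e"
    unfolding eventually_at_top_linorder by blast
  show ?thesis
    unfolding stays_def
  proof (intro allI impI)
    fix t :: real assume "t \<ge> 0"
    moreover have "\<Phi> (max t T) x \<in> \<Omega>" using e(2) T[of "max t T"] by force
    ultimately show "\<Phi> t x \<in> closure \<Omega>" using flow_between[of x "max t T" t] x by (auto simp: basin_def)
  qed
qed

lemma tends_to_set_shift:
  assumes "0 \<le> s" shows "tends_to_set (\<Phi> s x) K \<longleftrightarrow> tends_to_set x K"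
proof -
  have "\<forall>\<^sub>F t in at_top. infdist (\<Phi> t (\<Phi> s x)) K = infdist (\<Phi> (t + s) x) K"
    using eventually_ge_at_top[of 0] by (rule eventually_mono) (simp add: flow_add assms)
  then have "tends_to_set (\<Phi> s x) K \<longleftrightarrow> ((\<lambda>t. infdist (\<Phi> (t + s) x) K) \<longlongrightarrow> 0) at_top"
    unfolding tends_to_set_def by (rule tendsto_cong)
  also have "\<dots> \<longleftrightarrow> tends_to_set x K"
    unfolding tends_to_set_def
  proof
    assume "((\<lambda>t. infdist (\<Phi> (t + s) x) K) \<longlongrightarrow> 0) at_top"
    from filterlim_compose[OF this filterlim_tendsto_add_at_top[OF tendsto_const[of "- s"] filterlim_ident]]
    show "((\<lambda>t. infdist (\<Phi> t x) K) \<longlongrightarrow> 0) at_top" by simp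
  next
    assume "((\<lambda>t. infdist (\<Phi> t x) K) \<longlongrightarrow> 0) at_top"
    from filterlim_compose[OF this filterlim_tendsto_add_at_top[OF tendsto_const[of s] filterlim_ident]]
    show "((\<lambda>t. infdist (\<Phi> (t + s) x) K) \<longlongrightarrow> 0) at_top" by (simp add: add.commute)
  qed
  finally show ?thesis .
qed

text \<open>\<open>u\<close> serves as a strict Lyapunov function near \<open>K\<close>.\<close>

lemma open_trapping_neighbourhood:
  assumes K: "attractor K"
  obtains G where "open G" "K \<subseteq> G" "G \<subseteq> basin K"
proof -
  have K': "K \<noteq> {}" "compact K" "K \<subseteq> \<Omega>" "K \<subseteq> local_maxima \<Omega> u" "openin (top_of_set (critical_points \<Omega> u)) K"
    using K local_maxima_subset by (auto simp: attractor_def)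
  obtain v where v: "\<And>x. x \<in> K \<Longrightarrow> u x = v" using K by (auto simp: attractor_def)
  obtain W where W: "open W" "K = critical_points \<Omega> u \<inter> W" using K'(5) by (auto simp: openin_open)
  \<comment> \<open>In \<open>B\<close> the value \<open>v\<close> is maximal and, thanks to
    \<open>W\<close>, all critical points belong to \<open>K\<close>.\<close>
  define B where "B = \<Omega> \<inter> W \<inter> interior {y. u y \<le> v}"
  have "K \<subseteq> interior {y. u y \<le> v}"
  proof
    fix x assume x: "x \<in> K"
    then have "\<forall>\<^sub>F y in nhds x. u y \<le> v" using K'(4) v by (auto simp: local_maxima_def)
    then show "x \<in> interior {y. u y \<le> v}" by (simp add: eventually_nhds interior_def) blast
  qed
  then have KB: "K \<subseteq> B" "open B" using K' W open_\<Omega> by (auto simp: B_def)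
  \<comment> \<open>Equality would make \<open>y\<close> another local maximum, hence
    critical.\<close>
  have less: "u y < v" if y: "y \<in> B" "y \<notin> K" for y
  proof (rule ccontr)
    assume "\<not> u y < v"
    then have uy: "u y = v" using y interior_subset[of "{y. u y \<le> v}"] by (auto simp: B_def)
    have "\<forall>\<^sub>F z in nhds y. z \<in> interior {y. u y \<le> v}" using y by (intro eventually_nhds_in_open) (auto simp: B_def)
    then have "\<forall>\<^sub>F z in nhds y. u z \<le> u y"
      by (rule eventually_mono) (use interior_subset uy in auto)
    then have "grad u y = 0" using y in_U by (intro local_max_grad[OF analytic]) (auto simp: B_def)
    then have "y \<in> K" using y W closure_subset by (auto simp: B_def critical_points_def)
    then show False using y by simp
  qed
  obtain e where e: "e > 0" "{x. infdist x K \<le> e} \<subseteq> B"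
    using compact_in_open_separated[OF K'(1,2) KB(2,1)] by auto
  define S where "S = {x. infdist x K = e}"
  have SB: "S \<subseteq> B" "S \<inter> K = {}" using e by (auto simp: S_def)
  have "compact S"
  proof -
    have "closed S" unfolding S_def by (intro closed_Collect_eq continuous_intros)
    moreover have "bounded S" using SB bounded_\<Omega> by (auto simp: B_def intro: bounded_subset)
    ultimately show ?thesis by (simp add: compact_eq_bounded_closed)
  qed
  have cS: "continuous_on S u"
    using SB closure_subset by (intro continuous_on_subset[OF continuous_u]) (auto simp: B_def)
  \<comment> \<open>The gap between \<open>m\<close> and \<open>v\<close> is the barrier: an orbit
    starting above \<open>m\<close> cannot reach \<open>S\<close>, as \<open>u\<close> does not
    decrease along it. If \<open>S\<close> is empty, any number below \<open>v\<close>
    serves.\<close>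
  obtain m where m: "m < v" "\<And>y. y \<in> S \<Longrightarrow> u y \<le> m"
  proof (cases "S = {}")
    case True
    then show thesis using that[of "v - 1"] by simp
  next
    case False
    then obtain y where "y \<in> S" "\<And>z. z \<in> S \<Longrightarrow> u z \<le> u y"
      using continuous_attains_sup[OF \<open>compact S\<close> _ cS] by blast
    then show thesis using that[of "u y"] less[of y] SB by blast
  qed
  define G where "G = {x. infdist x K < e} \<inter> (\<Omega> \<inter> u -` {m<..})"
  have "open (\<Omega> \<inter> u -` {m<..})"
    by (rule continuous_open_preimage[OF continuous_on_subset[OF continuous_u closure_subset] open_\<Omega>]) simp
  moreover have "open {x. infdist x K < e}" by (intro open_Collect_less continuous_intros)
  ultimately have "open G" unfolding G_def by (rule open_Int[rotated])
  moreover have "K \<subseteq> G" using v m(1) e K' by (auto simp: G_def)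
  moreover have "G \<subseteq> basin K"
  proof
    fix x assume x: "x \<in> G"
    then have x\<Omega>: "x \<in> \<Omega>" "infdist x K < e" "u x > m" by (auto simp: G_def)
    have near: "infdist (\<Phi> t x) K < e" if t: "t \<ge> 0" for t
    proof (rule ccontr)
      assume "\<not> infdist (\<Phi> t x) K < e"
      moreover have "continuous_on {0..t} (\<lambda>t. infdist (\<Phi> t x) K)"
        by (intro continuous_intros continuous_on_subset[OF flow_continuous_on]) auto
      ultimately obtain s where s: "s \<ge> 0" "infdist (\<Phi> s x) K = e"
        using IVT'[of "\<lambda>t. infdist (\<Phi> t x) K" 0 e t] x\<Omega> t by auto
      then have "u (\<Phi> s x) \<le> m" using m by (simp add: S_def)
      then show False using u_flow_mono[OF \<Omega>_subset_V[OF x\<Omega>(1)], of 0 s] s x\<Omega> by simp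
    qed
    have inB: "\<Phi> t x \<in> B" if "t \<ge> 0" for t using near[OF that] e(2) by force
    then have st: "stays x" unfolding stays_def B_def using closure_subset by blast
    have "closed {x. infdist x K \<le> e}" by (intro closed_Collect_le continuous_intros)
    moreover have "\<exists>t\<ge>real n. \<Phi> t x \<in> {x. infdist x K \<le> e}" for n
      using near[of "real n"] by (intro exI[of _ "real n"]) auto
    ultimately obtain q where q: "limit_pt x q" "q \<in> {x. infdist x K \<le> e}"
      using limit_pt_if_sequence[OF st] by metis
    have "q \<in> K" using limit_pt_critical[OF st q(1)] q(2) e(2) W by (auto simp: B_def)
    then have "tends_to_set x K"
      by (rule tends_to_set_if_limit_pt[OF st q(1) _ K'(2) closed_critical_minus[OF K'(5)]])
    then show "x \<in> basin K" using x\<Omega> by (simp add: basin_def)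
  qed
  ultimately show thesis by (rule that)
qed

lemma attractor_subset_basin: "attractor K \<Longrightarrow> K \<subseteq> basin K"
  using open_trapping_neighbourhood by blast

text \<open>The orbit of \<open>x\<close> is in the trapping neighbourhood at some finite time
  \<open>T\<close>, and so are those of nearby points, since \<open>\<Phi> T\<close> is
  continuous.\<close>

lemma open_basin:
  assumes K: "attractor K" shows "open (basin K)"
proof (subst open_subopen, intro ballI)
  fix x assume x: "x \<in> basin K"
  obtain G where G: "open G" "K \<subseteq> G" "G \<subseteq> basin K" using open_trapping_neighbourhood[OF K] by blast
  have K': "K \<noteq> {}" "compact K" using K by (auto simp: attractor_def)
  obtain e where e: "e > 0" "{x. infdist x K \<le> e} \<subseteq> G"
    using compact_in_open_separated[OF K' G(1,2)] by auto
  have "\<forall>\<^sub>F t in at_top. infdist (\<Phi> t x) K < e"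
    using x e(1) unfolding basin_def tends_to_set_def by (auto intro: order_tendstoD)
  then obtain T0 where T0: "\<And>t. t \<ge> T0 \<Longrightarrow> infdist (\<Phi> t x) K < e"
    unfolding eventually_at_top_linorder by blast
  define T where "T = max 0 T0"
  have T: "T \<ge> 0" "\<Phi> T x \<in> G" using e(2) T0[of T] by (auto simp: T_def intro!: subsetD[OF e(2)] less_imp_le)
  have "open (\<Omega> \<inter> \<Phi> T -` G)"
    by (intro open_Int open_\<Omega> open_vimage G(1) flow_continuous T)
  moreover have "\<Omega> \<inter> \<Phi> T -` G \<subseteq> basin K"
  proof
    fix y assume y: "y \<in> \<Omega> \<inter> \<Phi> T -` G"
    then have "tends_to_set (\<Phi> T y) K" using G(3) by (auto simp: basin_def)
    then show "y \<in> basin K" using y tends_to_set_shift[OF T(1)] by (simp add: basin_def)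
  qed
  ultimately show "\<exists>T. open T \<and> x \<in> T \<and> T \<subseteq> basin K"
    using x T by (intro exI[of _ "\<Omega> \<inter> \<Phi> T -` G"]) (auto simp: basin_def)
qed

lemma basin_limit_pt:
  assumes "attractor K" "x \<in> basin K" "limit_pt x q"
  shows "q \<in> K"
  using limit_pt_in_if_tends_to_set[OF _ assms(3), of K] assms
  by (auto simp: attractor_def basin_def compact_imp_closed)

text \<open>The orbit has an omega-limit point, which lies in both attractors.\<close>

lemma basins_meet:
  assumes "attractor K" "attractor K'" "x \<in> basin K" "x \<in> basin K'"
  shows "K \<inter> K' \<noteq> {}"
proof -
  obtain q where "limit_pt x q" using ex_limit_pt[OF basin_stays[OF assms(1,3)]] by blast
  then show ?thesis using basin_limit_pt assms by blast
qed

lemma basin_asc: "attractor K \<Longrightarrow> x \<in> basin K \<Longrightarrow> x \<in> asc p \<Longrightarrow> p \<in> K"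
  using basin_limit_pt limit_pt_if_tendsto by (auto simp: asc_def)

end

section \<open>Neumann domains\<close>

text \<open>The closed sets are cut down to a closed ball in \<open>E\<close>. If none had interior
  points in \<open>E\<close>, the complements would be open and dense, yet their intersection misses
  the ball.\<close>

lemma Baire_interior:
  fixes E :: "'a::{real_normed_vector,heine_borel} set"
  assumes E: "open E" "E \<noteq> {}" and F: "countable \<F>" "\<And>S. S \<in> \<F> \<Longrightarrow> closed S" "E \<subseteq> \<Union>\<F>"
  shows "\<exists>S\<in>\<F>. E \<inter> interior S \<noteq> {}"
proof (rule ccontr)
  assume "\<not> ?thesis"
  then have none: "E \<inter> interior S = {}" if "S \<in> \<F>" for S using that by blast
  obtain x where "x \<in> E" using E(2) by blast
  then obtain e where xe: "e > 0" "cball x e \<subseteq> E" using E(1) open_contains_cball by blast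
  define \<G> where "\<G> = (\<lambda>S. - (S \<inter> cball x e)) ` \<F>"
  have "UNIV \<subseteq> closure (\<Inter>\<G>)"
  proof (rule Baire[OF closed_UNIV])
    show "countable \<G>" using F(1) by (simp add: \<G>_def)
    fix T assume "T \<in> \<G>"
    then obtain S where S: "S \<in> \<F>" "T = - (S \<inter> cball x e)" by (auto simp: \<G>_def)
    have "interior (S \<inter> cball x e) \<subseteq> E \<inter> interior S"
      using interior_subset xe(2) by (auto simp: interior_Int)
    then have "interior (S \<inter> cball x e) = {}" using none[OF S(1)] by blast
    then have "closure T = UNIV" unfolding S(2) closure_complement by (simp only: Compl_empty_eq)
    moreover have "open T" using S F(2) by (auto intro!: open_Compl closed_Int)
    ultimately show "openin (top_of_set UNIV) T \<and> UNIV \<subseteq> closure T" by simp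
  qed
  moreover have "\<Inter>\<G> \<subseteq> - cball x e"
  proof
    fix y assume y: "y \<in> \<Inter>\<G>"
    show "y \<in> - cball x e"
    proof
      assume "y \<in> cball x e"
      then obtain S where "S \<in> \<F>" "y \<in> S" using F(3) xe by blast
      then show False using y \<open>y \<in> cball x e\<close> by (auto simp: \<G>_def)
    qed
  qed
  ultimately have "x \<in> closure (- cball x e)" using closure_mono by blast
  moreover have "x \<in> interior (cball x e)" using xe(1) ball_subset_cball by (auto simp: mem_interior)
  ultimately show False by (simp add: closure_complement)
qed

context dirichlet_eigenfunction
begin

lemma stable_set_le:
  assumes "y \<in> stable_set \<Omega> u q" shows "u q \<le> u y"
proof -
  obtain X L \<Phi> V k where "gradient_semiflow \<Omega> U (\<lambda>x. - u x) \<mu> X L \<Phi> V k"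
    by (rule dirichlet_eigenfunction.ex_gradient_semiflow[OF neg])
  then interpret n: gradient_semiflow \<Omega> U "\<lambda>x. - u x" \<mu> X L \<Phi> V k .
  have "y \<in> n.asc q" using assms n.stable_set_minus_eq_asc[of q] by simp
  then have "n.stays y" "n.limit_pt y q" using n.limit_pt_if_tendsto by (auto simp: n.asc_def)
  from n.u_flow_le_limit_pt[OF this, of 0] show ?thesis by simp
qed

lemma attractor_isolated:
  assumes "p \<in> isolated_maxima \<Omega> u" shows "attractor {p}"
proof -
  obtain T where T: "p \<in> local_maxima \<Omega> u" "open T" "T \<inter> local_maxima \<Omega> u = {p}"
    using assms by (auto simp: isolated_maxima_def isolated_in_def)
  have "openin (top_of_set (critical_points \<Omega> u)) (local_maxima \<Omega> u \<inter> T)"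
    using local_maxima_openin T(2) by (rule openin_Int_open)
  then show ?thesis using T by (simp add: attractor_def Int_commute)
qed

text \<open>Each point of \<open>K\<close> has a connected, relatively open neighbourhood of maxima,
  which lies in the component \<open>K\<close>; so \<open>K\<close> is open in the critical set.
  Locally constant values are constant on the connected \<open>K\<close>, and compactness comes from
  the path.\<close>

lemma attractor_curve:
  assumes "K \<in> curves_of_maxima \<Omega> u" shows "attractor K"
proof -
  obtain g where g: "simple_path g" "path_image g = K" and K: "K \<in> components (local_maxima \<Omega> u)"
    using assms by (auto simp: curves_of_maxima_def simple_closed_curve_def)
  have KM: "K \<subseteq> local_maxima \<Omega> u" "K \<noteq> {}" "connected K"
    using K in_components_subset in_components_nonempty in_components_connected by blast+
  have "compact K" using g compact_simple_path_image by blast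
  have loc: "\<exists>T. openin (top_of_set (critical_points \<Omega> u)) T \<and> p \<in> T \<and> T \<subseteq> K
      \<and> (\<forall>x\<in>T. u x = u p)" if p: "p \<in> K" for p
  proof (rule u_locally_constant_on_maxima[of p])
    show "p \<in> local_maxima \<Omega> u" using p KM by blast
    fix T assume T: "openin (top_of_set (critical_points \<Omega> u)) T" "p \<in> T" "T \<subseteq> local_maxima \<Omega> u" "connected T"
      "\<And>x. x \<in> T \<Longrightarrow> u x = u p"
    have "T \<subseteq> K" using components_maximal[OF K T(4,3)] T(2) p by blast
    then show ?thesis using T by blast
  qed
  have "openin (top_of_set (critical_points \<Omega> u)) K"
    by (subst openin_subopen) (use loc in blast)
  moreover have "u constant_on K"
  proof (rule locally_constant_imp_constant[OF KM(3)])
    fix p assume "p \<in> K"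
    then obtain T where T: "openin (top_of_set (critical_points \<Omega> u)) T" "p \<in> T" "T \<subseteq> K" "\<forall>x\<in>T. u x = u p"
      using loc by blast
    have "openin (top_of_set K) T"
      by (rule openin_subset_trans[OF T(1,3)]) (use KM local_maxima_critical in blast)
    then show "\<exists>T. openin (top_of_set K) T \<and> p \<in> T \<and> (\<forall>x\<in>T. u x = u p)" using T by blast
  qed
  ultimately show ?thesis using KM \<open>compact K\<close> unfolding attractor_def constant_on_def by blast
qed

text \<open>Maxima and minima are open in the critical set, so the saddle points form a compact set,
  and it is discrete.\<close>

lemma finite_saddles: "finite (saddle_points \<Omega> u)"
proof -
  have "saddle_points \<Omega> u = critical_points \<Omega> u - local_maxima \<Omega> u - local_maxima \<Omega> (\<lambda>x. - u x)"
    by (auto simp: saddle_points_def local_minima_minus)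
  moreover have "closed (critical_points \<Omega> u - local_maxima \<Omega> u)"
    by (rule closed_critical_minus[OF local_maxima_openin])
  moreover have "closed (critical_points \<Omega> u - local_maxima \<Omega> (\<lambda>x. - u x))"
    using dirichlet_eigenfunction.closed_critical_minus[OF neg dirichlet_eigenfunction.local_maxima_openin[OF neg]]
    by (simp add: critical_points_minus)
  ultimately have "closed (saddle_points \<Omega> u)"
    using closed_Int by (metis Diff_Int2 Diff_Int_distrib2 Int_Diff Int_absorb)
  then have c: "compact (saddle_points \<Omega> u)"
    using compact_critical_points compact_Int_closed[of "critical_points \<Omega> u" "saddle_points \<Omega> u"]
    by (metis Diff_subset inf.absorb2 saddle_points_def)
  have "p isolated_in saddle_points \<Omega> u" if p: "p \<in> saddle_points \<Omega> u" for p
  proof -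
    obtain V where "open V" "critical_points \<Omega> u \<inter> V = {p}" using saddle_isolated[OF p] by blast
    then have "open V" "V \<inter> saddle_points \<Omega> u = {p}" using p by (auto simp: saddle_points_def)
    then show ?thesis using p by (auto simp: isolated_in_def)
  qed
  then show ?thesis using c discrete_compact_finite_iff[of "saddle_points \<Omega> u"] by (auto intro: discreteI)
qed

lemma saddle_closed_minus:
  assumes "p \<in> saddle_points \<Omega> u" shows "closed (critical_points \<Omega> u - {p})"
proof -
  obtain V where "open V" "critical_points \<Omega> u \<inter> V = {p}" using saddle_isolated[OF assms] by blast
  then have "openin (top_of_set (critical_points \<Omega> u)) {p}" using openin_open by metis
  then show ?thesis by (rule closed_critical_minus)
qed

end

context gradient_semiflow
begin

text \<open>A saddle point is isolated among the critical points, and for a singleton the distance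
  tending to 0 is convergence.\<close>

lemma saddle_limit:
  assumes "stays x" "limit_pt x q" "q \<in> saddle_points \<Omega> u"
  shows "x \<in> asc q"
  using tends_to_set_if_limit_pt[OF assms(1,2), of "{q}"] saddle_closed_minus[OF assms(3)] assms(1)
  by (simp add: asc_def tends_to_singleton)

text \<open>Along the orbit \<open>u\<close> stays strictly below \<open>u q\<close>, yet the orbit
  comes arbitrarily close to \<open>q\<close>.\<close>

lemma limit_pt_not_minimum:
  assumes "stays x" "limit_pt x q" "grad u x \<noteq> 0"
  shows "q \<notin> local_minima \<Omega> u"
proof
  assume "q \<in> local_minima \<Omega> u"
  then have ev: "\<forall>\<^sub>F y in nhds q. u q \<le> u y" by (simp add: local_minima_def)
  obtain f where f: "filterlim f at_top sequentially" "(\<lambda>n::nat. \<Phi> (f n) x) \<longlonglongrightarrow> q"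
    using assms(2) by (auto simp: limit_pt_def)
  have "\<forall>\<^sub>F n in sequentially. u q \<le> u (\<Phi> (f n) x)" using f(2) ev unfolding filterlim_iff by blast
  moreover have "\<forall>\<^sub>F n in sequentially. f n \<ge> 0" using f(1) by (simp add: filterlim_at_top)
  ultimately have "\<forall>\<^sub>F n in sequentially. False"
    by eventually_elim (use u_flow_less_limit_pt[OF assms(1,2) _ assms(3)] in fastforce)
  then show False by simp
qed

lemma stays_closure_basin:
  assumes K: "attractor K" and x: "x \<in> closure (basin K)"
  shows "stays x"
  unfolding stays_def
proof (intro allI impI)
  fix t :: real assume t: "t \<ge> 0"
  have "\<Phi> t ` closure (basin K) \<subseteq> closure \<Omega>"
  proof (rule image_closure_subset)
    show "continuous_on (closure (basin K)) (\<Phi> t)" using flow_continuous[OF t] continuous_on_subset by blast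
    show "\<Phi> t ` basin K \<subseteq> closure \<Omega>" using basin_stays[OF K] t by (auto simp: stays_def)
  qed simp
  then show "\<Phi> t x \<in> closure \<Omega>" using x by blast
qed

lemma boundary_of_basin_in_neumann_line_set:
  assumes K: "attractor K" and x: "x \<in> \<Omega>" "x \<notin> neumann_line_set \<Omega> u" "x \<in> closure (basin K)"
  shows "x \<in> basin K"
proof -
  have st: "stays x" by (rule stays_closure_basin[OF K x(3)])
  have xC: "x \<notin> critical_points \<Omega> u" using x(2) by (simp add: neumann_line_set_def)
  then have gx: "grad u x \<noteq> 0" using x(1) closure_subset by (auto simp: critical_points_def)
  have KM: "K \<subseteq> local_maxima \<Omega> u" "compact K" using K by (auto simp: attractor_def)
  obtain q where q: "limit_pt x q" using ex_limit_pt[OF st] by blast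
  have qC: "q \<in> critical_points \<Omega> u" by (rule limit_pt_critical[OF st q])
  have "q \<notin> local_minima \<Omega> u" by (rule limit_pt_not_minimum[OF st q gx])
  then consider "q \<in> K" | "q \<in> local_maxima \<Omega> u" "q \<notin> K" | "q \<in> saddle_points \<Omega> u"
    using qC by (auto simp: saddle_points_def)
  then show ?thesis
  proof cases
    case 1
    have "tends_to_set x K"
      using K by (intro tends_to_set_if_limit_pt[OF st q 1 KM(2)] closed_critical_minus) (simp add: attractor_def)
    then show ?thesis using x(1) by (simp add: basin_def)
  next
    case 2
    \<comment> \<open>The remaining maxima at the level of \<open>q\<close> attract
      \<open>x\<close>; their open basin would contain points of \<open>basin K\<close> near
      \<open>x\<close>, although the two attractors are disjoint.\<close>
    define K' where "K' = {z \<in> local_maxima \<Omega> u. u z = u q} - K"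
    have qK': "q \<in> K'" using 2 by (simp add: K'_def)
    then have K': "attractor K'" using attractor_level[of "u q" K] K by (auto simp: K'_def)
    then have "tends_to_set x K'"
      by (intro tends_to_set_if_limit_pt[OF st q qK'] closed_critical_minus) (auto simp: attractor_def)
    then have "x \<in> basin K'" using x(1) by (simp add: basin_def)
    then have "basin K' \<inter> basin K \<noteq> {}"
      using x(3) open_basin[OF K'] open_Int_closure_eq_empty[of "basin K'" "basin K"] by blast
    then have "K' \<inter> K \<noteq> {}" using basins_meet[OF K' K] by blast
    then show ?thesis by (auto simp: K'_def)
  next
    case 3
    define L where "L = stable_set \<Omega> u q \<union> unstable_set \<Omega> u q"
    have "x \<in> unstable_set \<Omega> u q" using saddle_limit[OF st q 3] by (simp add: unstable_set_eq_asc)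
    then have "x \<in> L" by (simp add: L_def)
    have "x \<notin> frontier L"
    proof
      assume "x \<in> frontier L"
      moreover have "x \<notin> frontier \<Omega>" using x(1) open_\<Omega> by (simp add: frontier_def interior_open)
      ultimately have "x \<in> (\<Union>r\<in>saddle_points \<Omega> u. frontier (stable_set \<Omega> u r \<union> unstable_set \<Omega> u r)) - frontier \<Omega>"
        using 3 by (auto simp: L_def)
      then have "x \<in> neumann_line_set \<Omega> u"
        unfolding neumann_line_set_def by (intro UnI1 subsetD[OF closure_subset])
      then show False using x(2) by simp
    qed
    then have xL: "x \<in> interior L" using \<open>x \<in> L\<close> subsetD[OF closure_subset, of x L] by (simp add: frontier_def)
    have "u x < u q" using u_flow_less_limit_pt[OF st q _ gx, of 0] by simp
    \<comment> \<open>In \<open>S\<close> the values are below \<open>u q\<close>, which shuts out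
      the stable half of \<open>L\<close>: a point of \<open>S\<close> must ascend to
      \<open>q\<close>, while a point of \<open>basin K\<close> can only ascend to
      \<open>K\<close>.\<close>
    define S where "S = interior L \<inter> (\<Omega> \<inter> u -` {..<u q})"
    have "open (\<Omega> \<inter> u -` {..<u q})"
      by (rule continuous_open_preimage[OF continuous_on_subset[OF continuous_u closure_subset] open_\<Omega>]) simp
    then have "open S" unfolding S_def by (rule open_Int[OF open_interior])
    moreover have "x \<in> S" using xL x(1) \<open>u x < u q\<close> by (simp add: S_def)
    ultimately have "S \<inter> basin K \<noteq> {}"
      using x(3) open_Int_closure_eq_empty[of S "basin K"] by blast
    then obtain y where y: "y \<in> S" "y \<in> basin K" by blast
    then have "y \<in> L" "u y < u q" using interior_subset by (auto simp: S_def)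
    then have "y \<in> asc q" using stable_set_le[of y q] unfolding L_def unstable_set_eq_asc by force
    then have "q \<in> K" by (rule basin_asc[OF K y(2)])
    then show ?thesis using KM 3 by (auto simp: saddle_points_def)
  qed
qed

lemma neumann_domain_subset_basin:
  assumes K: "attractor K" and D: "D \<in> neumann_domains \<Omega> u" "D \<inter> basin K \<noteq> {}"
  shows "D \<subseteq> basin K"
proof -
  have D': "connected D" "D \<subseteq> \<Omega> - neumann_line_set \<Omega> u"
    using D(1) in_components_connected in_components_subset unfolding neumann_domains_def by blast+
  have "D \<inter> closure (basin K) = D \<inter> basin K"
    using boundary_of_basin_in_neumann_line_set[OF K] D'(2) closure_subset[of "basin K"] by blast
  then have "D \<inter> frontier (basin K) = {}"
    using open_basin[OF K] by (auto simp: frontier_def interior_open)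
  then show ?thesis using connected_Int_frontier[OF D'(1) D(2)] by blast
qed

lemma basin_minus_neumann_line_set:
  assumes K: "attractor K" shows "basin K - neumann_line_set \<Omega> u \<noteq> {}"
proof -
  have KM: "K \<subseteq> local_maxima \<Omega> u" "K \<noteq> {}" using K by (auto simp: attractor_def)
  have basin\<Omega>: "basin K \<subseteq> \<Omega>" by (auto simp: basin_def)
  define L where "L r = stable_set \<Omega> u r \<union> unstable_set \<Omega> u r" for r
  \<comment> \<open>An open set on one side of each \<open>L r\<close> contains no frontier point of
    it and, being open, also misses the closure of the union of these frontiers.\<close>
  have avoid: "\<exists>x. x \<in> basin K - neumann_line_set \<Omega> u"
    if O: "open O'" "O' \<noteq> {}" "O' \<subseteq> basin K - critical_points \<Omega> u"
      "\<And>r. r \<in> saddle_points \<Omega> u \<Longrightarrow> O' \<inter> L r = {} \<or> O' \<subseteq> L r" for O'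
  proof -
    have "O' \<inter> frontier (L r) = {}" if r: "r \<in> saddle_points \<Omega> u" for r
      using O(4)[OF r]
    proof
      assume "O' \<inter> L r = {}"
      then have "O' \<inter> closure (L r) = {}" using open_Int_closure_eq_empty[OF O(1)] by blast
      then show ?thesis by (auto simp: frontier_def)
    next
      assume "O' \<subseteq> L r"
      then have "O' \<subseteq> interior (L r)" using O(1) by (rule interior_maximal)
      then show ?thesis by (auto simp: frontier_def)
    qed
    then have "O' \<inter> ((\<Union>r\<in>saddle_points \<Omega> u. frontier (L r)) - frontier \<Omega>) = {}" by blast
    then have "O' \<inter> closure ((\<Union>r\<in>saddle_points \<Omega> u. frontier (L r)) - frontier \<Omega>) = {}"
      using open_Int_closure_eq_empty[OF O(1)] by blast
    then have "O' \<inter> neumann_line_set \<Omega> u = {}" using O(3) by (auto simp: neumann_line_set_def L_def)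
    then show ?thesis using O(2,3) by blast
  qed
  obtain X' L' \<Phi>' V' k' where "gradient_semiflow \<Omega> U (\<lambda>x. - u x) \<mu> X' L' \<Phi>' V' k'"
    by (rule dirichlet_eigenfunction.ex_gradient_semiflow[OF neg])
  then interpret n: gradient_semiflow \<Omega> U "\<lambda>x. - u x" \<mu> X' L' \<Phi>' V' k' .
  have stable: "stable_set \<Omega> u r = n.asc r" for r using n.stable_set_minus_eq_asc[of r] by simp
  \<comment> \<open>Points of \<open>basin K\<close> can ascend only to \<open>K\<close>, which
    contains no saddle points; so just the stable halves of the \<open>L r\<close> reach into the
    basin.\<close>
  have unstable: "y \<notin> unstable_set \<Omega> u r" if "y \<in> basin K" "r \<in> saddle_points \<Omega> u" for y r
    using basin_asc[OF K that(1), of r] KM that(2) by (auto simp: unstable_set_eq_asc saddle_points_def)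
  define E where "E = basin K - critical_points \<Omega> u"
  have oE: "open E" unfolding E_def
    using open_basin[OF K] compact_imp_closed[OF compact_critical_points] by (rule open_Diff)
  have "E \<noteq> {}"
  proof
    assume "E = {}"
    then have "basin K \<subseteq> interior (critical_points \<Omega> u)"
      using open_basin[OF K] by (intro interior_maximal) (auto simp: E_def)
    then show False using critical_points_empty_interior attractor_subset_basin[OF K] KM by auto
  qed
  \<comment> \<open>The minima of \<open>u\<close> with value \<open>- v\<close>, written as maxima
    of \<open>- u\<close> so that \<open>n.attractor\<close> and \<open>n.basin\<close>
    apply.\<close>
  define M where "M v = {z \<in> local_maxima \<Omega> (\<lambda>x. - u x). - u z = v}" for v
  have attr: "n.attractor (M v)" if "M v \<noteq> {}" for v
    using n.attractor_level[of v "{}"] that by (simp add: M_def)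
  \<comment> \<open>Points of \<open>E\<close> whose descending orbit leaves
    \<open>closure \<Omega>\<close> or is attracted by minima. Both conditions are open, and either
    one rules out convergence to a saddle point within \<open>closure \<Omega>\<close>.\<close>
  define O1 where "O1 = E \<inter> (\<Union>t\<in>{0..}. \<Phi>' t -` (- closure \<Omega>)) \<union> E \<inter> (\<Union>v\<in>{v. M v \<noteq> {}}. n.basin (M v))"
  show ?thesis
  proof (cases "O1 = {}")
    case False
    have "open O1"
      unfolding O1_def
      by (intro open_Un open_Int oE open_UN ballI open_vimage) (auto intro: n.flow_continuous n.open_basin attr)
    moreover have "O1 \<subseteq> basin K - critical_points \<Omega> u" by (auto simp: O1_def E_def)
    moreover have "O1 \<inter> L r = {}" if r: "r \<in> saddle_points \<Omega> u" for r
    proof -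
      have False if y: "y \<in> O1" "y \<in> n.asc r" for y
      proof -
        have "n.stays y" using y(2) by (simp add: n.asc_def)
        then obtain v where v: "M v \<noteq> {}" "y \<in> n.basin (M v)" using y(1) by (auto simp: O1_def n.stays_def)
        then have "r \<in> M v" using n.basin_asc[OF attr[OF v(1)] v(2) y(2)] by blast
        then show False using r by (auto simp: M_def saddle_points_def local_minima_minus)
      qed
      moreover have "y \<notin> unstable_set \<Omega> u r" if "y \<in> O1" for y
        using unstable[OF _ r] that by (auto simp: O1_def E_def)
      ultimately show ?thesis by (auto simp: L_def stable)
    qed
    ultimately show ?thesis using avoid[of O1] False by blast
  next
    case True
    have "\<forall>r\<in>saddle_points \<Omega> u. \<exists>e>0. \<forall>q\<in>critical_points \<Omega> u. dist q r \<le> e \<longrightarrow> q = r"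
    proof
      fix r assume r: "r \<in> saddle_points \<Omega> u"
      obtain V where V: "open V" "critical_points \<Omega> u \<inter> V = {r}" using saddle_isolated[OF r] by blast
      then obtain e where "e > 0" "cball r e \<subseteq> V" using open_contains_cball[of V] by blast
      then show "\<exists>e>0. \<forall>q\<in>critical_points \<Omega> u. dist q r \<le> e \<longrightarrow> q = r"
      proof (intro exI[of _ e] conjI ballI impI)
        fix q assume "q \<in> critical_points \<Omega> u" "dist q r \<le> e"
        then have "q \<in> critical_points \<Omega> u \<inter> V" using \<open>cball r e \<subseteq> V\<close> by (auto simp: dist_commute)
        then show "q = r" using V(2) by blast
      qed
    qed
    then obtain \<epsilon> where \<epsilon>: "\<And>r. r \<in> saddle_points \<Omega> u \<Longrightarrow> \<epsilon> r > 0"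
      "\<And>r q. r \<in> saddle_points \<Omega> u \<Longrightarrow> q \<in> critical_points \<Omega> u \<Longrightarrow> dist q r \<le> \<epsilon> r \<Longrightarrow> q = r"
      by metis
    \<comment> \<open>\<open>n.asc r\<close> need not be closed. Its points whose orbit is in the
      isolating ball from time \<open>m\<close> on form a closed set, and these sets exhaust it as
      \<open>m\<close> grows.\<close>
    define F where "F r m = (\<Inter>t\<in>{0..}. \<Phi>' t -` closure \<Omega>) \<inter> (\<Inter>t\<in>{real m..}. \<Phi>' t -` cball r (\<epsilon> r))" for r
        and m :: nat
    have F_asc: "x \<in> n.asc r" if r: "r \<in> saddle_points \<Omega> u" and x: "x \<in> F r m" for r m x
    proof -
      have st: "n.stays x" using x by (auto simp: F_def n.stays_def)
      have "\<exists>t\<ge>real i. \<Phi>' t x \<in> cball r (\<epsilon> r)" for i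
        using x by (intro exI[of _ "max (real i) (real m)"]) (auto simp: F_def)
      then obtain q where q: "n.limit_pt x q" "q \<in> cball r (\<epsilon> r)"
        using n.limit_pt_if_sequence[OF st closed_cball] by metis
      have "q \<in> critical_points \<Omega> u" using n.limit_pt_critical[OF st q(1)] by (simp add: critical_points_minus)
      then have "q = r" using \<epsilon>(2)[OF r] q(2) by (simp add: dist_commute)
      then show ?thesis using n.saddle_limit[OF st q(1)] r by (simp add: saddle_points_minus)
    qed
    define \<F> where "\<F> = (\<lambda>(r, m). F r m) ` (saddle_points \<Omega> u \<times> UNIV)"
    have "countable \<F>"
      unfolding \<F>_def by (intro countable_image countable_SIGMA countable_finite[OF finite_saddles]) auto
    moreover have "closed S" if "S \<in> \<F>" for S
    proof -
      have "closed (F r m)" for r m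
        unfolding F_def
        by (intro closed_Int closed_INT ballI closed_vimage closed_closure closed_cball n.flow_continuous) auto
      then show ?thesis using that by (auto simp: \<F>_def)
    qed
    \<comment> \<open>With \<open>O1\<close> empty, every descending orbit from \<open>E\<close>
      stays in \<open>closure \<Omega>\<close> and has no extremum as a limit point, so it converges
      to a saddle point.\<close>
    moreover have "E \<subseteq> \<Union>\<F>"
    proof
      fix y assume y: "y \<in> E"
      then have st: "n.stays y" using True by (auto simp: O1_def n.stays_def)
      have y\<Omega>: "y \<in> \<Omega>" "grad u y \<noteq> 0"
        using y basin\<Omega> closure_subset by (auto simp: E_def critical_points_def)
      then have gy: "grad (\<lambda>x. - u x) y \<noteq> 0" using grad_minus in_U by simp
      obtain q where q: "n.limit_pt y q" using n.ex_limit_pt[OF st] by blast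
      have qC: "q \<in> critical_points \<Omega> u" using n.limit_pt_critical[OF st q] by (simp add: critical_points_minus)
      have "q \<notin> local_maxima \<Omega> u" using n.limit_pt_not_minimum[OF st q gy] by (simp add: local_maxima_minus)
      moreover have "q \<notin> local_maxima \<Omega> (\<lambda>x. - u x)"
      proof
        assume "q \<in> local_maxima \<Omega> (\<lambda>x. - u x)"
        then have qM: "q \<in> M (- u q)" by (simp add: M_def)
        then have a: "n.attractor (M (- u q))" by (intro attr) auto
        then have "n.tends_to_set y (M (- u q))"
          by (intro n.tends_to_set_if_limit_pt[OF st q qM] n.closed_critical_minus) (auto simp: n.attractor_def)
        then have "y \<in> O1" using y y\<Omega> qM by (auto simp: O1_def n.basin_def)
        then show False using True by blast
      qed
      ultimately have qS: "q \<in> saddle_points \<Omega> u" using qC by (simp add: saddle_points_def local_minima_minus)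
      then have "y \<in> n.asc q" using n.saddle_limit[OF st q] by (simp add: saddle_points_minus)
      then have "((\<lambda>t. \<Phi>' t y) \<longlongrightarrow> q) at_top" by (simp add: n.asc_def)
      then have "\<forall>\<^sub>F t in at_top. dist (\<Phi>' t y) q < \<epsilon> q" using \<epsilon>(1)[OF qS] by (rule tendstoD)
      then obtain T where T: "\<And>t. t \<ge> T \<Longrightarrow> dist (\<Phi>' t y) q < \<epsilon> q"
        unfolding eventually_at_top_linorder by blast
      obtain m :: nat where "real m \<ge> T" using real_arch_simple by blast
      then have "\<Phi>' t y \<in> cball q (\<epsilon> q)" if "t \<ge> real m" for t
        using T[of t] that by (simp add: dist_commute)
      then have "y \<in> F q m" using st by (auto simp: F_def n.stays_def)
      then show "y \<in> \<Union>\<F>" using qS by (auto simp: \<F>_def)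
    qed
    ultimately have "\<exists>S\<in>\<F>. E \<inter> interior S \<noteq> {}"
      by (rule Baire_interior[OF oE \<open>E \<noteq> {}\<close>])
    then obtain S where S: "S \<in> \<F>" "E \<inter> interior S \<noteq> {}" by blast
    then obtain r m where r: "r \<in> saddle_points \<Omega> u" "S = F r m" by (auto simp: \<F>_def)
    have sub: "E \<inter> interior S \<subseteq> n.asc r" using F_asc[OF r(1)] r(2) interior_subset by blast
    \<comment> \<open>Limits are unique, so the open piece lies in \<open>L r\<close> and misses
      every other \<open>L r'\<close>.\<close>
    have "E \<inter> interior S \<inter> L r' = {} \<or> E \<inter> interior S \<subseteq> L r'" if r': "r' \<in> saddle_points \<Omega> u" for r'
    proof (cases "r' = r")
      case True
      then show ?thesis using sub by (auto simp: L_def stable)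
    next
      case False
      have "y \<notin> n.asc r'" if "y \<in> E \<inter> interior S" for y
      proof
        assume "y \<in> n.asc r'"
        then have "((\<lambda>t. \<Phi>' t y) \<longlongrightarrow> r') at_top" by (simp add: n.asc_def)
        moreover have "((\<lambda>t. \<Phi>' t y) \<longlongrightarrow> r) at_top" using subsetD[OF sub that] by (simp add: n.asc_def)
        ultimately show False using False tendsto_unique trivial_limit_at_top_linorder by blast
      qed
      moreover have "y \<notin> unstable_set \<Omega> u r'" if "y \<in> E \<inter> interior S" for y
        using unstable[OF _ r'] that by (auto simp: E_def)
      ultimately show ?thesis by (auto simp: L_def stable)
    qed
    moreover have "open (E \<inter> interior S)" using oE by (rule open_Int[OF _ open_interior])
    moreover have "E \<inter> interior S \<subseteq> basin K - critical_points \<Omega> u" by (auto simp: E_def)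
    ultimately have "\<exists>x. x \<in> basin K - neumann_line_set \<Omega> u" using S(2) by (intro avoid)
    then show ?thesis by blast
  qed
qed

lemma ex_neumann_domain_in_basin:
  assumes K: "attractor K"
  shows "\<exists>D \<in> neumann_domains \<Omega> u. D \<subseteq> basin K"
proof -
  obtain x where x: "x \<in> basin K" "x \<notin> neumann_line_set \<Omega> u" using basin_minus_neumann_line_set[OF K] by blast
  then have "x \<in> \<Omega> - neumann_line_set \<Omega> u" by (simp add: basin_def)
  then obtain D where "D \<in> neumann_domains \<Omega> u" "x \<in> D"
    unfolding neumann_domains_def using Union_components by (metis UnionE)
  then show ?thesis using neumann_domain_subset_basin[OF K] x by blast
qed

end

section \<open>Injection of the maxima into the Neumann domains\<close>

context dirichlet_eigenfunction
begin

text \<open>An isolated maximum on the curve would be open and closed in the connected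
  \<open>K\<close>, making \<open>K\<close> a single point; but a simple path separates the
  parameters 0 and 1/2, whereas 0 and 1 coincide on a loop.\<close>

lemma isolated_maximum_notin_curve:
  assumes p: "p \<in> isolated_maxima \<Omega> u" and K: "K \<in> curves_of_maxima \<Omega> u"
  shows "p \<notin> K"
proof
  assume pK: "p \<in> K"
  obtain T where T: "open T" "T \<inter> local_maxima \<Omega> u = {p}"
    using p by (auto simp: isolated_maxima_def isolated_in_def)
  obtain g where g: "simple_path g" "path_image g = K" and comp: "K \<in> components (local_maxima \<Omega> u)"
    using K by (auto simp: curves_of_maxima_def simple_closed_curve_def)
  have K': "connected K" "K \<subseteq> local_maxima \<Omega> u" using comp in_components_connected in_components_subset by blast+
  have "K \<inter> T = {p}" using K'(2) T(2) pK by blast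
  then have "openin (top_of_set K) {p}" using T(1) openin_open_Int by metis
  moreover have "closedin (top_of_set K) {p}" using pK by (simp add: closed_subset)
  ultimately have "K = {p}" using K'(1) unfolding connected_clopen by blast
  moreover have "g 0 \<in> K" "g (1/2) \<in> K" using g(2) by (auto simp: path_image_def)
  ultimately have "g 0 = g (1/2)" by simp
  moreover have "loop_free g" using g(1) by (simp add: simple_path_def)
  from this[unfolded loop_free_def, rule_format, of 0 "1/2"] have "g 0 \<noteq> g (1/2)" by auto
  ultimately show False by simp
qed

text \<open>One Neumann domain is chosen in each basin. A domain chosen twice would be a nonempty
  subset of two basins, so their attractors would meet; but distinct ones are disjoint.\<close>

lemma maxima_lepoll_neumann_domains:
  "isolated_maxima \<Omega> u <+> curves_of_maxima \<Omega> u \<lesssim> neumann_domains \<Omega> u"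
proof -
  obtain X L \<Phi> V k where "gradient_semiflow \<Omega> U u \<mu> X L \<Phi> V k"
    by (rule ex_gradient_semiflow)
  then interpret f: gradient_semiflow \<Omega> U u \<mu> X L \<Phi> V k .
  define A where "A = isolated_maxima \<Omega> u <+> curves_of_maxima \<Omega> u"
  define S :: "real^2 + (real^2) set \<Rightarrow> (real^2) set" where "S = case_sum (\<lambda>p. {p}) (\<lambda>K. K)"
  have attr: "attractor (S a)" if "a \<in> A" for a
    using that attractor_isolated attractor_curve by (auto simp: A_def S_def)
  have disj: "a = b" if ab: "a \<in> A" "b \<in> A" "S a \<inter> S b \<noteq> {}" for a b
  proof -
    have "K = K'" if "K \<in> curves_of_maxima \<Omega> u" "K' \<in> curves_of_maxima \<Omega> u" "K \<inter> K' \<noteq> {}" for K K'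
      using that components_nonoverlap[of K "local_maxima \<Omega> u" K'] by (auto simp: curves_of_maxima_def)
    moreover have "False" if "p \<in> isolated_maxima \<Omega> u" "K \<in> curves_of_maxima \<Omega> u" "{p} \<inter> K \<noteq> {}" for p K
      using isolated_maximum_notin_curve[OF that(1,2)] that(3) by simp
    ultimately show ?thesis
      using ab unfolding A_def S_def
      by (cases a; cases b) (simp_all add: Int_commute Inl_Inr_False image_iff Plus_def del: Int_insert_left
          Int_insert_right)
  qed
  have "\<forall>a\<in>A. \<exists>D. D \<in> neumann_domains \<Omega> u \<and> D \<subseteq> f.basin (S a)"
    using f.ex_neumann_domain_in_basin attr by blast
  then obtain D where D: "\<And>a. a \<in> A \<Longrightarrow> D a \<in> neumann_domains \<Omega> u" "\<And>a. a \<in> A \<Longrightarrow> D a \<subseteq> f.basin (S a)"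
    by metis
  have "inj_on D A"
  proof (rule inj_onI)
    fix a b assume ab: "a \<in> A" "b \<in> A" "D a = D b"
    have "D a \<noteq> {}" using D(1)[OF ab(1)] in_components_nonempty by (auto simp: neumann_domains_def)
    then obtain x where "x \<in> f.basin (S a)" "x \<in> f.basin (S b)" using D(2)[OF ab(1)] D(2)[OF ab(2)] ab(3) by blast
    then have "S a \<inter> S b \<noteq> {}" using f.basins_meet attr ab by blast
    then show "a = b" using disj ab by blast
  qed
  then show ?thesis using D(1) unfolding lepoll_def A_def by blast
qed

end

theorem corollary1p3:
  fixes \<Omega> U :: "(real^2) set" and u :: "real^2 \<Rightarrow> real" and \<mu> :: real
  assumes "open \<Omega>" and "connected \<Omega>" and "bounded \<Omega>"
    and "open U" and "closure \<Omega> \<subseteq> U" and "real_analytic_on u U"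
    and "\<forall>x\<in>\<Omega>. - laplacian u x = \<mu> * u x"
    and "\<forall>x\<in>frontier \<Omega>. u x = 0"
    and "\<exists>x\<in>\<Omega>. u x \<noteq> 0"
  shows "isolated_maxima \<Omega> u <+> curves_of_maxima \<Omega> u \<lesssim> neumann_domains \<Omega> u"
proof -
  interpret dirichlet_eigenfunction \<Omega> U u \<mu>
    using assms by unfold_locales auto
  show ?thesis by (rule maxima_lepoll_neumann_domains)
qed

end
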